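(* The Poisson bracket induced on $\mathbf T_{m+1}$ by ${\rm PB}_2({\rm A}_1,{\rm A}_2,{\rm S})$ and the Poisson bracket induced on $\mathbf T_{m+1}$ by ${\rm PB}_1({\rm R};\mathcal F)$ are compatible (every linear combination of them is a Poisson bracket), and every flow $\dot T=T\mathcal C_2-\mathcal C_1T$ generated by a Hamiltonian $\psi(T)=\varphi(T\mathcal F^{-1})$ with Ad-invariant $\varphi$ (with $\mathcal C_1=\frac12\mathcal F{\rm R}(\mathcal F^{-1}d\varphi(T\mathcal F^{-1}))$, $\mathcal C_2=\frac12{\rm R}(d\varphi(\mathcal F^{-1}T)\mathcal F^{-1})\mathcal F$) restricts to a Hamiltonian flow on $\mathbf T_{m+1}$ with respect to the bracket induced by ${\rm PB}_2({\rm A}_1,{\rm A}_2,{\rm S})$.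
   Context: Periodic lattice setting: $N\ge2$, $m\ge1$; $\mathfrak g=\{X(\lambda)\in gl(N)[\lambda,\lambda^{-1}]:\Omega X(\lambda)\Omega^{-1}=X(\omega\lambda)\}$, $\omega=e^{2\pi i/N}$, $\Omega=\mathrm{diag}(1,\omega,\dots,\omega^{N-1})$, matrix indices modulo $N$; $\langle X,Y\rangle$ = coefficient of $\lambda^0$ in $\mathrm{tr}(XY)$; graded pieces $\mathfrak g_p=\{\lambda^p\sum_{j-k\equiv p}x_{jk}E_{jk}\}$ with projections $P_0,P_{>0},P_{\ge0},P_{<0}$; ${\rm R}=P_{\ge0}-P_{<0}$, ${\rm R}_0=P_{>0}-P_{<0}$; $W$ linear, $W=W\circ P_0$, $W(E_{kk})=\sum_j\mathrm{sgn}(k-j)E_{jj}$; ${\rm A}_1={\rm R}_0+W$, ${\rm A}_2={\rm R}_0-W$, ${\rm S}=P_0-W$, ${\rm S}^*=P_0+W$. Gradient $\nabla\varphi$ via $\langle\nabla\varphi(L),M\rangle=\frac{d}{d\varepsilon}\varphi(L+\varepsilon M)|_0$, $d\varphi=L\nabla\varphi$, $d'\varphi=\nabla\varphi L$; Ad-invariant: $[\nabla\varphi(L),L]=0$. ${\rm PB}_2({\rm A}_1,{\rm A}_2,{\rm S})$: $\{\varphi,\psi\}_2=\frac12\langle{\rm A}_1(d'\varphi),d'\psi\rangle-\frac12\langle{\rm A}_2(d\varphi),d\psi\rangle+\frac12\langle{\rm S}(d\varphi),d'\psi\rangle-\frac12\langle{\rm S}^*(d'\varphi),d\psi\rangle$.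 $\alpha$ real, $\mathcal E=\lambda\sum_kE_{k+1,k}$, $\mathcal F=I-\alpha\mathcal E$; $[X,Y]^{(\mathcal F)}=X\mathcal FY-Y\mathcal FX$; ${\rm PB}_1({\rm R};\mathcal F)$: $\{\varphi,\psi\}_1=\frac12\langle[{\rm R}\nabla\varphi,\nabla\psi]^{(\mathcal F)}+[\nabla\varphi,{\rm R}\nabla\psi]^{(\mathcal F)},L\rangle$. $\mathbf T_{m+1}$ = set of $T=\mathcal E+\sum_kb_kE_{kk}+\sum_{j=1}^m\lambda^{-j}\sum_ka_k^{(j)}E_{k,k+j}$; it is a Poisson submanifold for both brackets. Hamiltonian flow: $\frac{d}{dt}f=\{H,f\}$. *)

theory Defs
  imports "HOL-Analysis.Analysis"
begin

text \<open>Elements of the (completed) twisted loop algebra: X p j k is the coefficient of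
  lambda^p in the (j,k) matrix entry, matrix indices 0..N-1 (taken modulo N).\<close>
type_synonym lser = "int \<Rightarrow> nat \<Rightarrow> nat \<Rightarrow> real"

text \<open>Twisted, bounded-below Laurent series (formal completion of g in positive powers of lambda).\<close>
definition ser :: "nat \<Rightarrow> lser \<Rightarrow> bool" where
  "ser N X \<longleftrightarrow> (\<exists>a. \<forall>p<a. \<forall>j k. X p j k = 0) \<and>
     (\<forall>p j k. X p j k \<noteq> 0 \<longrightarrow> j < N \<and> k < N \<and> (int j - int k - p) mod int N = 0)"

definition loopalg :: "nat \<Rightarrow> lser \<Rightarrow> bool" where
  "loopalg N X \<longleftrightarrow> ser N X \<and> finite {p. \<exists>j k. X p j k \<noteq> 0}"

definition lzero :: lser where "lzero = (\<lambda>p j k. 0)"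
definition ladd :: "lser \<Rightarrow> lser \<Rightarrow> lser" where "ladd X Y = (\<lambda>p j k. X p j k + Y p j k)"
definition lsub :: "lser \<Rightarrow> lser \<Rightarrow> lser" where "lsub X Y = (\<lambda>p j k. X p j k - Y p j k)"
definition lscale :: "real \<Rightarrow> lser \<Rightarrow> lser" where "lscale c X = (\<lambda>p j k. c * X p j k)"

text \<open>Product (finite sums for bounded-below series).\<close>
definition lmul :: "nat \<Rightarrow> lser \<Rightarrow> lser \<Rightarrow> lser" where
  "lmul N X Y = (\<lambda>p j k. \<Sum>q\<in>{q. X q \<noteq> (\<lambda>_ _. 0) \<and> Y (p - q) \<noteq> (\<lambda>_ _. 0)}.
                       \<Sum>l<N. X q j l * Y (p - q) l k)"

definition lpair :: "nat \<Rightarrow> lser \<Rightarrow> lser \<Rightarrow> real" where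
  "lpair N X Y = (\<Sum>j<N. lmul N X Y 0 j j)"

definition lbr :: "nat \<Rightarrow> lser \<Rightarrow> lser \<Rightarrow> lser" where
  "lbr N X Y = lsub (lmul N X Y) (lmul N Y X)"

definition lbrF :: "nat \<Rightarrow> lser \<Rightarrow> lser \<Rightarrow> lser \<Rightarrow> lser" where
  "lbrF N F X Y = lsub (lmul N X (lmul N F Y)) (lmul N Y (lmul N F X))"

definition lI :: "nat \<Rightarrow> lser" where
  "lI N = (\<lambda>p j k. if p = 0 \<and> j = k \<and> j < N then 1 else 0)"

definition lE :: "nat \<Rightarrow> lser" where
  "lE N = (\<lambda>p j k. if p = 1 \<and> j < N \<and> k < N \<and> j = (k + 1) mod N then 1 else 0)"

definition lF :: "nat \<Rightarrow> real \<Rightarrow> lser" where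
  "lF N \<alpha> = lsub (lI N) (lscale \<alpha> (lE N))"

definition lFinv :: "nat \<Rightarrow> real \<Rightarrow> lser" where
  "lFinv N \<alpha> = (THE Y. ser N Y \<and> lmul N (lF N \<alpha>) Y = lI N \<and> lmul N Y (lF N \<alpha>) = lI N)"

definition P0 :: "lser \<Rightarrow> lser" where "P0 X = (\<lambda>p. if p = 0 then X p else (\<lambda>_ _. 0))"
definition Ppos :: "lser \<Rightarrow> lser" where "Ppos X = (\<lambda>p. if p > 0 then X p else (\<lambda>_ _. 0))"
definition Pge :: "lser \<Rightarrow> lser" where "Pge X = (\<lambda>p. if p \<ge> 0 then X p else (\<lambda>_ _. 0))"
definition Pneg :: "lser \<Rightarrow> lser" where "Pneg X = (\<lambda>p. if p < 0 then X p else (\<lambda>_ _. 0))"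

definition Rop :: "lser \<Rightarrow> lser" where "Rop X = lsub (Pge X) (Pneg X)"
definition R0op :: "lser \<Rightarrow> lser" where "R0op X = lsub (Ppos X) (Pneg X)"

definition Wop :: "nat \<Rightarrow> lser \<Rightarrow> lser" where
  "Wop N X = (\<lambda>p j l. if p = 0 \<and> j = l \<and> j < N
                      then (\<Sum>k<N. sgn (real k - real j) * X 0 k k) else 0)"

definition A1op :: "nat \<Rightarrow> lser \<Rightarrow> lser" where "A1op N X = ladd (R0op X) (Wop N X)"
definition A2op :: "nat \<Rightarrow> lser \<Rightarrow> lser" where "A2op N X = lsub (R0op X) (Wop N X)"
definition Sop :: "nat \<Rightarrow> lser \<Rightarrow> lser" where "Sop N X = lsub (P0 X) (Wop N X)"
definition Sstarop :: "nat \<Rightarrow> lser \<Rightarrow> lser" where "Sstarop N X = ladd (P0 X) (Wop N X)"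

text \<open>PB_2(A1,A2,S) at L, in terms of the gradients Gf, Gg of the two functions at L.\<close>
definition pb2 :: "nat \<Rightarrow> lser \<Rightarrow> lser \<Rightarrow> lser \<Rightarrow> real" where
  "pb2 N L Gf Gg =
     (let df = lmul N L Gf; df' = lmul N Gf L; dg = lmul N L Gg; dg' = lmul N Gg L in
      lpair N (A1op N df') dg' / 2 - lpair N (A2op N df) dg / 2
      + lpair N (Sop N df) dg' / 2 - lpair N (Sstarop N df') dg / 2)"

definition pb1 :: "nat \<Rightarrow> real \<Rightarrow> lser \<Rightarrow> lser \<Rightarrow> lser \<Rightarrow> real" where
  "pb1 N \<alpha> L Gf Gg =
     lpair N (ladd (lbrF N (lF N \<alpha>) (Rop Gf) Gg) (lbrF N (lF N \<alpha>) Gf (Rop Gg))) L / 2"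

text \<open>Coordinates on T_{m+1}: (0,k) is b_k, (j,k) with 1 \<le> j \<le> m is a_k^(j).\<close>
definition coords :: "nat \<Rightarrow> nat \<Rightarrow> (nat \<times> nat) set" where
  "coords N m = {(j, k). j \<le> m \<and> k < N}"

definition cbasis :: "nat \<Rightarrow> nat \<times> nat \<Rightarrow> lser" where
  "cbasis N c = (case c of (j, k) \<Rightarrow>
     (\<lambda>p r s. if p = - int j \<and> r = k \<and> s = (k + j) mod N then 1 else 0))"

text \<open>Dual element (w.r.t. the pairing) of a coordinate: E_kk, resp. lambda^j E_{k+j,k}.\<close>
definition cdual :: "nat \<Rightarrow> nat \<times> nat \<Rightarrow> lser" where
  "cdual N c = (case c of (j, k) \<Rightarrow>
     (\<lambda>p r s. if p = int j \<and> r = (k + j) mod N \<and> s = k then 1 else 0))"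

definition coord :: "nat \<Rightarrow> nat \<times> nat \<Rightarrow> lser \<Rightarrow> real" where
  "coord N c V = (case c of (j, k) \<Rightarrow> V (- int j) k ((k + j) mod N))"

definition Tpt :: "nat \<Rightarrow> nat \<Rightarrow> (nat \<times> nat \<Rightarrow> real) \<Rightarrow> lser" where
  "Tpt N m x = (\<lambda>p r s. lE N p r s + (\<Sum>c\<in>coords N m. x c * cbasis N c p r s))"

definition tangentT :: "nat \<Rightarrow> nat \<Rightarrow> lser \<Rightarrow> bool" where
  "tangentT N m V \<longleftrightarrow> V = (\<lambda>p r s. \<Sum>c\<in>coords N m. coord N c V * cbasis N c p r s)"

definition pd :: "((nat \<times> nat \<Rightarrow> real) \<Rightarrow> real) \<Rightarrow> nat \<times> nat \<Rightarrow> (nat \<times> nat \<Rightarrow> real) \<Rightarrow> real" where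
  "pd f c x = deriv (\<lambda>t. f (x(c := t))) (x c)"

fun iter_pd :: "(nat \<times> nat) list \<Rightarrow> ((nat \<times> nat \<Rightarrow> real) \<Rightarrow> real) \<Rightarrow> (nat \<times> nat \<Rightarrow> real) \<Rightarrow> real" where
  "iter_pd [] f = f"
| "iter_pd (c # cs) f = pd (iter_pd cs f) c"

definition smoothT :: "nat \<Rightarrow> nat \<Rightarrow> ((nat \<times> nat \<Rightarrow> real) \<Rightarrow> real) \<Rightarrow> bool" where
  "smoothT N m f \<longleftrightarrow>
     (\<forall>x y. (\<forall>c\<in>coords N m. x c = y c) \<longrightarrow> f x = f y) \<and>
     (\<forall>cs. set cs \<subseteq> coords N m \<longrightarrow>
        continuous_on UNIV (iter_pd cs f) \<and>
        (\<forall>c\<in>coords N m. \<forall>x. (\<lambda>t. iter_pd cs f (x(c := t))) differentiable (at (x c))))"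

text \<open>Gradient (in g) of the canonical extension L \<mapsto> f(coordinates of L).\<close>
definition gradT :: "nat \<Rightarrow> nat \<Rightarrow> ((nat \<times> nat \<Rightarrow> real) \<Rightarrow> real) \<Rightarrow> (nat \<times> nat \<Rightarrow> real) \<Rightarrow> lser" where
  "gradT N m f x = (\<lambda>p r s. \<Sum>c\<in>coords N m. pd f c x * cdual N c p r s)"

definition ib2 :: "nat \<Rightarrow> nat \<Rightarrow> ((nat \<times> nat \<Rightarrow> real) \<Rightarrow> real) \<Rightarrow> ((nat \<times> nat \<Rightarrow> real) \<Rightarrow> real)
                     \<Rightarrow> (nat \<times> nat \<Rightarrow> real) \<Rightarrow> real" where
  "ib2 N m f g x = pb2 N (Tpt N m x) (gradT N m f x) (gradT N m g x)"

definition ib1 :: "nat \<Rightarrow> nat \<Rightarrow> real \<Rightarrow> ((nat \<times> nat \<Rightarrow> real) \<Rightarrow> real) \<Rightarrow> ((nat \<times> nat \<Rightarrow> real) \<Rightarrow> real)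
                     \<Rightarrow> (nat \<times> nat \<Rightarrow> real) \<Rightarrow> real" where
  "ib1 N m \<alpha> f g x = pb1 N \<alpha> (Tpt N m x) (gradT N m f x) (gradT N m g x)"

definition poissonT :: "nat \<Rightarrow> nat \<Rightarrow> (((nat \<times> nat \<Rightarrow> real) \<Rightarrow> real) \<Rightarrow> ((nat \<times> nat \<Rightarrow> real) \<Rightarrow> real)
                        \<Rightarrow> (nat \<times> nat \<Rightarrow> real) \<Rightarrow> real) \<Rightarrow> bool" where
  "poissonT N m B \<longleftrightarrow>
    (\<forall>f g h a b. smoothT N m f \<and> smoothT N m g \<and> smoothT N m h \<longrightarrow>
       smoothT N m (B f g) \<and>
       B f (\<lambda>y. a * g y + b * h y) = (\<lambda>y. a * B f g y + b * B f h y) \<and>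
       B g f = (\<lambda>y. - B f g y) \<and>
       B f (\<lambda>y. g y * h y) = (\<lambda>y. B f g y * h y + g y * B f h y) \<and>
       (\<forall>y. B f (B g h) y + B g (B h f) y + B h (B f g) y = 0))"

end

theory Submission
  imports Defs
begin

text \<open>A twisted Laurent series is an N-periodic infinite matrix: the coefficient of lambda^p occupies
  the diagonal j - k = p. The trace over one period is cyclic and gives the pairing.

  On linear functionals the quadratic bracket is the image, under the left and right multiplications
  of L, of a skew operator on the doubled algebra which satisfies the modified Yang-Baxter equation;
  whence the Jacobi identity at every L. The Hamiltonian fields at a point L whose leading part is a
  multiple of the shift are tangent to the submanifold, so the identity restricts. For gradients of
  nonnegative grade the quadratic bracket at L + s F is the quadratic bracket at L plus s times the
  linear one, and L + s F again has a multiple of the shift as leading part. So all brackets of the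
  pencil satisfy the Jacobi identity, and so do all linear combinations.

  For the flows one needs that an invariant function satisfies G (F^-1 L F) = F^-1 G(L) F, although it
  is only assumed to be differentiable along lines. A matrix F is, up to a central factor, a product of
  transvections 1 + n with n^2 = 0, and conjugation by 1 + x n moves L along a parabola in a plane. A
  function on the plane that is differentiable along lines with vanishing derivative in the direction
  of these parabolas is constant along them, by a Baire category argument. Writing
  w = F^-1 L1 G(L1), L1 = T F^-1, the flow is then minus the Hamiltonian field of F^-1 G(L1), up to
  the commutator of T with a diagonal matrix that turns out to be scalar.\<close>

section \<open>Infinite band matrices\<close>

text \<open>Diagonals are only bounded below because the inverse of \<open>Fb \<alpha>\<close> is an
  infinite series in positive powers. Products are still finite sums, so \<open>band\<close> is a
  ring and identities between series become ring identities. The obstacle in the flows is that the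
  function has derivatives along lines only: no chain rule is available along a conjugation orbit,
  so invariance is proved for conjugations simple enough to stay in a plane. Transvections have
  determinant 1, whereas \<open>Fb \<alpha>\<close> has determinant 1 - \<alpha>^N lambda^N; a
  central N-th root of that series absorbs it. The shifted point L + s F has leading part (1 - s
  \<alpha>) E, which may vanish; hence tangency is proved for an arbitrary coefficient of the shift.
  The Jacobi expression of a combination is a quadratic form in its two coefficients, and three
  values of s suffice to annihilate it.\<close>

typedef band = "{M :: int \<Rightarrow> int \<Rightarrow> real. \<exists>a. \<forall>j k. j - k < a \<longrightarrow> M j k = 0}"
  morphisms ent Band
  by (rule exI[of _ "\<lambda>_ _. 0"]) simp

setup_lifting type_definition_band

lemma band_eqI: "(\<And>j k. ent A j k = ent B j k) \<Longrightarrow> A = B"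
  by (metis ent_inject ext)

definition grade_ge :: "int \<Rightarrow> band \<Rightarrow> bool" where
  "grade_ge a A \<longleftrightarrow> (\<forall>j k. j - k < a \<longrightarrow> ent A j k = 0)"

definition grade_le :: "int \<Rightarrow> band \<Rightarrow> bool" where
  "grade_le a A \<longleftrightarrow> (\<forall>j k. j - k > a \<longrightarrow> ent A j k = 0)"

lemma grade_geD: "grade_ge a A \<Longrightarrow> j - k < a \<Longrightarrow> ent A j k = 0"
  by (simp add: grade_ge_def)

lemma grade_leD: "grade_le a A \<Longrightarrow> j - k > a \<Longrightarrow> ent A j k = 0"
  by (simp add: grade_le_def)

lemma ent_bounded:
  obtains a where "grade_ge a A"
  using ent[of A] by (auto simp: grade_ge_def)

lemma sum_restrict_nonzero:
  fixes f g :: "int \<Rightarrow> real"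
  assumes "finite S" "\<And>l. f l \<noteq> 0 \<Longrightarrow> g l \<noteq> 0 \<Longrightarrow> l \<in> S"
  shows "(\<Sum>l\<in>{l. f l \<noteq> 0 \<and> g l \<noteq> 0}. f l * g l) = (\<Sum>l\<in>S. f l * g l)"
  using assms by (intro sum.mono_neutral_left) auto

instantiation band :: ring_1
begin
lift_definition zero_band :: band is "\<lambda>_ _. 0" by simp
lift_definition one_band :: band is "\<lambda>j k. if j = k then 1 else 0"
  by (rule exI[of _ 0]) simp
lift_definition plus_band :: "band \<Rightarrow> band \<Rightarrow> band" is "\<lambda>A B j k. A j k + B j k"
proof -
  fix A B :: "int \<Rightarrow> int \<Rightarrow> real"
  assume "\<exists>a. \<forall>j k. j - k < a \<longrightarrow> A j k = 0" "\<exists>a. \<forall>j k. j - k < a \<longrightarrow> B j k = 0"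
  then obtain a b where "\<forall>j k. j - k < a \<longrightarrow> A j k = 0" "\<forall>j k. j - k < b \<longrightarrow> B j k = 0" by auto
  then show "\<exists>a. \<forall>j k. j - k < a \<longrightarrow> A j k + B j k = 0"
    by (intro exI[of _ "min a b"]) auto
qed
lift_definition minus_band :: "band \<Rightarrow> band \<Rightarrow> band" is "\<lambda>A B j k. A j k - B j k"
proof -
  fix A B :: "int \<Rightarrow> int \<Rightarrow> real"
  assume "\<exists>a. \<forall>j k. j - k < a \<longrightarrow> A j k = 0" "\<exists>a. \<forall>j k. j - k < a \<longrightarrow> B j k = 0"
  then obtain a b where "\<forall>j k. j - k < a \<longrightarrow> A j k = 0" "\<forall>j k. j - k < b \<longrightarrow> B j k = 0" by auto
  then show "\<exists>a. \<forall>j k. j - k < a \<longrightarrow> A j k - B j k = 0"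
    by (intro exI[of _ "min a b"]) auto
qed
lift_definition uminus_band :: "band \<Rightarrow> band" is "\<lambda>A j k. - A j k" by simp
lift_definition times_band :: "band \<Rightarrow> band \<Rightarrow> band"
  is "\<lambda>A B j k. \<Sum>l\<in>{l. A j l \<noteq> 0 \<and> B l k \<noteq> 0}. A j l * B l k"
proof -
  fix A B :: "int \<Rightarrow> int \<Rightarrow> real"
  assume "\<exists>a. \<forall>j k. j - k < a \<longrightarrow> A j k = 0" "\<exists>a. \<forall>j k. j - k < a \<longrightarrow> B j k = 0"
  then obtain a b where ab: "\<And>j k. j - k < a \<Longrightarrow> A j k = 0" "\<And>j k. j - k < b \<Longrightarrow> B j k = 0" by auto
  have "{l. A j l \<noteq> 0 \<and> B l k \<noteq> 0} = {}" if "j - k < a + b" for j k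
  proof -
    have "A j l = 0 \<or> B l k = 0" for l
      using ab(1)[of j l] ab(2)[of l k] that by (cases "j - l < a") auto
    then show ?thesis by auto
  qed
  then show "\<exists>c. \<forall>j k. j - k < c \<longrightarrow> (\<Sum>l\<in>{l. A j l \<noteq> 0 \<and> B l k \<noteq> 0}. A j l * B l k) = 0"
    by (intro exI[of _ "a + b"] allI impI) (simp only: sum.empty)
qed

lemma times_band_ent:
  assumes "finite S" "\<And>l. ent A j l \<noteq> 0 \<Longrightarrow> ent B l k \<noteq> 0 \<Longrightarrow> l \<in> S"
  shows "ent (A * B) j k = (\<Sum>l\<in>S. ent A j l * ent B l k)"
  unfolding times_band.rep_eq by (rule sum_restrict_nonzero[OF assms])

text \<open>A nonzero term needs k + b \<le> l \<le> j - a. Any larger interval is allowed, so that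
  one index set can serve several products at once.\<close>

lemma times_band_ent_interval:
  assumes "grade_ge a A" "grade_ge b B"
    and "p \<le> k + b" "j - a \<le> q"
  shows "ent (A * B) j k = (\<Sum>l\<in>{p..q}. ent A j l * ent B l k)"
proof (rule times_band_ent)
  fix l assume "ent A j l \<noteq> 0" "ent B l k \<noteq> 0"
  then have "\<not> j - l < a" "\<not> l - k < b" using assms grade_geD by blast+
  then show "l \<in> {p..q}" using assms by auto
qed auto

instance
proof
  fix A B C :: band
  show "A + B + C = A + (B + C)" "A + B = B + A" "0 + A = A" "- A + A = 0" "A - B = A + - B"
    by (rule band_eqI, simp add: zero_band.rep_eq plus_band.rep_eq minus_band.rep_eq uminus_band.rep_eq)+
  have "ent 0 0 0 \<noteq> ent 1 0 0"
    by (simp add: zero_band.rep_eq one_band.rep_eq)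
  then show "(0::band) \<noteq> 1"
    by metis
  show "1 * A = A"
  proof (rule band_eqI)
    fix j k
    have "ent (1 * A) j k = (\<Sum>l\<in>{j}. ent 1 j l * ent A l k)"
      by (rule times_band_ent) (auto simp: one_band.rep_eq split: if_splits)
    then show "ent (1 * A) j k = ent A j k" by (simp add: one_band.rep_eq)
  qed
  show "A * 1 = A"
  proof (rule band_eqI)
    fix j k
    have "ent (A * 1) j k = (\<Sum>l\<in>{k}. ent A j l * ent 1 l k)"
      by (rule times_band_ent) (auto simp: one_band.rep_eq split: if_splits)
    then show "ent (A * 1) j k = ent A j k" by (simp add: one_band.rep_eq)
  qed
  obtain a where a: "grade_ge a A" using ent_bounded by blast
  obtain b where b: "grade_ge b B" using ent_bounded by blast
  obtain c where c: "grade_ge c C" using ent_bounded by blast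
  have ab: "grade_ge (a + b) (A * B)"
    using times_band_ent_interval[OF a b order_refl order_refl] by (simp add: grade_ge_def)
  have bc: "grade_ge (b + c) (B * C)"
    using times_band_ent_interval[OF b c order_refl order_refl] by (simp add: grade_ge_def)
  show "A * B * C = A * (B * C)"
  proof (rule band_eqI)
    fix j k
    \<comment> \<open>Neither interval depends on the other summation index, so the two sums can be
      interchanged.\<close>
    let ?L = "{k + c..j - a - b}" and ?I = "{k + b + c..j - a}"
    have "ent (A * B * C) j k = (\<Sum>l\<in>?L. ent (A * B) j l * ent C l k)"
      by (rule times_band_ent_interval[OF ab c]) auto
    also have "\<dots> = (\<Sum>l\<in>?L. (\<Sum>i\<in>?I. ent A j i * ent B i l) * ent C l k)"
      by (intro sum.cong refl arg_cong2[where f = "(*)"] times_band_ent_interval[OF a b]) auto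
    also have "\<dots> = (\<Sum>i\<in>?I. ent A j i * (\<Sum>l\<in>?L. ent B i l * ent C l k))"
      by (simp add: sum_distrib_left sum_distrib_right mult.assoc) (rule sum.swap)
    also have "\<dots> = (\<Sum>i\<in>?I. ent A j i * ent (B * C) i k)"
      by (intro sum.cong refl arg_cong2[where f = "(*)"] times_band_ent_interval[OF b c, symmetric]) auto
    also have "\<dots> = ent (A * (B * C)) j k"
      by (rule times_band_ent_interval[OF a bc, symmetric]) auto
    finally show "ent (A * B * C) j k = ent (A * (B * C)) j k" .
  qed
  have ab: "grade_ge (min a b) (A + B)"
    using a b by (simp add: plus_band.rep_eq grade_ge_def)
  have bc: "grade_ge (min b c) (B + C)"
    using c b by (simp add: plus_band.rep_eq grade_ge_def)
  show "(A + B) * C = A * C + B * C"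
  proof (rule band_eqI)
    fix j k
    let ?S = "{k + c..j - min a b}"
    have "ent ((A + B) * C) j k = (\<Sum>l\<in>?S. ent (A + B) j l * ent C l k)"
      by (rule times_band_ent_interval[OF ab c]) auto
    moreover have "ent (A * C) j k = (\<Sum>l\<in>?S. ent A j l * ent C l k)"
      by (rule times_band_ent_interval[OF a c]) auto
    moreover have "ent (B * C) j k = (\<Sum>l\<in>?S. ent B j l * ent C l k)"
      by (rule times_band_ent_interval[OF b c]) auto
    ultimately show "ent ((A + B) * C) j k = ent (A * C + B * C) j k"
      by (simp add: plus_band.rep_eq distrib_right sum.distrib)
  qed
  show "A * (B + C) = A * B + A * C"
  proof (rule band_eqI)
    fix j k
    let ?S = "{k + min b c..j - a}"
    have "ent (A * (B + C)) j k = (\<Sum>l\<in>?S. ent A j l * ent (B + C) l k)"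
      by (rule times_band_ent_interval[OF a bc]) auto
    moreover have "ent (A * B) j k = (\<Sum>l\<in>?S. ent A j l * ent B l k)"
      by (rule times_band_ent_interval[OF a b]) auto
    moreover have "ent (A * C) j k = (\<Sum>l\<in>?S. ent A j l * ent C l k)"
      by (rule times_band_ent_interval[OF a c]) auto
    ultimately show "ent (A * (B + C)) j k = ent (A * B + A * C) j k"
      by (simp add: plus_band.rep_eq distrib_left sum.distrib)
  qed
qed
end

instantiation band :: real_algebra_1
begin
lift_definition scaleR_band :: "real \<Rightarrow> band \<Rightarrow> band" is "\<lambda>r A j k. r * A j k" by auto
instance
proof
  fix A B :: band and r s :: real
  show "r *\<^sub>R (A + B) = r *\<^sub>R A + r *\<^sub>R B" "(r + s) *\<^sub>R A = r *\<^sub>R A + s *\<^sub>R A"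
    "r *\<^sub>R s *\<^sub>R A = (r * s) *\<^sub>R A" "1 *\<^sub>R A = A"
    by (rule band_eqI, simp add: plus_band.rep_eq scaleR_band.rep_eq algebra_simps)+
  obtain a where a: "grade_ge a A" using ent_bounded by blast
  obtain b where b: "grade_ge b B" using ent_bounded by blast
  have a': "grade_ge a (r *\<^sub>R A)" and b': "grade_ge b (r *\<^sub>R B)"
    using a b by (auto simp: scaleR_band.rep_eq grade_ge_def)
  show "r *\<^sub>R A * B = r *\<^sub>R (A * B)"
    by (rule band_eqI)
      (simp add: times_band_ent_interval[OF a b order_refl order_refl]
        times_band_ent_interval[OF a' b order_refl order_refl] scaleR_band.rep_eq sum_distrib_left mult.assoc)
  show "A * r *\<^sub>R B = r *\<^sub>R (A * B)"
    by (rule band_eqI)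
      (simp add: times_band_ent_interval[OF a b order_refl order_refl]
        times_band_ent_interval[OF a b' order_refl order_refl] scaleR_band.rep_eq sum_distrib_left mult.left_commute)
qed
end

lemmas ent_simps = zero_band.rep_eq one_band.rep_eq plus_band.rep_eq minus_band.rep_eq
  uminus_band.rep_eq scaleR_band.rep_eq

lemma ent_sum: "ent (sum f S) j k = (\<Sum>x\<in>S. ent (f x) j k)"
  by (induction S rule: infinite_finite_induct) (auto simp: ent_simps)

section \<open>Periodic matrices and the trace\<close>

definition per :: "nat \<Rightarrow> band \<Rightarrow> bool" where
  "per N A \<longleftrightarrow> (\<forall>j k. ent A (j + int N) (k + int N) = ent A j k)"

lemma perD: "per N A \<Longrightarrow> ent A (j + int N) (k + int N) = ent A j k"
  by (simp add: per_def)

lemma per_simps [simp]: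
  "per N 0" "per N 1" "per N A \<Longrightarrow> per N (- A)"
  "per N A \<Longrightarrow> per N B \<Longrightarrow> per N (A + B)"
  "per N A \<Longrightarrow> per N B \<Longrightarrow> per N (A - B)"
  "per N A \<Longrightarrow> per N (r *\<^sub>R A)"
  by (simp_all add: per_def ent_simps)

lemma per_sum [simp]: "(\<And>x. x \<in> S \<Longrightarrow> per N (f x)) \<Longrightarrow> per N (sum f S)"
  by (simp add: per_def ent_sum)

lemma per_mult [simp]:
  assumes "per N A" "per N B"
  shows "per N (A * B)"
  unfolding per_def
proof (intro allI)
  fix j k
  obtain a where a: "grade_ge a A" using ent_bounded by blast
  obtain b where b: "grade_ge b B" using ent_bounded by blast
  have "ent (A * B) (j + int N) (k + int N)
      = (\<Sum>l\<in>{k + int N + b..j + int N - a}. ent A (j + int N) l * ent B l (k + int N))"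
    by (rule times_band_ent_interval[OF a b]) auto
  also have "\<dots> = (\<Sum>l\<in>{k + b..j - a}. ent A j l * ent B l k)"
    by (rule sum.reindex_bij_witness[of _ "\<lambda>l. l + int N" "\<lambda>l. l - int N"])
      (use perD[OF assms(1)] perD[OF assms(2)] in \<open>auto simp: algebra_simps, metis diff_add_cancel\<close>)
  also have "\<dots> = ent (A * B) j k"
    by (rule times_band_ent_interval[OF a b, symmetric]) auto
  finally show "ent (A * B) (j + int N) (k + int N) = ent (A * B) j k" .
qed

lemma per_power [simp]: "per N A \<Longrightarrow> per N (A ^ n)"
  by (induction n) auto

lemma periodic_int_mult:
  fixes g :: "int \<Rightarrow> 'a"
  assumes "\<And>j. g (j + int N) = g j"
  shows "g (j + int N * i) = g j"
proof (induction i rule: int_induct[of _ 0])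
  case (step1 i)
  then show ?case using assms[of "j + int N * i"] by (simp add: algebra_simps)
next
  case (step2 i)
  then show ?case using assms[of "j + int N * (i - 1)"] by (simp add: algebra_simps)
qed simp

lemma per_mult_shift:
  assumes "per N A"
  shows "ent A (j + int N * i) (k + int N * i) = ent A j k"
proof -
  have "ent A (j + (x + int N)) (k + (x + int N)) = ent A (j + x) (k + x)" for x
    using perD[OF assms, of "j + x" "k + x"] by (simp add: add.assoc)
  from periodic_int_mult[of "\<lambda>x. ent A (j + x) (k + x)" N 0 i, OF this]
  show ?thesis by simp
qed

lemma periodic_sum_shift:
  fixes g :: "int \<Rightarrow> real"
  assumes "\<And>j. g (j + int N) = g j"
  shows "(\<Sum>j<N. g (int j + d)) = (\<Sum>j<N. g (int j))"
proof -
  have step: "(\<Sum>j<N. g (int j + (d + 1))) = (\<Sum>j<N. g (int j + d))" for d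
  proof -
    have "(\<Sum>j<N. g (int (Suc j) + d) - g (int j + d)) = g (int N + d) - g d"
      using sum_lessThan_telescope[of "\<lambda>j. g (int j + d)" N] by simp
    then show ?thesis using assms[of d] by (simp add: sum_subtractf algebra_simps)
  qed
  show ?thesis
  proof (induction d rule: int_induct[of _ 0])
    case (step2 i)
    then show ?case using step[of "i - 1"] by simp
  qed (use step in auto)
qed

lemma sum_shift_interval:
  fixes f :: "int \<Rightarrow> real"
  shows "(\<Sum>l\<in>{j + b..j - a}. f l) = (\<Sum>d\<in>{b..-a}. f (j + d))"
    and "(\<Sum>l\<in>{j + a..j - b}. f l) = (\<Sum>d\<in>{b..-a}. f (j - d))"
  by (rule sum.reindex_bij_witness[of _ "\<lambda>d. j + d" "\<lambda>l. l - j"]; simp)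
    (rule sum.reindex_bij_witness[of _ "\<lambda>d. j - d" "\<lambda>l. j - l"]; simp)

definition tr :: "nat \<Rightarrow> band \<Rightarrow> real" where
  "tr N A = (\<Sum>j<N. ent A (int j) (int j))"

lemma tr_simps [simp]:
  "tr N 0 = 0" "tr N (A + B) = tr N A + tr N B" "tr N (A - B) = tr N A - tr N B"
  "tr N (- A) = - tr N A" "tr N (r *\<^sub>R A) = r * tr N A"
  by (simp_all add: tr_def ent_simps sum.distrib sum_subtractf sum_negf sum_distrib_left)

lemma tr_sum: "tr N (sum f S) = (\<Sum>x\<in>S. tr N (f x))"
  by (induction S rule: infinite_finite_induct) auto

text \<open>Arranged by diagonals, A B contributes the entries (j, j + d) and (j + d, j), and B A
  the same pair read from j + d. By periodicity the base point can be moved by d within the sum over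
  a period; only finitely many d occur, since both factors have diagonals bounded below.\<close>

lemma tr_commute:
  assumes "per N A" "per N B"
  shows "tr N (A * B) = tr N (B * A)"
proof -
  obtain a where a: "grade_ge a A" using ent_bounded by blast
  obtain b where b: "grade_ge b B" using ent_bounded by blast
  have "tr N (A * B) = (\<Sum>j<N. \<Sum>l\<in>{int j + b..int j - a}. ent A (int j) l * ent B l (int j))"
    unfolding tr_def by (intro sum.cong refl times_band_ent_interval[OF a b]) auto
  also have "\<dots> = (\<Sum>j<N. \<Sum>d\<in>{b..-a}. ent A (int j) (int j + d) * ent B (int j + d) (int j))"
    by (simp only: sum_shift_interval(1))
  also have "\<dots> = (\<Sum>d\<in>{b..-a}. \<Sum>j<N. ent A (int j) (int j + d) * ent B (int j + d) (int j))"
    by (rule sum.swap)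
  also have "\<dots> = (\<Sum>d\<in>{b..-a}. \<Sum>j<N. ent A (int j - d) (int j) * ent B (int j) (int j - d))"
  proof (rule sum.cong[OF refl])
    fix d assume "d \<in> {b..-a}"
    define g where "g = (\<lambda>j. ent A j (j + d) * ent B (j + d) j)"
    have "g (j + int N) = g j" for j
      using perD[OF assms(1), of j "j + d"] perD[OF assms(2), of "j + d" j]
      by (simp add: g_def algebra_simps)
    from periodic_sum_shift[of g, OF this, of "- d"]
    show "(\<Sum>j<N. ent A (int j) (int j + d) * ent B (int j + d) (int j))
        = (\<Sum>j<N. ent A (int j - d) (int j) * ent B (int j) (int j - d))"
      by (simp add: g_def)
  qed
  also have "\<dots> = (\<Sum>j<N. \<Sum>d\<in>{b..-a}. ent B (int j) (int j - d) * ent A (int j - d) (int j))"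
    by (subst sum.swap) (simp add: mult.commute)
  also have "\<dots> = (\<Sum>j<N. \<Sum>l\<in>{int j + a..int j - b}. ent B (int j) l * ent A l (int j))"
    by (simp only: sum_shift_interval(2))
  also have "\<dots> = tr N (B * A)"
    unfolding tr_def by (intro sum.cong refl times_band_ent_interval[OF b a, symmetric]) auto
  finally show ?thesis .
qed

section \<open>Grading\<close>

lemma grade_ge_simps [simp]:
  "grade_ge a 0" "grade_ge a A \<Longrightarrow> grade_ge a B \<Longrightarrow> grade_ge a (A + B)"
  "grade_ge a A \<Longrightarrow> grade_ge a B \<Longrightarrow> grade_ge a (A - B)"
  "grade_ge a A \<Longrightarrow> grade_ge a (- A)" "grade_ge a A \<Longrightarrow> grade_ge a (r *\<^sub>R A)"
  by (simp_all add: grade_ge_def ent_simps)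

lemma grade_le_simps [simp]:
  "grade_le a 0" "grade_le a A \<Longrightarrow> grade_le a B \<Longrightarrow> grade_le a (A + B)"
  "grade_le a A \<Longrightarrow> grade_le a B \<Longrightarrow> grade_le a (A - B)"
  "grade_le a A \<Longrightarrow> grade_le a (- A)" "grade_le a A \<Longrightarrow> grade_le a (r *\<^sub>R A)"
  by (simp_all add: grade_le_def ent_simps)

lemma grade_ge_sum: "(\<And>x. x \<in> S \<Longrightarrow> grade_ge a (f x)) \<Longrightarrow> grade_ge a (sum f S)"
  by (simp add: grade_ge_def ent_sum)

lemma grade_le_sum: "(\<And>x. x \<in> S \<Longrightarrow> grade_le a (f x)) \<Longrightarrow> grade_le a (sum f S)"
  by (simp add: grade_le_def ent_sum)

lemma grade_ge_mono: "grade_ge a A \<Longrightarrow> b \<le> a \<Longrightarrow> grade_ge b A"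
  by (simp add: grade_ge_def)

lemma grade_le_mono: "grade_le a A \<Longrightarrow> a \<le> b \<Longrightarrow> grade_le b A"
  by (simp add: grade_le_def)

lemma grade_ge_mult:
  assumes "grade_ge a A" "grade_ge b B" "c \<le> a + b"
  shows "grade_ge c (A * B)"
  using times_band_ent_interval[OF assms(1,2) order_refl order_refl] assms(3)
  by (simp add: grade_ge_def)

lemma grade_le_mult:
  assumes "grade_le a A" "grade_le b B" "a + b \<le> c"
  shows "grade_le c (A * B)"
  unfolding grade_le_def
proof (intro allI impI)
  fix j k :: int assume "j - k > c"
  then have "ent (A * B) j k = (\<Sum>l\<in>{}. ent A j l * ent B l k)"
    using grade_leD[OF assms(1)] grade_leD[OF assms(2)] assms(3)
    by (intro times_band_ent) (auto, smt (verit))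
  then show "ent (A * B) j k = 0" by simp
qed

section \<open>Diagonal matrices and the splitting into positive, diagonal and negative
  parts\<close>

definition diagonal :: "band \<Rightarrow> bool" where
  "diagonal A \<longleftrightarrow> (\<forall>j k. j \<noteq> k \<longrightarrow> ent A j k = 0)"

lemma diagonal_simps [simp]:
  "diagonal 0" "diagonal 1" "diagonal A \<Longrightarrow> diagonal B \<Longrightarrow> diagonal (A + B)"
  "diagonal A \<Longrightarrow> diagonal B \<Longrightarrow> diagonal (A - B)"
  "diagonal A \<Longrightarrow> diagonal (- A)" "diagonal A \<Longrightarrow> diagonal (r *\<^sub>R A)"
  by (simp_all add: diagonal_def ent_simps)

lemma diagonal_iff: "diagonal A \<longleftrightarrow> grade_ge 0 A \<and> grade_le 0 A"
  by (auto simp: diagonal_def grade_ge_def grade_le_def) (metis diff_gt_0_iff_gt diff_less_0_iff_less linorder_neqE)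

lemma diagonal_grades: "diagonal A \<Longrightarrow> grade_ge 0 A" "diagonal A \<Longrightarrow> grade_le 0 A"
  by (simp_all add: diagonal_iff)

lemma diagonal_mult_left:
  assumes "diagonal A" shows "ent (A * B) j k = ent A j j * ent B j k"
proof -
  have "l \<in> {j}" if "ent A j l \<noteq> 0" for l
    using assms that by (metis diagonal_def singletonI)
  then have "ent (A * B) j k = (\<Sum>l\<in>{j}. ent A j l * ent B l k)"
    by (intro times_band_ent) simp_all
  then show ?thesis by simp
qed

lemma diagonal_mult_right:
  assumes "diagonal A" shows "ent (B * A) j k = ent B j k * ent A k k"
proof -
  have "l \<in> {k}" if "ent A l k \<noteq> 0" for l
    using assms that by (metis diagonal_def singletonI)
  then have "ent (B * A) j k = (\<Sum>l\<in>{k}. ent B j l * ent A l k)"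
    by (intro times_band_ent) simp_all
  then show ?thesis by simp
qed

lemma diagonal_commute:
  assumes "diagonal A" "diagonal B" shows "A * B = B * A"
proof (rule band_eqI)
  fix j k
  show "ent (A * B) j k = ent (B * A) j k"
    using assms by (cases "j = k") (simp_all add: diagonal_mult_left diagonal_def)
qed

lift_definition restr :: "int set \<Rightarrow> band \<Rightarrow> band"
  is "\<lambda>S A j k. if j - k \<in> S then A j k else 0" by auto

abbreviation "pos \<equiv> restr {0<..}"
abbreviation "zer \<equiv> restr {0}"
abbreviation "neg \<equiv> restr {..<0}"

lemma restr_simps:
  "restr S 0 = 0" "restr S (A + B) = restr S A + restr S B" "restr S (A - B) = restr S A - restr S B"
  "restr S (- A) = - restr S A" "restr S (r *\<^sub>R A) = r *\<^sub>R restr S A"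
  by (rule band_eqI, simp add: restr.rep_eq ent_simps)+

lemma per_restr [simp]: "per N A \<Longrightarrow> per N (restr S A)"
  by (simp add: per_def restr.rep_eq)

lemma diagonal_zer [simp]: "diagonal (zer A)"
  by (simp add: diagonal_def restr.rep_eq)

lemma grade_pos [simp]: "grade_ge 1 (pos A)" "grade_ge 0 (pos A)"
  by (auto simp: grade_ge_def restr.rep_eq)

lemma grade_neg [simp]: "grade_le (-1) (neg A)"
  by (auto simp: grade_le_def restr.rep_eq)

lemma triangular_decomposition: "A = pos A + zer A + neg A"
  by (rule band_eqI) (simp add: ent_simps restr.rep_eq)

lemma restr_graded:
  "grade_ge 1 A \<Longrightarrow> pos A = A" "grade_ge 1 A \<Longrightarrow> zer A = 0"
  "grade_le (-1) A \<Longrightarrow> pos A = 0" "grade_le (-1) A \<Longrightarrow> zer A = 0"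
  by (rule band_eqI; simp add: restr.rep_eq zero_band.rep_eq grade_ge_def grade_le_def)+

lemma tr_grade: "grade_ge 1 A \<Longrightarrow> tr N A = 0" "grade_le (-1) A \<Longrightarrow> tr N A = 0"
  by (simp_all add: tr_def grade_ge_def grade_le_def)

lemma tr_mult_grade:
  "grade_ge 1 A \<Longrightarrow> grade_ge 0 B \<Longrightarrow> tr N (A * B) = 0" "grade_ge 0 A \<Longrightarrow> grade_ge 1 B \<Longrightarrow> tr N (A * B) = 0"
  "grade_le (-1) A \<Longrightarrow> grade_le 0 B \<Longrightarrow> tr N (A * B) = 0" "grade_le 0 A \<Longrightarrow> grade_le (-1) B \<Longrightarrow> tr N (A * B) = 0"
  by (simp_all add: tr_grade grade_ge_mult[where c = 1] grade_le_mult[where c = "-1"])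

text \<open>The trace sees grade zero only, so each grade pairs with its negative.\<close>

lemma tr_mult_decomposition:
  "tr N (A * B) = tr N (pos A * neg B) + tr N (zer A * zer B) + tr N (neg A * pos B)"
proof -
  have z: "grade_ge 0 (zer M)" "grade_le 0 (zer M)" "grade_le 0 (neg M)" for M
    using diagonal_grades[OF diagonal_zer] grade_le_mono[OF grade_neg, of 0] by auto
  have "A * B = (pos A + zer A + neg A) * (pos B + zer B + neg B)"
    using triangular_decomposition by metis
  also have "tr N \<dots> = tr N (pos A * neg B) + tr N (zer A * zer B) + tr N (neg A * pos B)"
    by (simp add: distrib_left distrib_right tr_mult_grade z)
  finally show ?thesis .
qed

section \<open>The operator W on the diagonal entries\<close>

lift_definition Wb :: "nat \<Rightarrow> band \<Rightarrow> band"
  is "\<lambda>N A i l. if i = l then (\<Sum>k<N. sgn (real k - real_of_int (i mod int N)) * A (int k) (int k)) else 0"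
  by (rule exI[of _ 0]) simp

lemma Wb_simps:
  "Wb N 0 = 0" "Wb N (A + B) = Wb N A + Wb N B" "Wb N (A - B) = Wb N A - Wb N B"
  "Wb N (r *\<^sub>R A) = r *\<^sub>R Wb N A"
  by (rule band_eqI, simp add: Wb.rep_eq ent_simps sum.distrib sum_subtractf sum_distrib_left algebra_simps)+

lemma diagonal_Wb [simp]: "diagonal (Wb N A)"
  by (simp add: diagonal_def Wb.rep_eq)

lemma per_Wb [simp]: "per N (Wb N A)"
  by (simp add: per_def Wb.rep_eq)

lemma Wb_zer: "Wb N (zer A) = Wb N A"
  by (rule band_eqI) (simp add: Wb.rep_eq restr.rep_eq)

lemma tr_diagonal_mult: "diagonal A \<Longrightarrow> tr N (A * B) = (\<Sum>j<N. ent A (int j) (int j) * ent B (int j) (int j))"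
  by (simp add: tr_def diagonal_mult_left)

lemma Wb_skew: "tr N (Wb N A * B) = - tr N (Wb N B * A)"
proof -
  have "tr N (Wb N A * B) = (\<Sum>j<N. \<Sum>k<N. sgn (real k - real j) * (ent A (int k) (int k) * ent B (int j) (int j)))"
    by (simp add: tr_diagonal_mult Wb.rep_eq sum_distrib_right mult.assoc)
  also have "\<dots> = (\<Sum>j<N. \<Sum>k<N. sgn (real j - real k) * (ent A (int j) (int j) * ent B (int k) (int k)))"
    by (rule sum.swap)
  also have "\<dots> = (\<Sum>j<N. \<Sum>k<N. - (sgn (real k - real j) * (ent B (int k) (int k) * ent A (int j) (int j))))"
    by (intro sum.cong refl) (metis minus_diff_eq mult.commute mult_minus_left sgn_minus)
  also have "\<dots> = - tr N (Wb N B * A)"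
    by (simp add: tr_diagonal_mult Wb.rep_eq sum_distrib_right mult.assoc sum_negf)
  finally show ?thesis .
qed

text \<open>Between the rows j - 1 and j the sign changes only at k = j - 1 and k = j, by -1 each.
  Across the end of the period, from row N - 1 to row 0, it jumps by 2 at every k strictly between
  the ends, and the trace condition removes that constant. This identity explains the form of W: it
  fixes the coefficient of the shift in \<open>grade_le_hvf\<close> and makes the diagonal
  correction scalar in \<open>hvf_factorized\<close>.\<close>

lemma Wb_shift:
  assumes N: "N \<ge> 2" and "per N D" and tr0: "tr N D = 0"
  shows "ent (Wb N D) j j - ent (Wb N D) (j - 1) (j - 1) = - (ent D j j + ent D (j - 1) (j - 1))"
proof -
  define d where "d k = ent D (int k) (int k)" for k :: nat
  define r where "r = nat (j mod int N)"
  have r: "int r = j mod int N" "r < N"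
    using N by (auto simp: r_def nat_less_iff)
  have dj: "ent D i i = d s" if "int s = i mod int N" for i s
    using per_mult_shift[OF assms(2), of "int s" "i div int N" "int s"] that
    by (simp add: d_def)
  have sum0: "(\<Sum>k<N. d k) = 0"
    using tr0 by (simp add: tr_def d_def)
  show ?thesis
  proof (cases "r = 0")
    case True
    have j1: "int (N - 1) = (j - 1) mod int N"
    proof -
      have "(j - 1) mod int N = (j mod int N - 1) mod int N" by (simp add: mod_diff_left_eq)
      also have "\<dots> = - 1 mod int N" using r True by simp
      also have "\<dots> = int N - 1" using N by (simp add: zmod_minus1)
      finally show ?thesis using N by (simp add: of_nat_diff)
    qed
    have "ent (Wb N D) j j - ent (Wb N D) (j - 1) (j - 1)
        = (\<Sum>k<N. (sgn (real k) - sgn (real k - real (N - 1))) * d k)"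
      using r True j1[symmetric] by (simp add: Wb.rep_eq d_def sum_subtractf left_diff_distrib)
    also have "\<dots> = (\<Sum>k<N. 2 * d k - (if k = 0 then d k else 0) - (if k = N - 1 then d k else 0))"
      using N by (intro sum.cong refl) (auto simp: sgn_if of_nat_diff)
    also have "\<dots> = - (d 0 + d (N - 1))"
      using N sum0 by (simp add: sum_subtractf sum.delta flip: sum_distrib_left)
    finally show ?thesis using dj[OF j1] dj[of 0 j] r True by simp
  next
    case False
    have j1: "int (r - 1) = (j - 1) mod int N"
    proof -
      have "(j - 1) mod int N = (j mod int N - 1) mod int N" by (simp add: mod_diff_left_eq)
      also have "\<dots> = (int r - 1) mod int N" using r by simp
      also have "\<dots> = int r - 1" using r False by (intro mod_pos_pos_trivial) auto
      finally show ?thesis using False by (simp add: of_nat_diff)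
    qed
    have "ent (Wb N D) j j - ent (Wb N D) (j - 1) (j - 1)
        = (\<Sum>k<N. (sgn (real k - real r) - sgn (real k - real (r - 1))) * d k)"
      using r(1)[symmetric] j1[symmetric] by (simp add: Wb.rep_eq d_def sum_subtractf left_diff_distrib)
    also have "\<dots> = (\<Sum>k<N. - (if k = r then d k else 0) - (if k = r - 1 then d k else 0))"
      using False by (intro sum.cong refl) (auto simp: sgn_if of_nat_diff)
    also have "\<dots> = - (d r + d (r - 1))"
      using r by (simp add: sum_subtractf sum_negf sum.delta)
    finally show ?thesis using dj[OF j1] dj[OF r(1)] by simp
  qed
qed

section \<open>The doubled operator and the modified Yang-Baxter equation\<close>

text \<open>With v = X L and u = L X, twice ra and twice la are A1 v + S u and A2 u + S* v.\<close>

definition kdiag :: "nat \<Rightarrow> band \<Rightarrow> band \<Rightarrow> band" where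
  "kdiag N v u = (1/2) *\<^sub>R (zer u + zer v) + (1/2) *\<^sub>R Wb N (v - u)"

definition ra :: "nat \<Rightarrow> band \<Rightarrow> band \<Rightarrow> band" where
  "ra N v u = pos v + kdiag N v u - (1/2) *\<^sub>R v"

definition la :: "nat \<Rightarrow> band \<Rightarrow> band \<Rightarrow> band" where
  "la N v u = pos u + kdiag N v u - (1/2) *\<^sub>R u"

lemma diagonal_kdiag [simp]: "diagonal (kdiag N v u)"
  by (simp add: kdiag_def)

lemma per_ops [simp]:
  assumes "per N v" "per N u"
  shows "per N (kdiag N v u)" "per N (ra N v u)" "per N (la N v u)"
  using assms by (simp_all add: kdiag_def ra_def la_def)

definition comm :: "'a::ring \<Rightarrow> 'a \<Rightarrow> 'a" where "comm x y = x * y - y * x"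

lemma comm_simps:
  "comm (x + y) z = comm x z + comm y z" "comm (x - y) z = comm x z - comm y z"
  "comm z (x + y) = comm z x + comm z y" "comm z (x - y) = comm z x - comm z y"
  "comm (- x) z = - comm x z" "comm z (- x) = - comm z x"
  by (simp_all add: comm_def algebra_simps)

lemma comm_scaleR:
  fixes x y :: "'a::real_algebra"
  shows "comm (r *\<^sub>R x) y = r *\<^sub>R comm x y" "comm x (r *\<^sub>R y) = r *\<^sub>R comm x y"
  by (simp_all add: comm_def algebra_simps)

lemma comm_graded:
  "grade_ge 1 A \<Longrightarrow> grade_ge 0 B \<Longrightarrow> grade_ge 1 (comm A B)"
  "grade_ge 0 A \<Longrightarrow> grade_ge 1 B \<Longrightarrow> grade_ge 1 (comm A B)"
  "grade_le (-1) A \<Longrightarrow> grade_le 0 B \<Longrightarrow> grade_le (-1) (comm A B)"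
  "grade_le 0 A \<Longrightarrow> grade_le (-1) B \<Longrightarrow> grade_le (-1) (comm A B)"
  unfolding comm_def by (auto intro!: grade_ge_simps grade_le_simps intro: grade_ge_mult grade_le_mult)

text \<open>The classical argument for a Lie algebra split into upper and lower parts: \<zeta> is
  [b, b'] plus commutators of grade at most -1. Diagonal matrices commute, hence [b, b'] is strictly
  upper, and \<zeta> has no diagonal part whatever k and k' are.\<close>

lemma bracket_splitting:
  fixes v v' k k' :: band
  assumes "diagonal k" "diagonal k'"
  defines "b \<equiv> pos v + k" and "b' \<equiv> pos v' + k'"
  defines "\<zeta> \<equiv> comm b v' + comm v (b' - v')"
  shows "pos \<zeta> = comm b b'" "zer \<zeta> = 0"
proof -
  have z: "grade_ge 0 M" "grade_le 0 M" if "diagonal M" for M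
    using diagonal_grades[OF that] by auto
  have n: "grade_le 0 (neg M)" for M
    using grade_le_mono[OF grade_neg, of 0] by auto
  have c0: "comm x y = 0" if "diagonal x" "diagonal y" for x y
    using diagonal_commute[OF that] by (simp add: comm_def)
  define Q where "Q = comm k (neg v') + comm (neg v) (k' - zer v') - comm (neg v) (neg v') - comm (zer v) (neg v')"
  have v: "v = pos v + zer v + neg v" and v': "v' = pos v' + zer v' + neg v'"
    by (rule triangular_decomposition)+
  have b'v': "b' - v' = k' - zer v' - neg v'"
    unfolding b'_def by (subst (2) v') simp
  have "\<zeta> = comm (pos v + k) (pos v' + zer v' + neg v') + comm (pos v + zer v + neg v) (k' - zer v' - neg v')"
    using b'v' v v' unfolding \<zeta>_def b_def by metis
  also have "\<dots> = comm b b' + Q"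
    by (simp add: b_def b'_def Q_def comm_simps c0 assms)
  finally have \<zeta>: "\<zeta> = comm b b' + Q" .
  have "comm b b' = comm (pos v) (pos v') + comm (pos v) k' + comm k (pos v')"
    by (simp add: b_def b'_def comm_simps c0 assms)
  moreover have "grade_ge 1 (comm (pos v) (pos v'))" "grade_ge 1 (comm (pos v) k')" "grade_ge 1 (comm k (pos v'))"
    by (simp_all add: comm_graded z assms)
  ultimately have P: "grade_ge 1 (comm b b')" by simp
  have "grade_le (-1) (comm k (neg v'))" "grade_le (-1) (comm (neg v) (k' - zer v'))"
    "grade_le (-1) (comm (neg v) (neg v'))" "grade_le (-1) (comm (zer v) (neg v'))"
    by (simp_all add: comm_graded z n assms)
  then have Q: "grade_le (-1) Q" by (simp add: Q_def)
  show "pos \<zeta> = comm b b'" "zer \<zeta> = 0"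
    unfolding \<zeta> using P Q by (simp_all add: restr_simps restr_graded)
qed

text \<open>Both components share the correction \<open>kdiag\<close>, and by
  \<open>bracket_splitting\<close> both arguments have zero diagonal; so \<open>kdiag\<close>, and
  with it W, vanishes on them, and the computation for a splitting remains. Subtracting half of v
  and half of u brings the equation into symmetric form, which is the origin of the constant
  1/4.\<close>

lemma yang_baxter:
  fixes N :: nat and v u v' u' :: band
  defines "a \<equiv> ra N v u" and "a' \<equiv> ra N v' u'" and "c \<equiv> la N v u" and "c' \<equiv> la N v' u'"
  defines "\<zeta>v \<equiv> comm a v' + comm v a'" and "\<zeta>u \<equiv> comm c u' + comm u c'"
  shows "ra N \<zeta>v \<zeta>u = comm a a' + (1/4) *\<^sub>R comm v v'"
    and "la N \<zeta>v \<zeta>u = comm c c' + (1/4) *\<^sub>R comm u u'"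
proof -
  have half: "(1/2) *\<^sub>R (x::band) + (1/2) *\<^sub>R x = x" for x
    by (simp flip: scaleR_left_distrib)
  define k k' where "k = kdiag N v u" and "k' = kdiag N v' u'"
  have a: "a = pos v + k - (1/2) *\<^sub>R v" "a' = pos v' + k' - (1/2) *\<^sub>R v'"
    and c: "c = pos u + k - (1/2) *\<^sub>R u" "c' = pos u' + k' - (1/2) *\<^sub>R u'"
    by (simp_all add: a_def a'_def c_def c'_def ra_def la_def k_def k'_def)
  have \<zeta>v: "\<zeta>v = comm (pos v + k) v' + comm v (pos v' + k' - v')"
    unfolding \<zeta>v_def a comm_simps comm_scaleR using half[of "comm v v'"] by (simp add: algebra_simps)
  have \<zeta>u: "\<zeta>u = comm (pos u + k) u' + comm u (pos u' + k' - u')"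
    unfolding \<zeta>u_def c comm_simps comm_scaleR using half[of "comm u u'"] by (simp add: algebra_simps)
  have dk: "diagonal k" "diagonal k'" by (simp_all add: k_def k'_def)
  note sv = bracket_splitting[OF dk, of v v', folded \<zeta>v]
  note su = bracket_splitting[OF dk, of u u', folded \<zeta>u]
  have "Wb N (\<zeta>v - \<zeta>u) = 0"
    by (subst Wb_zer[symmetric]) (simp add: restr_simps sv su Wb_simps)
  then have k0: "kdiag N \<zeta>v \<zeta>u = 0"
    by (simp add: kdiag_def sv su)
  have id: "comm b b' - (1/2) *\<^sub>R (comm (b - (1/2) *\<^sub>R x) x' + comm x (b' - (1/2) *\<^sub>R x'))
      = comm (b - (1/2) *\<^sub>R x) (b' - (1/2) *\<^sub>R x') + (1/4) *\<^sub>R comm x x'" for b b' x x' :: band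
  proof -
    have q: "(1/2) *\<^sub>R comm x x' = (1/4) *\<^sub>R comm x x' + (1/4) *\<^sub>R comm x x'"
      by (simp flip: scaleR_left_distrib)
    have q': "(1/8) *\<^sub>R comm x x' + (1/8) *\<^sub>R comm x x' = (1/4) *\<^sub>R comm x x'"
      by (simp flip: scaleR_left_distrib)
    show ?thesis
      by (simp add: comm_simps comm_scaleR scaleR_add_right scaleR_diff_right q q')
  qed
  show "ra N \<zeta>v \<zeta>u = comm a a' + (1/4) *\<^sub>R comm v v'"
  proof -
    have "ra N \<zeta>v \<zeta>u = comm (pos v + k) (pos v' + k') - (1/2) *\<^sub>R \<zeta>v"
      by (simp add: ra_def k0 sv)
    also have "\<dots> = comm a a' + (1/4) *\<^sub>R comm v v'"
      unfolding \<zeta>v_def a by (rule id)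
    finally show ?thesis .
  qed
  show "la N \<zeta>v \<zeta>u = comm c c' + (1/4) *\<^sub>R comm u u'"
  proof -
    have "la N \<zeta>v \<zeta>u = comm (pos u + k) (pos u' + k') - (1/2) *\<^sub>R \<zeta>u"
      by (simp add: la_def k0 su)
    also have "\<dots> = comm c c' + (1/4) *\<^sub>R comm u u'"
      unfolding \<zeta>u_def c by (rule id)
    finally show ?thesis .
  qed
qed


text \<open>The map \<open>pos\<close> minus one half of the identity is skew up to the pairing of
  the diagonal parts. In the difference of the two traces this defect is compensated by the
  symmetric terms of \<open>kdiag\<close>, which pair v with v' and u with u'; its mixed terms and W
  are skew by themselves.\<close>

lemma doubled_skew:
  assumes per: "per N v" "per N u" "per N v'" "per N u'"
  shows "tr N (ra N v u * v') - tr N (la N v u * u') = - (tr N (ra N v' u' * v) - tr N (la N v' u' * u))"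
proof -
  have half: "tr N ((pos x - (1/2) *\<^sub>R x) * y)
      = (tr N (pos x * neg y) - tr N (neg x * pos y) - tr N (zer x * zer y)) / 2" for x y
  proof -
    have "tr N (pos x * y) = tr N (pos x * neg y)"
      using tr_mult_decomposition[of N "pos x" y]
      by (simp add: restr_graded, simp add: restr.rep_eq zero_band.rep_eq band_eqI[of "neg (pos x)" 0])
    then show ?thesis
      using tr_mult_decomposition[of N x y] by (simp add: left_diff_distrib field_simps)
  qed
  have anti: "tr N ((pos x - (1/2) *\<^sub>R x) * y) + tr N ((pos y - (1/2) *\<^sub>R y) * x) = - tr N (zer x * zer y)"
    if "per N x" "per N y" for x y
    using tr_commute[of N "pos x" "neg y"] tr_commute[of N "neg x" "pos y"] tr_commute[of N "zer x" "zer y"] that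
    unfolding half by (simp add: add_divide_distrib diff_divide_distrib)
  have diag: "tr N (d * y) = tr N (d * zer y)" if "diagonal d" for d y
    using that by (simp add: tr_diagonal_mult restr.rep_eq)
  have split: "tr N (ra N x y * z) = tr N ((pos x - (1/2) *\<^sub>R x) * z) + tr N (kdiag N x y * z)"
    "tr N (la N x y * z) = tr N ((pos y - (1/2) *\<^sub>R y) * z) + tr N (kdiag N x y * z)" for x y z
    by (simp_all add: ra_def la_def algebra_simps)
  have k: "tr N (kdiag N x y * z) - tr N (kdiag N x y * w)
      = (tr N (zer y * zer z) + tr N (zer x * zer z) - tr N (zer y * zer w) - tr N (zer x * zer w)) / 2
        + tr N (Wb N (x - y) * (z - w)) / 2" for x y z w
    using diag[of "zer x" z] diag[of "zer y" z] diag[of "zer x" w] diag[of "zer y" w]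
    by (simp add: kdiag_def algebra_simps add_divide_distrib diff_divide_distrib)
  show ?thesis
    using k[of v u v' u'] k[of v' u' v u] anti[OF per(1,3)] anti[OF per(2,4)]
      Wb_skew[of N "v - u" "v' - u'"]
      tr_commute[of N "zer v" "zer v'"] tr_commute[of N "zer v" "zer u'"]
      tr_commute[of N "zer u" "zer v'"] tr_commute[of N "zer u" "zer u'"] per
    by (simp add: split field_simps)
qed

section \<open>The quadratic bracket on linear functionals\<close>

text \<open>The bracket of the functionals X and Y at L is the value at M = L; the two slots are kept
  apart in order to differentiate.\<close>

definition qb :: "nat \<Rightarrow> band \<Rightarrow> band \<Rightarrow> band \<Rightarrow> band \<Rightarrow> real" where
  "qb N L M X Y = tr N (ra N (X * L) (L * X) * (Y * M)) - tr N (la N (X * L) (L * X) * (M * Y))"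

text \<open>Minus the Hamiltonian field of the functional X, by \<open>qb_hvf\<close>: the
  derivative of Y along the field is the bracket of X with Y.\<close>

definition hvf :: "nat \<Rightarrow> band \<Rightarrow> band \<Rightarrow> band" where
  "hvf N L X = la N (X * L) (L * X) * L - L * ra N (X * L) (L * X)"

lemma per_hvf [simp]: "per N L \<Longrightarrow> per N X \<Longrightarrow> per N (hvf N L X)"
  by (simp add: hvf_def)

lemma qb_skew:
  assumes "per N L" "per N M" "per N X" "per N Y"
  shows "qb N L M X Y = - qb N M L Y X"
  unfolding qb_def using assms by (intro doubled_skew) simp_all

lemma qb_hvf:
  assumes "per N L" "per N X" "per N Y"
  shows "qb N L L X Y = - tr N (Y * hvf N L X)"
proof -
  let ?r = "ra N (X * L) (L * X)" and ?l = "la N (X * L) (L * X)"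
  have "tr N (?r * (Y * L)) = tr N (Y * (L * ?r))"
    using tr_commute[of N ?r "Y * L"] assms by (simp add: mult.assoc)
  moreover have "tr N (?l * (L * Y)) = tr N (Y * (?l * L))"
    using tr_commute[of N "?l * L" Y] assms by (simp add: mult.assoc)
  ultimately show ?thesis
    by (simp add: qb_def hvf_def right_diff_distrib)
qed

lemma tr_comm:
  assumes "per N x" "per N y" "per N z"
  shows "tr N (x * comm y z) = tr N (z * comm x y)"
proof -
  have "tr N (x * (y * z)) = tr N (z * (x * y))" "tr N (x * (z * y)) = tr N (z * (y * x))"
    using tr_commute[of N "x * y" z] tr_commute[of N "y * x" z] tr_commute[of N x "z * y"] assms
    by (simp_all add: mult.assoc)
  then show ?thesis by (simp add: comm_def right_diff_distrib)
qed

text \<open>Only the second slot is varied. As the field is l L - L r, there appear products of two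
  left operators, products of two right operators, and mixed terms l L r. The mixed terms are
  symmetric in X and Z and drop out of the difference, leaving commutators.\<close>

lemma qb_derivative_difference:
  assumes "per N L" "per N X" "per N Y" "per N Z"
  shows "qb N L (hvf N L Z) X Y - qb N L (hvf N L X) Z Y
    = tr N ((L * Y) * comm (la N (Z * L) (L * Z)) (la N (X * L) (L * X)))
      - tr N ((Y * L) * comm (ra N (Z * L) (L * Z)) (ra N (X * L) (L * X)))"
proof -
  define a2 a1 d2 d1 where "a2 = ra N (X * L) (L * X)" "a1 = la N (X * L) (L * X)"
    "d2 = ra N (Z * L) (L * Z)" "d1 = la N (Z * L) (L * Z)"
  have p: "per N a2" "per N a1" "per N d2" "per N d1"
    using assms by (simp_all add: a2_a1_d2_d1_def)
  have e: "tr N (a2' * (Y * (d1' * L - L * d2'))) - tr N (a1' * ((d1' * L - L * d2') * Y))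
      = tr N (Y * (d1' * (L * a2'))) - tr N (Y * (L * (d2' * a2'))) - tr N (Y * (a1' * (d1' * L)))
        + tr N (Y * (a1' * (L * d2')))" if "per N a2'" "per N a1'" "per N d2'" "per N d1'" for a2' a1' d2' d1'
    using tr_commute[of N a2' "Y * (d1' * L)"] tr_commute[of N a2' "Y * (L * d2')"]
      tr_commute[of N "a1' * (d1' * L)" Y] tr_commute[of N "a1' * (L * d2')" Y] that assms
    by (simp add: right_diff_distrib left_diff_distrib mult.assoc)
  have "tr N (L * (Y * (d1 * a1))) = tr N (Y * (d1 * (a1 * L)))" "tr N (L * (Y * (a1 * d1))) = tr N (Y * (a1 * (d1 * L)))"
    using tr_commute[of N L "Y * (d1 * a1)"] tr_commute[of N L "Y * (a1 * d1)"] assms p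
    by (simp_all add: mult.assoc)
  then show ?thesis
    unfolding qb_def hvf_def a2_a1_d2_d1_def[symmetric] e[OF p] e[OF p(3,4,1,2)]
    by (simp add: comm_def right_diff_distrib mult.assoc)
qed

text \<open>Skewness turns each variation of the first slot into one of the second, so the six terms
  pair up to differences as in \<open>qb_derivative_difference\<close>, and their sum is a cyclic
  sum of w. It vanishes by the Yang-Baxter equation, paired with the third functional and moved
  across by \<open>doubled_skew\<close>.\<close>

lemma qb_jacobi:
  assumes per: "per N L" "per N X" "per N Y" "per N Z"
  shows "qb N L (hvf N L Z) X Y + qb N (hvf N L Z) L X Y
    + qb N L (hvf N L X) Y Z + qb N (hvf N L X) L Y Z
    + qb N L (hvf N L Y) Z X + qb N (hvf N L Y) L Z X = 0"
proof -
  define R where "R A = ra N (A * L) (L * A)" for A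
  define l where "l A = la N (A * L) (L * A)" for A
  have pl: "per N (R A)" "per N (l A)" if "per N A" for A
    using that per by (simp_all add: R_def l_def)
  define w where "w A B C = tr N ((A * L) * comm (R B) (R C)) - tr N ((L * A) * comm (l B) (l C))" for A B C
  have swap: "comm x y = - comm y x" for x y :: band by (simp add: comm_def)
  have diff: "qb N L (hvf N L C) A B - qb N L (hvf N L A) C B = - w B C A"
    if "per N A" "per N B" "per N C" for A B C
    using qb_derivative_difference[OF per(1) that] by (simp add: w_def R_def l_def)
  have rot: "w Y X Z = - w X Z Y - w Z Y X"
  proof -
    let ?\<zeta>v = "comm (R X) (Z * L) + comm (X * L) (R Z)" and ?\<zeta>u = "comm (l X) (L * Z) + comm (L * X) (l Z)"
    have pz: "per N ?\<zeta>v" "per N ?\<zeta>u"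
      using per by (simp_all add: comm_def pl)
    have yb: "comm (R X) (R Z) = ra N ?\<zeta>v ?\<zeta>u - (1/4) *\<^sub>R comm (X * L) (Z * L)"
      "comm (l X) (l Z) = la N ?\<zeta>v ?\<zeta>u - (1/4) *\<^sub>R comm (L * X) (L * Z)"
      using yang_baxter[of N "X * L" "L * X" "Z * L" "L * Z"] by (simp_all add: R_def l_def)
    \<comment> \<open>The 1/4 terms of the two components have equal traces and cancel, so the
      modified equation serves as well as the classical one.\<close>
    have cyc: "tr N ((Y * L) * comm (X * L) (Z * L)) = tr N ((L * Y) * comm (L * X) (L * Z))"
      using tr_commute[of N "Y * (L * (X * (L * Z)))" L] tr_commute[of N "Y * (L * (Z * (L * X)))" L] per
      by (simp add: comm_def right_diff_distrib mult.assoc)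
    have "w Y X Z = tr N (ra N ?\<zeta>v ?\<zeta>u * (Y * L)) - tr N (la N ?\<zeta>v ?\<zeta>u * (L * Y))"
      unfolding w_def yb using cyc per tr_commute[of N "Y * L" "ra N ?\<zeta>v ?\<zeta>u"] tr_commute[of N "L * Y" "la N ?\<zeta>v ?\<zeta>u"] pz
      by (simp add: right_diff_distrib)
    also have "\<dots> = - (tr N (R Y * ?\<zeta>v) - tr N (l Y * ?\<zeta>u))"
      using per pz by (subst doubled_skew) (simp_all add: R_def l_def)
    also have "\<dots> = - w X Z Y - w Z Y X"
      using tr_comm[of N "R Y" "R X" "Z * L"] tr_comm[of N "R Y" "X * L" "R Z"] tr_comm[of N "R Z" "R Y" "X * L"]
        tr_comm[of N "l Y" "l X" "L * Z"] tr_comm[of N "l Y" "L * X" "l Z"] tr_comm[of N "l Z" "l Y" "L * X"] per pl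
      by (simp add: w_def distrib_left)
    finally show ?thesis .
  qed
  have wskew: "w A B C = - w A C B" for A B C
    unfolding w_def swap[of "R B"] swap[of "l B"] by simp
  show ?thesis
    using qb_skew[of N "hvf N L Z" L X Y] qb_skew[of N "hvf N L X" L Y Z] qb_skew[of N "hvf N L Y" L Z X]
      diff[OF per(2,3,4)] diff[OF per(3,4,2)] diff[OF per(4,2,3)]
      rot wskew[of Y Z X] wskew[of Z X Y] wskew[of X Y Z] per
    by simp
qed

section \<open>The shift and the tangency of the Hamiltonian vector fields\<close>

lift_definition Eb :: band is "\<lambda>j k. if j - k = 1 then 1 else 0"
  by (rule exI[of _ 0]) simp

lemma ent_Eb_mult: "ent (Eb * A) j k = ent A (j - 1) k" "ent (A * Eb) j k = ent A j (k + 1)"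
proof -
  have "ent (Eb * A) j k = (\<Sum>l\<in>{j - 1}. ent Eb j l * ent A l k)"
    by (rule times_band_ent) (auto simp: Eb.rep_eq split: if_splits)
  then show "ent (Eb * A) j k = ent A (j - 1) k" by (simp add: Eb.rep_eq)
  have "ent (A * Eb) j k = (\<Sum>l\<in>{k + 1}. ent A j l * ent Eb l k)"
    by (rule times_band_ent) (auto simp: Eb.rep_eq split: if_splits)
  then show "ent (A * Eb) j k = ent A j (k + 1)" by (simp add: Eb.rep_eq)
qed

lemma per_Eb [simp]: "per N Eb"
  by (simp add: per_def Eb.rep_eq)

lemma grade_Eb: "grade_ge 1 Eb" "grade_ge 0 Eb" "grade_le 1 Eb"
  by (auto simp: grade_ge_def grade_le_def Eb.rep_eq)

definition Fb :: "real \<Rightarrow> band" where "Fb \<alpha> = 1 - \<alpha> *\<^sub>R Eb"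

lemma per_Fb [simp]: "per N (Fb \<alpha>)"
  by (simp add: Fb_def)

lemma grade_Fb: "grade_ge 0 (Fb \<alpha>)" "grade_le 1 (Fb \<alpha>)"
  by (auto simp: grade_ge_def grade_le_def Eb.rep_eq Fb_def ent_simps)

text \<open>Two readings of one field, by (L X) L = L (X L). In the first all multipliers have
  nonnegative grade, which bounds the field below; in the second they have nonpositive grade, which
  bounds it above.\<close>

lemma hvf_alt:
  "hvf N L X = (pos (L * X) + kdiag N (X * L) (L * X)) * L - L * (pos (X * L) + kdiag N (X * L) (L * X))"
  "hvf N L X = (kdiag N (X * L) (L * X) - zer (L * X) - neg (L * X)) * L
     - L * (kdiag N (X * L) (L * X) - zer (X * L) - neg (X * L))"
proof -
  let ?u = "L * X" and ?v = "X * L" and ?k = "kdiag N (X * L) (L * X)"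
  have assoc: "?u * L = L * ?v" by (simp add: mult.assoc)
  have r: "hvf N L X = (pos ?u + ?k) * L - L * (pos ?v + ?k) - (1/2) *\<^sub>R (?u * L - L * ?v)"
    unfolding hvf_def la_def ra_def by (simp add: algebra_simps)
  then show 1: "hvf N L X = (pos ?u + ?k) * L - L * (pos ?v + ?k)"
    using assoc by simp
  have d: "pos A = A - zer A - neg A" for A
    using triangular_decomposition[of A] by (simp add: algebra_simps)
  have "(pos ?u + ?k) * L - L * (pos ?v + ?k)
    = (?k - zer ?u - neg ?u) * L - L * (?k - zer ?v - neg ?v) + (?u * L - L * ?v)"
    unfolding d by (simp add: algebra_simps)
  then show "hvf N L X = (?k - zer ?u - neg ?u) * L - L * (?k - zer ?v - neg ?v)"
    using 1 assoc by simp
qed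

lemma grade_ge_hvf:
  assumes "grade_ge a L"
  shows "grade_ge a (hvf N L X)"
  unfolding hvf_alt(1)
  by (intro grade_ge_simps grade_ge_mult[OF _ assms, of 0] grade_ge_mult[OF assms, of 0])
    (simp_all add: diagonal_grades)

text \<open>The strictly negative multipliers lower L to grade 0, so a term of positive grade could
  come only from the diagonal multipliers h and h' acting on the shift. By \<open>Wb_shift\<close>,
  h E = E h', and this term cancels.\<close>

lemma grade_le_hvf:
  assumes N: "N \<ge> 2" and per: "per N L" "per N X" and L: "L = c *\<^sub>R Eb + K" "grade_le 0 K"
  shows "grade_le 0 (hvf N L X)"
proof -
  let ?u = "L * X" and ?v = "X * L" and ?k = "kdiag N (X * L) (L * X)"
  define h h' where "h = ?k - zer ?u" and "h' = ?k - zer ?v"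
  have dh: "diagonal h" "diagonal h'" by (simp_all add: h_def h'_def)
  have "h * Eb = Eb * h'"
  proof (rule band_eqI)
    fix j k :: int
    have "tr N (?v - ?u) = 0" using tr_commute[OF per] by simp
    from Wb_shift[OF N _ this, of j] have "ent h j j = ent h' (j - 1) (j - 1)"
      using per by (simp add: h_def h'_def kdiag_def ent_simps restr.rep_eq field_simps)
    then have "ent h j (k + 1) = ent h' (j - 1) k"
      using dh by (cases "j = k + 1") (auto simp: diagonal_def)
    then show "ent (h * Eb) j k = ent (Eb * h') j k" by (simp add: ent_Eb_mult)
  qed
  then have "h * L - L * h' = h * K - K * h'"
    by (simp add: L algebra_simps)
  then have e: "hvf N L X = h * K - K * h' - neg ?u * L + L * neg ?v"
    unfolding hvf_alt(2) h_def[symmetric] h'_def[symmetric]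
    by (simp add: left_diff_distrib right_diff_distrib)
  have "grade_le 1 L" unfolding L(1)
    using L(2) grade_Eb(3) grade_le_mono[of 0 K 1] by simp
  then show ?thesis unfolding e
    by (intro grade_le_simps grade_le_mult[OF diagonal_grades(2)[OF dh(1)] L(2)]
        grade_le_mult[OF L(2) diagonal_grades(2)[OF dh(2)]]
        grade_le_mult[OF grade_neg \<open>grade_le 1 L\<close>] grade_le_mult[OF \<open>grade_le 1 L\<close> grade_neg]) simp_all
qed

section \<open>The linear bracket as the derivative of the quadratic one\<close>

lemma ra_la_linear:
  "ra N (v + v') (u + u') = ra N v u + ra N v' u'" "la N (v + v') (u + u') = la N v u + la N v' u'"
  "ra N (r *\<^sub>R v) (r *\<^sub>R u) = r *\<^sub>R ra N v u" "la N (r *\<^sub>R v) (r *\<^sub>R u) = r *\<^sub>R la N v u"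
proof -
  show "ra N (v + v') (u + u') = ra N v u + ra N v' u'" "la N (v + v') (u + u') = la N v u + la N v' u'"
    by (simp_all add: ra_def la_def kdiag_def restr_simps Wb_simps scaleR_add_right scaleR_diff_right)
  show "ra N (r *\<^sub>R v) (r *\<^sub>R u) = r *\<^sub>R ra N v u" "la N (r *\<^sub>R v) (r *\<^sub>R u) = r *\<^sub>R la N v u"
    by (simp_all add: ra_def la_def kdiag_def restr_simps Wb_simps scaleR_add_right scaleR_diff_right mult.commute)
qed

lemma qb_linear:
  "qb N (L + L') M X Y = qb N L M X Y + qb N L' M X Y" "qb N (r *\<^sub>R L) M X Y = r * qb N L M X Y"
  "qb N L (M + M') X Y = qb N L M X Y + qb N L M' X Y" "qb N L (r *\<^sub>R M) X Y = r * qb N L M X Y"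
  "qb N L M (X + X') Y = qb N L M X Y + qb N L M X' Y" "qb N L M (r *\<^sub>R X) Y = r * qb N L M X Y"
  "qb N L M X (Y + Y') = qb N L M X Y + qb N L M X Y'" "qb N L M X (r *\<^sub>R Y) = r * qb N L M X Y"
  by (simp_all add: qb_def ra_la_linear distrib_left distrib_right right_diff_distrib)

lemma qb_zero: "qb N 0 M X Y = 0" "qb N L 0 X Y = 0" "qb N L M 0 Y = 0" "qb N L M X 0 = 0"
  using qb_linear(2)[of N 0] qb_linear(4)[of N L 0] qb_linear(6)[of N L M 0] qb_linear(8)[of N L M X 0]
  by (metis mult_zero_left scaleR_zero_left)+

lemma qb_sum:
  "qb N (sum f S) M X Y = (\<Sum>x\<in>S. qb N (f x) M X Y)" "qb N L (sum f S) X Y = (\<Sum>x\<in>S. qb N L (f x) X Y)"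
  "qb N L M (sum f S) Y = (\<Sum>x\<in>S. qb N L M (f x) Y)" "qb N L M X (sum f S) = (\<Sum>x\<in>S. qb N L M X (f x))"
  by (induction S rule: infinite_finite_induct; simp add: qb_zero qb_linear)+

definition lb :: "nat \<Rightarrow> real \<Rightarrow> band \<Rightarrow> band \<Rightarrow> band \<Rightarrow> real" where
  "lb N \<alpha> L X Y = tr N ((X * Fb \<alpha> * Y - Y * Fb \<alpha> * X) * L)"

text \<open>For X of nonnegative grade, multiplication by F leaves the diagonal part unchanged on
  either side; so W cancels, and in the absence of a negative part the operators reduce to one half
  of the identity.\<close>

lemma ra_la_Fb:
  assumes "grade_ge 0 X"
  shows "ra N (X * Fb \<alpha>) (Fb \<alpha> * X) = (1/2) *\<^sub>R (X * Fb \<alpha>)"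
    "la N (X * Fb \<alpha>) (Fb \<alpha> * X) = (1/2) *\<^sub>R (Fb \<alpha> * X)"
proof -
  have "grade_ge 1 (X * Eb)" "grade_ge 1 (Eb * X)"
    using grade_ge_mult[OF assms grade_Eb(1), of 1] grade_ge_mult[OF grade_Eb(1) assms, of 1] by auto
  then have z: "zer (X * Fb \<alpha>) = zer X" "zer (Fb \<alpha> * X) = zer X"
    by (simp_all add: Fb_def algebra_simps restr_simps restr_graded)
  then have "Wb N (X * Fb \<alpha> - Fb \<alpha> * X) = 0"
    by (subst Wb_zer[symmetric]) (simp add: restr_simps Wb_simps)
  then have k: "kdiag N (X * Fb \<alpha>) (Fb \<alpha> * X) = zer X"
    by (simp add: kdiag_def z flip: scaleR_left_distrib scaleR_right_distrib)
  have half: "A - (1/2) *\<^sub>R A = (1/2) *\<^sub>R A" for A :: band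
    using scaleR_left_diff_distrib[of 1 "1/2" A] by simp
  have "neg A = 0" if "grade_ge 0 A" for A
    using that by (intro band_eqI) (simp add: restr.rep_eq ent_simps grade_ge_def)
  moreover have "grade_ge 0 (X * Fb \<alpha>)" "grade_ge 0 (Fb \<alpha> * X)"
    using grade_ge_mult[OF assms grade_Fb(1)] grade_ge_mult[OF grade_Fb(1) assms] by auto
  ultimately have "pos (X * Fb \<alpha>) + zer X = X * Fb \<alpha>" "pos (Fb \<alpha> * X) + zer X = Fb \<alpha> * X"
    using triangular_decomposition[of "X * Fb \<alpha>"] triangular_decomposition[of "Fb \<alpha> * X"] z by simp_all
  then show "ra N (X * Fb \<alpha>) (Fb \<alpha> * X) = (1/2) *\<^sub>R (X * Fb \<alpha>)"
    "la N (X * Fb \<alpha>) (Fb \<alpha> * X) = (1/2) *\<^sub>R (Fb \<alpha> * X)"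
    unfolding ra_def la_def k by (simp_all add: half)
qed

lemma qb_Fb:
  assumes "per N L" "per N X" "per N Y" "grade_ge 0 X"
  shows "qb N (Fb \<alpha>) L X Y = lb N \<alpha> L X Y / 2"
  unfolding qb_def ra_la_Fb[OF assms(4)] lb_def
  using tr_commute[of N "Fb \<alpha> * X * L" Y] assms
  by (simp add: left_diff_distrib right_diff_distrib mult.assoc)

text \<open>Each of the two mixed terms of the expansion contributes half of the linear bracket, one
  by \<open>qb_Fb\<close> and the other by skewness. The term in s^2 is a multiple of the linear
  bracket at F itself, which is the trace of a commutator.\<close>

lemma qb_pencil:
  assumes "per N L" "per N X" "per N Y" "grade_ge 0 X" "grade_ge 0 Y"
  shows "qb N (L + s *\<^sub>R Fb \<alpha>) (L + s *\<^sub>R Fb \<alpha>) X Y = qb N L L X Y + s * lb N \<alpha> L X Y"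
proof -
  have "qb N L (Fb \<alpha>) X Y = lb N \<alpha> L X Y / 2"
    using qb_skew[of N L "Fb \<alpha>" X Y] qb_Fb[of N L Y X \<alpha>] assms
    by (simp add: lb_def left_diff_distrib diff_divide_distrib)
  moreover have "lb N \<alpha> (Fb \<alpha>) X Y = 0"
    using tr_commute[of N "X * Fb \<alpha>" "Y * Fb \<alpha>"] assms
    by (simp add: lb_def left_diff_distrib mult.assoc)
  then have "qb N (Fb \<alpha>) (Fb \<alpha>) X Y = 0"
    using qb_Fb[of N "Fb \<alpha>" X Y \<alpha>] assms by simp
  moreover note qb_Fb[OF assms(1-4), of \<alpha>]
  ultimately show ?thesis
    unfolding qb_linear by (simp flip: distrib_left)
qed

section \<open>Periodic matrices as twisted Laurent series\<close>

text \<open>Of the periodic copies of an entry, the one whose column is k itself is read; its row is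
  then k + p, congruent to j by the twist condition.\<close>

definition emb :: "nat \<Rightarrow> band \<Rightarrow> lser" where
  "emb N A = (\<lambda>p j k. if j < N \<and> k < N \<and> (int j - int k - p) mod int N = 0
     then ent A (int k + p) (int k) else 0)"

lemma nat_cong_eq:
  assumes "j < N" "k < N" "int N dvd int j - int k" shows "j = k"
  using assms by (metis int_ops(9) mod_eq_dvd_iff mod_less of_nat_eq_iff)

lemma per_cong:
  assumes "per N A" "int N dvd i - i'" "j' = j + (i' - i)"
  shows "ent A i j = ent A i' j'"
proof -
  obtain q where "i - i' = int N * q" using assms(2) by (auto simp: dvd_def)
  then have "i = i' + int N * q" "j = j' + int N * q" using assms(3) by auto
  then show ?thesis by (simp only: per_mult_shift[OF assms(1)])
qed

lemma emb_nonzero: "emb N A p j k \<noteq> 0 \<Longrightarrow> j < N \<and> k < N \<and> int N dvd int j - int k - p"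
  by (auto simp: emb_def mod_eq_0_iff_dvd split: if_splits)

lemma emb_bound: "grade_ge a A \<Longrightarrow> p < a \<Longrightarrow> emb N A p j k = 0"
  by (simp add: emb_def grade_ge_def)

lemma emb_lmul:
  assumes N: "N > 0" and per: "per N A" "per N B"
  shows "lmul N (emb N A) (emb N B) = emb N (A * B)"
proof (intro ext)
  fix p j k
  let ?X = "emb N A" and ?Y = "emb N B"
  obtain a where a: "grade_ge a A" using ent_bounded by blast
  obtain b where b: "grade_ge b B" using ent_bounded by blast
  have "lmul N ?X ?Y p j k = (\<Sum>q\<in>{a..p - b}. \<Sum>l<N. ?X q j l * ?Y (p - q) l k)"
    unfolding lmul_def
  proof (rule sum.mono_neutral_left)
    show "{q. ?X q \<noteq> (\<lambda>_ _. 0) \<and> ?Y (p - q) \<noteq> (\<lambda>_ _. 0)} \<subseteq> {a..p - b}"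
    proof clarify
      fix q assume "?X q \<noteq> (\<lambda>_ _. 0)" "?Y (p - q) \<noteq> (\<lambda>_ _. 0)"
      then have "\<not> q < a" "\<not> p - q < b" using emb_bound[OF a] emb_bound[OF b] by blast+
      then show "q \<in> {a..p - b}" by simp
    qed
    show "\<forall>q\<in>{a..p - b} - {q. ?X q \<noteq> (\<lambda>_ _. 0) \<and> ?Y (p - q) \<noteq> (\<lambda>_ _. 0)}.
        (\<Sum>l<N. ?X q j l * ?Y (p - q) l k) = 0"
      by auto
  qed simp
  also have "\<dots> = emb N (A * B) p j k"
  proof (cases "j < N \<and> k < N \<and> int N dvd int j - int k - p")
    case False
    have z: "?X q j l * ?Y (p - q) l k = 0" for q l
    proof (rule ccontr)
      assume "\<not> ?thesis"
      then have "?X q j l \<noteq> 0" "?Y (p - q) l k \<noteq> 0" by auto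
      then have "j < N" "k < N" "int N dvd (int j - int l - q) + (int l - int k - (p - q))"
        using emb_nonzero by (blast, blast, blast intro: dvd_add)
      then show False using False by (simp add: algebra_simps)
    qed
    have "emb N (A * B) p j k = 0"
      using emb_nonzero[of N "A * B" p j k] False by blast
    then show ?thesis by (simp only: z sum.neutral_const)
  next
    case True
    have "(\<Sum>l<N. ?X q j l * ?Y (p - q) l k)
        = ent A (int k + p) (int k + p - q) * ent B (int k + p - q) (int k)" for q
    proof -
      \<comment> \<open>The twist condition admits a single l for each q, so the double sum over q
        and l is one sum over the integer index k + p - q.\<close>
      define l0 where "l0 = nat ((int k + p - q) mod int N)"
      have l0: "int l0 = (int k + p - q) mod int N" "l0 < N"
        using N by (auto simp: l0_def nat_less_iff)
      have dl0: "int N dvd int k + p - q - int l0"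
        unfolding l0(1) by simp
      have single: "?X q j l * ?Y (p - q) l k = (if l = l0 then ?X q j l0 * ?Y (p - q) l0 k else 0)" if "l < N" for l
      proof (cases "l = l0")
        case False
        have "?Y (p - q) l k = 0"
        proof (rule ccontr)
          assume "\<not> ?thesis"
          then have "int N dvd int l - int k - (p - q)" using emb_nonzero by blast
          from dvd_add[OF this dl0] have "int N dvd int l - int l0" by (simp add: algebra_simps)
          then show False using nat_cong_eq[OF that l0(2)] False by blast
        qed
        then show ?thesis using False by simp
      qed simp
      have "(\<Sum>l<N. ?X q j l * ?Y (p - q) l k) = (\<Sum>l<N. if l = l0 then ?X q j l0 * ?Y (p - q) l0 k else 0)"
        by (rule sum.cong[OF refl], rule single) simp
      also have "\<dots> = ?X q j l0 * ?Y (p - q) l0 k"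
        using l0(2) by (subst sum.delta) auto
      also have "?Y (p - q) l0 k = ent B (int k + p - q) (int k)"
        using True l0(2) dl0 by (simp add: emb_def mod_eq_0_iff_dvd algebra_simps dvd_diff_commute)
      also have "?X q j l0 = ent A (int l0 + q) (int l0)"
      proof -
        have "int N dvd (int j - int k - p) + (int k + p - q - int l0)"
          using True dl0 by (intro dvd_add) auto
        then show ?thesis using True l0(2) by (simp add: emb_def mod_eq_0_iff_dvd algebra_simps)
      qed
      also have "\<dots> = ent A (int k + p) (int k + p - q)"
        by (rule per_cong[OF per(1)]) (use dl0 in \<open>auto simp: algebra_simps dvd_diff_commute\<close>)
      finally show ?thesis .
    qed
    then have "(\<Sum>q\<in>{a..p - b}. \<Sum>l<N. ?X q j l * ?Y (p - q) l k)
        = (\<Sum>q\<in>{a..p - b}. ent A (int k + p) (int k + p - q) * ent B (int k + p - q) (int k))"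
      by simp
    also have "\<dots> = (\<Sum>l\<in>{int k + b..int k + p - a}. ent A (int k + p) l * ent B l (int k))"
      by (rule sum.reindex_bij_witness[of _ "\<lambda>l. int k + p - l" "\<lambda>q. int k + p - q"]) auto
    also have "\<dots> = ent (A * B) (int k + p) (int k)"
      by (rule times_band_ent_interval[OF a b, symmetric]) auto
    finally show ?thesis using True by (simp add: emb_def mod_eq_0_iff_dvd)
  qed
  finally show "lmul N ?X ?Y p j k = emb N (A * B) p j k" .
qed

lemma emb_linear:
  "ladd (emb N A) (emb N B) = emb N (A + B)" "lsub (emb N A) (emb N B) = emb N (A - B)"
  "lscale r (emb N A) = emb N (r *\<^sub>R A)" "lzero = emb N 0"
  by (auto simp: ladd_def lsub_def lscale_def lzero_def emb_def ent_simps fun_eq_iff)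

lemma emb_sum: "emb N (sum f S) p j k = (\<Sum>x\<in>S. emb N (f x) p j k)"
proof (cases "j < N \<and> k < N \<and> (int j - int k - p) mod int N = 0")
  case True
  then show ?thesis by (simp add: emb_def ent_sum)
next
  case False
  show ?thesis unfolding emb_def if_not_P[OF False] by simp
qed

lemma lpair_emb:
  assumes "N > 0" "per N A" "per N B"
  shows "lpair N (emb N A) (emb N B) = tr N (A * B)"
  unfolding lpair_def emb_lmul[OF assms] by (simp add: tr_def emb_def)

lemma ser_emb: "ser N (emb N A)"
proof -
  obtain a where "grade_ge a A" using ent_bounded by blast
  then show ?thesis
    unfolding ser_def using emb_bound emb_nonzero by (metis mod_eq_0_iff_dvd)
qed

lemma ser_imp_emb:
  assumes N: "N > 0" and X: "ser N X"
  obtains A where "per N A" "X = emb N A"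
proof
  define M where "M = (\<lambda>i k. X (i - k) (nat (i mod int N)) (nat (k mod int N)))"
  obtain a where "\<forall>p<a. \<forall>j k. X p j k = 0" using X unfolding ser_def by blast
  then have "\<exists>a. \<forall>j k. j - k < a \<longrightarrow> M j k = 0" by (auto simp: M_def)
  then have M: "ent (Band M) = M" by (simp add: Band_inverse)
  show "per N (Band M)" unfolding per_def M by (simp add: M_def)
  show "X = emb N (Band M)"
  proof (intro ext)
    fix p j k
    show "X p j k = emb N (Band M) p j k"
    proof (cases "j < N \<and> k < N \<and> (int j - int k - p) mod int N = 0")
      case True
      then have "int N dvd int j - (int k + p)" by (simp add: mod_eq_0_iff_dvd algebra_simps)
      then have "(int k + p) mod int N = int j mod int N" unfolding mod_eq_dvd_iff by (simp only: dvd_diff_commute)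
      then show ?thesis using True unfolding emb_def M by (simp add: M_def)
    next
      case False
      then show ?thesis using X unfolding ser_def emb_def by auto
    qed
  qed
qed

lemma emb_inject:
  assumes N: "N > 0" and per: "per N A" "per N B" and eq: "emb N A = emb N B"
  shows "A = B"
proof (rule band_eqI)
  fix i k
  define k0 where "k0 = nat (k mod int N)"
  define j0 where "j0 = nat ((int k0 + (i - k)) mod int N)"
  have k0: "int k0 = k mod int N" "k0 < N" using N by (auto simp: k0_def nat_less_iff)
  have j0: "int j0 = (int k0 + (i - k)) mod int N" "j0 < N" using N by (auto simp: j0_def nat_less_iff)
  have d: "int N dvd k - int k0" unfolding k0(1) by simp
  have c: "(int j0 - int k0 - (i - k)) mod int N = 0"
    unfolding j0(1) by (simp add: mod_eq_0_iff_dvd) (metis dvd_minus_mod dvd_diff_commute diff_diff_eq)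
  have "ent M i k = emb N M (i - k) j0 k0" if "per N M" for M
    using per_cong[OF that, of i "int k0 + (i - k)" "int k0" k] d c k0 j0 by (simp add: emb_def)
  then show "ent A i k = ent B i k" using per eq by metis
qed

lemma lI_emb: "lI N = emb N 1"
proof (intro ext)
  fix p j k
  show "lI N p j k = emb N 1 p j k"
    using nat_cong_eq[of j N k] by (auto simp: lI_def emb_def ent_simps mod_eq_0_iff_dvd)
qed

lemma projections_emb:
  "P0 (emb N A) = emb N (zer A)" "Rop (emb N A) = emb N (A - 2 *\<^sub>R neg A)"
  "R0op (emb N A) = emb N (pos A - neg A)" "Wop N (emb N A) = emb N (Wb N A)"
proof -
  show "P0 (emb N A) = emb N (zer A)" "Rop (emb N A) = emb N (A - 2 *\<^sub>R neg A)"
    "R0op (emb N A) = emb N (pos A - neg A)"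
    by (auto simp: fun_eq_iff P0_def Rop_def R0op_def Pge_def Pneg_def Ppos_def lsub_def emb_def
        restr.rep_eq ent_simps)
  show "Wop N (emb N A) = emb N (Wb N A)"
  proof (intro ext)
    fix p j k
    show "Wop N (emb N A) p j k = emb N (Wb N A) p j k"
      using nat_cong_eq[of j N k] by (auto simp: Wop_def emb_def Wb.rep_eq mod_eq_0_iff_dvd)
  qed
qed

lemma pb2_emb:
  assumes N: "N > 0" and per: "per N L" "per N X" "per N Y"
  shows "pb2 N (emb N L) (emb N X) (emb N Y) = qb N L L X Y"
proof -
  let ?v = "X * L" and ?u = "L * X"
  have pos: "pos A = A - zer A - neg A" for A
    using triangular_decomposition[of A] by (simp add: algebra_simps)
  have d: "pos ?v - neg ?v + Wb N ?v + (zer ?u - Wb N ?u) = 2 *\<^sub>R ra N ?v ?u"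
    "pos ?u - neg ?u - Wb N ?u + (zer ?v + Wb N ?v) = 2 *\<^sub>R la N ?v ?u"
    unfolding ra_def la_def kdiag_def pos by (simp_all add: Wb_simps algebra_simps scaleR_2)
  have "2 * qb N L L X Y = tr N ((pos ?v - neg ?v + Wb N ?v + (zer ?u - Wb N ?u)) * (Y * L))
      - tr N ((pos ?u - neg ?u - Wb N ?u + (zer ?v + Wb N ?v)) * (L * Y))"
    unfolding d qb_def by simp
  also have "\<dots> = 2 * pb2 N (emb N L) (emb N X) (emb N Y)"
    using per by (simp add: pb2_def Let_def emb_lmul N A1op_def A2op_def Sop_def Sstarop_def
        projections_emb emb_linear lpair_emb distrib_right left_diff_distrib diff_divide_distrib add_divide_distrib)
  finally show ?thesis by simp
qed

section \<open>Calculus of smooth functions of the coordinates\<close>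

lemma iter_pd_append: "iter_pd (cs @ [c]) f = iter_pd cs (pd f c)"
  by (induction cs) auto

definition pdiff :: "((nat \<times> nat \<Rightarrow> real) \<Rightarrow> real) \<Rightarrow> nat \<times> nat \<Rightarrow> bool" where
  "pdiff f c \<longleftrightarrow> (\<forall>x. (\<lambda>t. f (x(c := t))) differentiable (at (x c)))"

lemma pdiff_iff: "pdiff f c \<longleftrightarrow> (\<forall>x. ((\<lambda>t. f (x(c := t))) has_real_derivative pd f c x) (at (x c)))"
  by (simp add: pdiff_def pd_def DERIV_deriv_iff_real_differentiable)

lemma pdI: "(\<And>x. ((\<lambda>t. f (x(c := t))) has_real_derivative f' x) (at (x c))) \<Longrightarrow> pdiff f c \<and> pd f c = f'"
  unfolding pdiff_iff by (metis DERIV_imp_deriv ext pd_def)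

lemma pd_const: "pdiff (\<lambda>x. k) c \<and> pd (\<lambda>x. k) c = (\<lambda>x. 0)"
  by (rule pdI) simp

lemma pd_coordinate: "pdiff (\<lambda>x. x d) c \<and> pd (\<lambda>x. x d) c = (\<lambda>x. if c = d then 1 else 0)"
  by (rule pdI) (cases "c = d"; auto)

lemma pd_add:
  assumes "pdiff f c" "pdiff g c"
  shows "pdiff (\<lambda>x. f x + g x) c \<and> pd (\<lambda>x. f x + g x) c = (\<lambda>x. pd f c x + pd g c x)"
  using assms by (intro pdI DERIV_add) (auto simp: pdiff_iff)

lemma pd_mult:
  assumes "pdiff f c" "pdiff g c"
  shows "pdiff (\<lambda>x. f x * g x) c \<and> pd (\<lambda>x. f x * g x) c = (\<lambda>x. pd f c x * g x + f x * pd g c x)"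
proof (rule pdI)
  fix x
  show "((\<lambda>t. f (x(c := t)) * g (x(c := t))) has_real_derivative pd f c x * g x + f x * pd g c x) (at (x c))"
    using DERIV_mult[of "\<lambda>t. f (x(c := t))" "pd f c x" "x c" UNIV "\<lambda>t. g (x(c := t))" "pd g c x"] assms
    by (simp add: pdiff_iff mult.commute)
qed

text \<open>\<open>smoothT\<close> speaks of all iterated derivatives, so closure under products
  would call for a higher Leibniz rule. A generated class that is closed under one derivative avoids
  it, since iterated derivatives then stay in the class.\<close>

inductive smooth_alg :: "nat \<Rightarrow> nat \<Rightarrow> ((nat \<times> nat \<Rightarrow> real) \<Rightarrow> real) \<Rightarrow> bool" for N m where
  base: "smoothT N m f \<Longrightarrow> smooth_alg N m f"
| const: "smooth_alg N m (\<lambda>x. k)"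
| coordinate: "c \<in> coords N m \<Longrightarrow> smooth_alg N m (\<lambda>x. x c)"
| add: "smooth_alg N m f \<Longrightarrow> smooth_alg N m g \<Longrightarrow> smooth_alg N m (\<lambda>x. f x + g x)"
| mult: "smooth_alg N m f \<Longrightarrow> smooth_alg N m g \<Longrightarrow> smooth_alg N m (\<lambda>x. f x * g x)"

lemma smoothT_local:
  assumes "smoothT N m f"
  shows "\<And>x y. (\<And>c. c \<in> coords N m \<Longrightarrow> x c = y c) \<Longrightarrow> f x = f y"
    and "continuous_on UNIV f"
    and "c \<in> coords N m \<Longrightarrow> pdiff f c"
proof -
  show "f x = f y" if "\<And>c. c \<in> coords N m \<Longrightarrow> x c = y c" for x y
    using assms that unfolding smoothT_def by blast
  have "continuous_on UNIV (iter_pd [] f) \<and>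
      (\<forall>c\<in>coords N m. \<forall>x. (\<lambda>t. iter_pd [] f (x(c := t))) differentiable (at (x c)))"
    using assms unfolding smoothT_def by (metis empty_subsetI list.set(1))
  then show "continuous_on UNIV f" "c \<in> coords N m \<Longrightarrow> pdiff f c"
    by (auto simp: pdiff_def)
qed

lemma pd_eqI:
  assumes "\<And>x y. (\<And>c. c \<in> A \<Longrightarrow> x c = y c) \<Longrightarrow> f x = f y" "\<And>c. c \<in> A \<Longrightarrow> x c = y c" "d \<in> A"
  shows "pd f d x = pd f d y"
proof -
  have "(\<lambda>t. f (x(d := t))) = (\<lambda>t. f (y(d := t)))"
    by (rule ext, rule assms(1)) (simp add: assms(2))
  then show ?thesis unfolding pd_def using assms(2)[OF assms(3)] by (simp only:)
qed

lemma smoothT_pd: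
  assumes f: "smoothT N m f" and c: "c \<in> coords N m"
  shows "smoothT N m (pd f c)"
  unfolding smoothT_def
proof (intro conjI allI impI)
  fix x y :: "nat \<times> nat \<Rightarrow> real" assume "\<forall>c\<in>coords N m. x c = y c"
  then show "pd f c x = pd f c y"
    by (intro pd_eqI[where A = "coords N m"] smoothT_local(1)[OF f]) (auto simp: c)
next
  fix cs assume cs: "set cs \<subseteq> coords N m"
  have *: "continuous_on UNIV (iter_pd ds f) \<and> (\<forall>c\<in>coords N m. \<forall>x. (\<lambda>t. iter_pd ds f (x(c := t))) differentiable (at (x c)))"
    if "set ds \<subseteq> coords N m" for ds
    using f that unfolding smoothT_def by blast
  show "continuous_on UNIV (iter_pd cs (pd f c))"
    "\<forall>d\<in>coords N m. \<forall>x. (\<lambda>t. iter_pd cs (pd f c) (x(d := t))) differentiable (at (x d))"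
    using *[of "cs @ [c]"] cs c by (simp_all add: iter_pd_append)
qed

lemma smooth_alg_pd:
  assumes "smooth_alg N m f" "c \<in> coords N m"
  shows "pdiff f c \<and> smooth_alg N m (pd f c)"
  using assms(1)
proof induction
  case (base f)
  then show ?case using smoothT_local(3) smoothT_pd assms(2) smooth_alg.base by blast
next
  case (const k)
  then show ?case using pd_const[of k c] by (auto intro: smooth_alg.const)
next
  case (coordinate d)
  then show ?case using pd_coordinate[of d c] by (auto intro: smooth_alg.const)
next
  case (add f g)
  then show ?case using pd_add[of f c g] by (auto intro: smooth_alg.add)
next
  case (mult f g)
  then show ?case using pd_mult[of f c g] by (auto intro!: smooth_alg.add smooth_alg.mult)
qed

lemma smooth_alg_local:
  assumes "smooth_alg N m f"
  shows "\<forall>x y. (\<forall>c\<in>coords N m. x c = y c) \<longrightarrow> f x = f y" "continuous_on UNIV f"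
proof -
  show "\<forall>x y. (\<forall>c\<in>coords N m. x c = y c) \<longrightarrow> f x = f y"
    using assms
  proof induction
    case (base f)
    then show ?case by (simp add: smoothT_def)
  next
    case (add f g)
    then show ?case by metis
  next
    case (mult f g)
    then show ?case by metis
  qed auto
  show "continuous_on UNIV f"
    using assms
  proof induction
    case (base f)
    then show ?case by (rule smoothT_local(2))
  next
    case (coordinate c)
    show ?case by (rule continuous_on_product_coordinates)
  qed (auto intro: continuous_intros)
qed

lemma smoothT_iff_smooth_alg: "smoothT N m f \<longleftrightarrow> smooth_alg N m f"
proof
  assume "smooth_alg N m f"
  moreover have "continuous_on UNIV (iter_pd cs f) \<and> (\<forall>c\<in>coords N m. pdiff (iter_pd cs f) c)"
    if "set cs \<subseteq> coords N m" "smooth_alg N m f" for cs f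
    using that
  \<comment> \<open>The derivative applied first stands last in the list, hence induction from the
    right end.\<close>
  proof (induction cs arbitrary: f rule: rev_induct)
    case Nil
    then show ?case using smooth_alg_local(2) smooth_alg_pd by auto
  next
    case (snoc c cs)
    then show ?case using smooth_alg_pd[of N m f c] by (simp add: iter_pd_append)
  qed
  ultimately show "smoothT N m f"
    using smooth_alg_local(1) unfolding smoothT_def pdiff_def by blast
qed (rule smooth_alg.base)

lemma smoothT_intros:
  "smoothT N m (\<lambda>x. k)" "c \<in> coords N m \<Longrightarrow> smoothT N m (\<lambda>x. x c)"
  "smoothT N m f \<Longrightarrow> smoothT N m g \<Longrightarrow> smoothT N m (\<lambda>x. f x + g x)"
  "smoothT N m f \<Longrightarrow> smoothT N m g \<Longrightarrow> smoothT N m (\<lambda>x. f x * g x)"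
  unfolding smoothT_iff_smooth_alg by (auto intro: smooth_alg.intros)

lemma smoothT_sum: "(\<And>i. i \<in> I \<Longrightarrow> smoothT N m (f i)) \<Longrightarrow> smoothT N m (\<lambda>x. \<Sum>i\<in>I. f i x)"
  by (induction I rule: infinite_finite_induct) (auto intro: smoothT_intros)

lemma pd_sum:
  assumes "\<And>i. i \<in> I \<Longrightarrow> pdiff (f i) c"
  shows "pdiff (\<lambda>x. \<Sum>i\<in>I. f i x) c \<and> pd (\<lambda>x. \<Sum>i\<in>I. f i x) c = (\<lambda>x. \<Sum>i\<in>I. pd (f i) c x)"
  using assms
proof (induction I rule: infinite_finite_induct)
  case (insert i I)
  then show ?case using pd_add[of "f i" c "\<lambda>x. \<Sum>i\<in>I. f i x"] by simp
qed (simp_all add: pd_const)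

text \<open>The second difference of u over a square of side h is evaluated by the mean value
  theorem in both orders; this gives h^2 times u12 and h^2 times u21 at two points near (a, b), and
  continuity of the mixed derivatives concludes.\<close>

lemma mixed_partials_commute:
  fixes u u1 u2 u12 u21 :: "real \<Rightarrow> real \<Rightarrow> real"
  assumes d1: "\<And>s t. ((\<lambda>s. u s t) has_real_derivative u1 s t) (at s)"
    and d2: "\<And>s t. ((\<lambda>t. u s t) has_real_derivative u2 s t) (at t)"
    and d12: "\<And>s t. ((\<lambda>t. u1 s t) has_real_derivative u12 s t) (at t)"
    and d21: "\<And>s t. ((\<lambda>s. u2 s t) has_real_derivative u21 s t) (at s)"
    and c12: "continuous_on UNIV (\<lambda>p. u12 (fst p) (snd p))"
    and c21: "continuous_on UNIV (\<lambda>p. u21 (fst p) (snd p))"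
  shows "u12 a b = u21 a b"
proof (rule ccontr)
  assume ne: "\<not> ?thesis"
  define e where "e = \<bar>u12 a b - u21 a b\<bar> / 2"
  have e: "e > 0" using ne by (simp add: e_def)
  have near: "\<exists>d>0. \<forall>s t. a < s \<and> s < a + d \<and> b < t \<and> t < b + d \<longrightarrow> \<bar>w s t - w a b\<bar> < e"
    if c: "continuous_on UNIV (\<lambda>p. w (fst p) (snd p))" for w :: "real \<Rightarrow> real \<Rightarrow> real"
  proof -
    obtain d where d: "d > 0" "\<And>p. dist p (a, b) < d \<Longrightarrow> dist (w (fst p) (snd p)) (w a b) < e"
      using c e unfolding continuous_on_iff by (metis UNIV_I fst_conv snd_conv)
    have "\<bar>w s t - w a b\<bar> < e" if "a < s" "s < a + d / 2" "b < t" "t < b + d / 2" for s t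
    proof -
      have "dist (s, t) (a, b) \<le> \<bar>s - a\<bar> + \<bar>t - b\<bar>"
        using sqrt_sum_squares_le_sum_abs[of "s - a" "t - b"] by (simp add: dist_Pair_Pair dist_real_def)
      also have "\<dots> < d" using that by auto
      finally show ?thesis using d(2)[of "(s, t)"] by (simp add: dist_real_def)
    qed
    then show ?thesis using d(1) by (intro exI[of _ "d / 2"]) auto
  qed
  obtain d d' where d: "d > 0" "\<And>s t. a < s \<Longrightarrow> s < a + d \<Longrightarrow> b < t \<Longrightarrow> t < b + d \<Longrightarrow> \<bar>u12 s t - u12 a b\<bar> < e"
    and d': "d' > 0" "\<And>s t. a < s \<Longrightarrow> s < a + d' \<Longrightarrow> b < t \<Longrightarrow> t < b + d' \<Longrightarrow> \<bar>u21 s t - u21 a b\<bar> < e"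
    using near[OF c12] near[OF c21] by blast
  define h where "h = min d d'"
  have h: "h > 0" "h \<le> d" "h \<le> d'" using d d' by (auto simp: h_def)
  have "\<exists>s>a. s < a + h \<and> (u (a + h) (b + h) - u (a + h) b) - (u a (b + h) - u a b)
      = (a + h - a) * (u1 s (b + h) - u1 s b)"
    using h(1) by (intro MVT2 DERIV_diff d1) auto
  then obtain s where s: "a < s" "s < a + h"
    "(u (a + h) (b + h) - u (a + h) b) - (u a (b + h) - u a b) = h * (u1 s (b + h) - u1 s b)"
    by auto
  have "\<exists>t>b. t < b + h \<and> u1 s (b + h) - u1 s b = (b + h - b) * u12 s t"
    using h(1) by (intro MVT2 d12) auto
  then obtain t where t: "b < t" "t < b + h" "u1 s (b + h) - u1 s b = h * u12 s t"
    by auto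
  have "\<exists>t>b. t < b + h \<and> (u (a + h) (b + h) - u a (b + h)) - (u (a + h) b - u a b)
      = (b + h - b) * (u2 (a + h) t - u2 a t)"
    using h(1) by (intro MVT2 DERIV_diff d2) auto
  then obtain t' where t': "b < t'" "t' < b + h"
    "(u (a + h) (b + h) - u a (b + h)) - (u (a + h) b - u a b) = h * (u2 (a + h) t' - u2 a t')"
    by auto
  have "\<exists>s>a. s < a + h \<and> u2 (a + h) t' - u2 a t' = (a + h - a) * u21 s t'"
    using h(1) by (intro MVT2 d21) auto
  then obtain s' where s': "a < s'" "s' < a + h" "u2 (a + h) t' - u2 a t' = h * u21 s' t'"
    by auto
  have "h * (h * u12 s t) = h * (h * u21 s' t')"
    using s(3)[unfolded t(3)] t'(3)[unfolded s'(3)] by linarith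
  then have "u12 s t = u21 s' t'" using h by simp
  moreover have "\<bar>u12 s t - u12 a b\<bar> < e" "\<bar>u21 s' t' - u21 a b\<bar> < e"
    using d(2)[of s t] d'(2)[of s' t'] s t s' t' h by auto
  moreover have "\<bar>u12 a b - u21 a b\<bar> = 2 * e" by (simp add: e_def)
  ultimately show False by argo
qed

lemma smoothT_mixed_pd:
  assumes f: "smoothT N m f" and ab: "a \<in> coords N m" "b \<in> coords N m"
  shows "pd (pd f a) b x = pd (pd f b) a x"
proof (cases "a = b")
  case False
  define y where "y s t = x(a := s, b := t)" for s t
  have D: "((\<lambda>s. g (y s t)) has_real_derivative pd g a (y s t)) (at s)"
    "((\<lambda>t. g (y s t)) has_real_derivative pd g b (y s t)) (at t)" if "smoothT N m g" for g s t
  proof -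
    have "pdiff g a" "pdiff g b" using smoothT_local(3)[OF that] ab by auto
    then have "((\<lambda>r. g ((y s t)(a := r))) has_real_derivative pd g a (y s t)) (at (y s t a))"
      "((\<lambda>r. g ((y s t)(b := r))) has_real_derivative pd g b (y s t)) (at (y s t b))"
      by (auto simp: pdiff_iff)
    moreover have "(y s t)(a := r) = y r t" "(y s t)(b := r) = y s r" "y s t a = s" "y s t b = t" for r
      using False by (auto simp: y_def fun_upd_twist)
    ultimately show "((\<lambda>s. g (y s t)) has_real_derivative pd g a (y s t)) (at s)"
      "((\<lambda>t. g (y s t)) has_real_derivative pd g b (y s t)) (at t)" by simp_all
  qed
  have cont: "continuous_on UNIV (\<lambda>p. g (y (fst p) (snd p)))" if "smoothT N m g" for g
  proof (rule continuous_on_compose2[OF smoothT_local(2)[OF that]])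
    show "continuous_on UNIV (\<lambda>p. y (fst p) (snd p))"
    proof (rule continuous_on_coordinatewise_then_product)
      fix i
      show "continuous_on UNIV (\<lambda>p. y (fst p) (snd p) i)"
        by (cases "i = a"; cases "i = b") (auto simp: y_def intro!: continuous_intros)
    qed
  qed auto
  have "pd (pd f a) b (y (x a) (x b)) = pd (pd f b) a (y (x a) (x b))"
    by (rule mixed_partials_commute[of "\<lambda>s t. f (y s t)" "\<lambda>s t. pd f a (y s t)" "\<lambda>s t. pd f b (y s t)"
          "\<lambda>s t. pd (pd f a) b (y s t)" "\<lambda>s t. pd (pd f b) a (y s t)"])
      (intro D cont smoothT_pd f ab)+
  moreover have "y (x a) (x b) = x" by (simp add: y_def)
  ultimately show ?thesis by simp
qed simp


lemma finite_coords [simp]: "finite (coords N m)"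
proof -
  have "coords N m \<subseteq> {..m} \<times> {..<N}" by (auto simp: coords_def)
  then show ?thesis by (rule finite_subset) simp
qed

section \<open>Brackets given by a bivector in the coordinates\<close>

lemma sum_rotate:
  fixes W :: "'a \<Rightarrow> 'b \<Rightarrow> 'c \<Rightarrow> real"
  shows "(\<Sum>b\<in>B. \<Sum>c\<in>C. \<Sum>a\<in>A. W b c a) = (\<Sum>a\<in>A. \<Sum>b\<in>B. \<Sum>c\<in>C. W b c a)"
proof -
  have "(\<Sum>b\<in>B. \<Sum>c\<in>C. \<Sum>a\<in>A. W b c a) = (\<Sum>b\<in>B. \<Sum>a\<in>A. \<Sum>c\<in>C. W b c a)"
    by (rule sum.cong[OF refl], rule sum.swap)
  also have "\<dots> = (\<Sum>a\<in>A. \<Sum>b\<in>B. \<Sum>c\<in>C. W b c a)"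
    by (rule sum.swap)
  finally show ?thesis .
qed

text \<open>The Jacobi identity for coordinates implies that for all smooth functions, because the
  terms with second derivatives of the functions cancel in pairs by symmetry of the Hessian.\<close>

lemma poissonT_bivector:
  fixes N m :: nat and P :: "nat \<times> nat \<Rightarrow> nat \<times> nat \<Rightarrow> (nat \<times> nat \<Rightarrow> real) \<Rightarrow> real"
  defines "C \<equiv> coords N m"
  assumes smooth: "\<And>a b. a \<in> C \<Longrightarrow> b \<in> C \<Longrightarrow> smoothT N m (P a b)"
    and skew: "\<And>a b x. a \<in> C \<Longrightarrow> b \<in> C \<Longrightarrow> P a b x = - P b a x"
    and jacobi: "\<And>a b c x. a \<in> C \<Longrightarrow> b \<in> C \<Longrightarrow> c \<in> C \<Longrightarrow>
      (\<Sum>e\<in>C. P a e x * pd (P b c) e x + P b e x * pd (P c a) e x + P c e x * pd (P a b) e x) = 0"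
  shows "poissonT N m (\<lambda>f g x. \<Sum>a\<in>C. \<Sum>b\<in>C. P a b x * pd f a x * pd g b x)"
proof -
  define B where "B f g x = (\<Sum>a\<in>C. \<Sum>b\<in>C. P a b x * pd f a x * pd g b x)" for f g x
  define hv where "hv f x e = (\<Sum>a\<in>C. P a e x * pd f a x)" for f x e
  have pdC: "pdiff f a" if "smoothT N m f" "a \<in> C" for f a
    using smoothT_local(3)[OF that(1)] that(2) by (simp add: C_def)
  have sm: "smoothT N m (pd f a)" if "smoothT N m f" "a \<in> C" for f a
    using smoothT_pd[OF that(1)] that(2) by (simp add: C_def)
  have smB: "smoothT N m (B f g)" if "smoothT N m f" "smoothT N m g" for f g
    unfolding B_def by (intro smoothT_sum smoothT_intros smooth sm that)
  have B_hv: "B f g x = (\<Sum>e\<in>C. hv f x e * pd g e x)" for f g x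
    unfolding B_def hv_def sum_distrib_right by (rule sum.swap)
  have linear: "B f (\<lambda>y. a * g y + b * h y) = (\<lambda>y. a * B f g y + b * B f h y)"
    if "smoothT N m g" "smoothT N m h" for f g h a b
  proof
    fix x
    have "pd (\<lambda>y. a * g y + b * h y) e x = a * pd g e x + b * pd h e x" if "e \<in> C" for e
      using pd_add[of "\<lambda>y. a * g y" e "\<lambda>y. b * h y"] pd_mult[of "\<lambda>y. a" e g] pd_mult[of "\<lambda>y. b" e h]
        pd_const[of a e] pd_const[of b e] pdC[OF \<open>smoothT N m g\<close> that] pdC[OF \<open>smoothT N m h\<close> that]
      by simp
    then show "B f (\<lambda>y. a * g y + b * h y) x = a * B f g x + b * B f h x"
      by (simp add: B_hv sum_distrib_left sum.distrib distrib_left mult.left_commute)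
  qed
  have skewB: "B g f = (\<lambda>y. - B f g y)" for f g
  proof
    fix x
    have "B g f x = (\<Sum>a\<in>C. \<Sum>b\<in>C. - (P b a x * pd f b x * pd g a x))"
      unfolding B_def by (intro sum.cong refl) (subst skew, auto)
    also have "\<dots> = - B f g x"
      unfolding B_def sum_negf by (subst sum.swap) simp
    finally show "B g f x = - B f g x" .
  qed
  have leibniz: "B f (\<lambda>y. g y * h y) = (\<lambda>y. B f g y * h y + g y * B f h y)"
    if "smoothT N m g" "smoothT N m h" for f g h
  proof
    fix x
    have "pd (\<lambda>y. g y * h y) e x = pd g e x * h x + g x * pd h e x" if "e \<in> C" for e
      using pd_mult[of g e h] pdC[OF \<open>smoothT N m g\<close> that] pdC[OF \<open>smoothT N m h\<close> that] by simp
    then show "B f (\<lambda>y. g y * h y) x = B f g x * h x + g x * B f h x"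
      by (simp add: B_hv sum_distrib_left sum_distrib_right sum.distrib distrib_left mult.left_commute mult.assoc)
  qed
  \<comment> \<open>The Hessian of f on two directions; \<open>T\<close> collects the terms in which
    the bivector itself is differentiated.\<close>
  define Q where "Q f u v x = (\<Sum>e\<in>C. \<Sum>b\<in>C. u e * pd (pd f b) e x * v b)" for f u v x
  have Qsym: "Q f u v x = Q f v u x" if "smoothT N m f" for f u v x
    unfolding Q_def
    by (subst sum.swap, intro sum.cong refl) (use smoothT_mixed_pd[OF that] in \<open>simp add: C_def\<close>)
  define T where "T f g h x = (\<Sum>a\<in>C. \<Sum>b\<in>C. \<Sum>c\<in>C. (\<Sum>e\<in>C. P a e x * pd (P b c) e x) * (pd f a x * pd g b x * pd h c x))" for f g h x
  have BB: "B f (B g h) x = T f g h x - Q g (hv f x) (hv h x) x + Q h (hv f x) (hv g x) x"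
    if "smoothT N m f" "smoothT N m g" "smoothT N m h" for f g h x
  proof -
    have pdB: "pd (B g h) e x = (\<Sum>b\<in>C. \<Sum>c\<in>C. pd (P b c) e x * (pd g b x * pd h c x))
        - (\<Sum>b\<in>C. pd (pd g b) e x * hv h x b) + (\<Sum>c\<in>C. pd (pd h c) e x * hv g x c)" if e: "e \<in> C" for e
    proof -
      have dterm: "pdiff (\<lambda>x. P b c x * pd g b x * pd h c x) e \<and>
        pd (\<lambda>x. P b c x * pd g b x * pd h c x) e x = pd (P b c) e x * (pd g b x * pd h c x)
          + pd (pd g b) e x * (P b c x * pd h c x) + pd (pd h c) e x * (P b c x * pd g b x)"
        if "b \<in> C" "c \<in> C" for b c
      proof -
        note pdP = pdC[OF smooth[OF that] e] and pdg = pdC[OF sm[OF \<open>smoothT N m g\<close> that(1)] e]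
          and pdh = pdC[OF sm[OF \<open>smoothT N m h\<close> that(2)] e]
        show ?thesis
          using pd_mult[OF pdP pdg] pd_mult[OF _ pdh, of "\<lambda>x. P b c x * pd g b x"]
          by (simp add: algebra_simps)
      qed
      have inner: "pdiff (\<lambda>x. \<Sum>c\<in>C. P b c x * pd g b x * pd h c x) e \<and>
        pd (\<lambda>x. \<Sum>c\<in>C. P b c x * pd g b x * pd h c x) e x = (\<Sum>c\<in>C. pd (P b c) e x * (pd g b x * pd h c x)
          + pd (pd g b) e x * (P b c x * pd h c x) + pd (pd h c) e x * (P b c x * pd g b x))" if "b \<in> C" for b
        using pd_sum[of C "\<lambda>c x. P b c x * pd g b x * pd h c x" e] dterm[OF that] by (auto intro!: sum.cong)
      have "pd (B g h) e x = (\<Sum>b\<in>C. \<Sum>c\<in>C. pd (P b c) e x * (pd g b x * pd h c x)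
          + pd (pd g b) e x * (P b c x * pd h c x) + pd (pd h c) e x * (P b c x * pd g b x))"
        unfolding B_def
        using pd_sum[of C "\<lambda>b x. \<Sum>c\<in>C. P b c x * pd g b x * pd h c x" e] inner by (auto intro!: sum.cong)
      also have "\<dots> = (\<Sum>b\<in>C. \<Sum>c\<in>C. pd (P b c) e x * (pd g b x * pd h c x))
          + (\<Sum>b\<in>C. pd (pd g b) e x * (\<Sum>c\<in>C. P b c x * pd h c x))
          + (\<Sum>b\<in>C. \<Sum>c\<in>C. pd (pd h c) e x * (P b c x * pd g b x))"
        by (simp only: sum.distrib sum_distrib_left)
      also have "(\<Sum>b\<in>C. pd (pd g b) e x * (\<Sum>c\<in>C. P b c x * pd h c x)) = - (\<Sum>b\<in>C. pd (pd g b) e x * hv h x b)"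
      proof -
        have "(\<Sum>c\<in>C. P b c x * pd h c x) = - hv h x b" if "b \<in> C" for b
          unfolding hv_def sum_negf[symmetric]
        proof (rule sum.cong[OF refl])
          fix c assume "c \<in> C"
          then show "P b c x * pd h c x = - (P c b x * pd h c x)" using skew[OF that, of c x] by simp
        qed
        then show ?thesis by (simp add: sum_negf)
      qed
      also have "(\<Sum>b\<in>C. \<Sum>c\<in>C. pd (pd h c) e x * (P b c x * pd g b x)) = (\<Sum>c\<in>C. pd (pd h c) e x * hv g x c)"
        unfolding hv_def sum_distrib_left by (rule sum.swap)
      finally show ?thesis by simp
    qed
    have "B f (B g h) x = (\<Sum>e\<in>C. hv f x e * (\<Sum>b\<in>C. \<Sum>c\<in>C. pd (P b c) e x * (pd g b x * pd h c x)))
        - Q g (hv f x) (hv h x) x + Q h (hv f x) (hv g x) x"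
      unfolding B_hv[of f "B g h"] Q_def by (simp add: pdB distrib_left right_diff_distrib sum.distrib sum_subtractf sum_distrib_left mult.assoc)
    also have "(\<Sum>e\<in>C. hv f x e * (\<Sum>b\<in>C. \<Sum>c\<in>C. pd (P b c) e x * (pd g b x * pd h c x)))
        = (\<Sum>e\<in>C. \<Sum>a\<in>C. \<Sum>b\<in>C. \<Sum>c\<in>C. P a e x * pd (P b c) e x * (pd f a x * pd g b x * pd h c x))"
      unfolding hv_def by (simp only: sum_distrib_right) (simp only: sum_distrib_left mult_ac)
    also have "\<dots> = T f g h x"
      unfolding T_def sum_distrib_right
      by (subst sum.swap, rule sum.cong[OF refl], subst sum.swap, rule sum.cong[OF refl], subst sum.swap, rule refl)
    finally show ?thesis .
  qed
  have jac: "B f (B g h) x + B g (B h f) x + B h (B f g) x = 0"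
    if s: "smoothT N m f" "smoothT N m g" "smoothT N m h" for f g h x
  proof -
    have T1: "T g h f x = (\<Sum>a\<in>C. \<Sum>b\<in>C. \<Sum>c\<in>C. (\<Sum>e\<in>C. P b e x * pd (P c a) e x) * (pd f a x * pd g b x * pd h c x))"
      unfolding T_def
      by (rule trans[OF sum_rotate]) (simp only: mult_ac)
    have T2: "T h f g x = (\<Sum>a\<in>C. \<Sum>b\<in>C. \<Sum>c\<in>C. (\<Sum>e\<in>C. P c e x * pd (P a b) e x) * (pd f a x * pd g b x * pd h c x))"
      unfolding T_def
      by (rule trans[OF sum_rotate], rule trans[OF sum_rotate]) (simp only: mult_ac)
    have "T f g h x + T g h f x + T h f g x = (\<Sum>a\<in>C. \<Sum>b\<in>C. \<Sum>c\<in>C.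
        (\<Sum>e\<in>C. P a e x * pd (P b c) e x + P b e x * pd (P c a) e x + P c e x * pd (P a b) e x)
          * (pd f a x * pd g b x * pd h c x))"
      unfolding T1 T2 unfolding T_def by (simp only: sum.distrib distrib_right)
    also have "\<dots> = 0" by (simp add: jacobi)
    finally show ?thesis
      unfolding BB[OF s] BB[OF s(2,3,1)] BB[OF s(3,1,2)]
      using Qsym[OF s(1), of "hv g x" "hv h x" x] Qsym[OF s(2), of "hv f x" "hv h x" x] Qsym[OF s(3), of "hv f x" "hv g x" x]
      by linarith
  qed
  have "poissonT N m B"
    unfolding poissonT_def using smB linear skewB leibniz jac by blast
  then show ?thesis by (simp add: B_def[abs_def])
qed

section \<open>Coordinates on the submanifold\<close>

lift_definition bc :: "nat \<Rightarrow> nat \<times> nat \<Rightarrow> band"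
  is "\<lambda>N c i l. if l - i = int (fst c) \<and> int N dvd i - int (snd c) then 1 else 0"
proof -
  fix N :: nat and c :: "nat \<times> nat"
  show "\<exists>a. \<forall>j k. j - k < a \<longrightarrow> (if k - j = int (fst c) \<and> int N dvd j - int (snd c) then 1 else 0) = (0::real)"
    by (rule exI[of _ "- int (fst c)"]) auto
qed

lift_definition bd :: "nat \<Rightarrow> nat \<times> nat \<Rightarrow> band"
  is "\<lambda>N c i l. if i - l = int (fst c) \<and> int N dvd l - int (snd c) then 1 else 0"
  by (rule exI[of _ 0]) auto

definition cf :: "nat \<times> nat \<Rightarrow> band \<Rightarrow> real" where
  "cf c V = ent V (int (snd c)) (int (snd c) + int (fst c))"

definition TT :: "nat \<Rightarrow> nat \<Rightarrow> (nat \<times> nat \<Rightarrow> real) \<Rightarrow> band" where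
  "TT N m x = Eb + (\<Sum>c\<in>coords N m. x c *\<^sub>R bc N c)"

lemma dvd_shift: "int N dvd i + int N - k \<longleftrightarrow> int N dvd i - k"
  by (metis add_diff_eq diff_add_eq dvd_add_triv_right_iff)

lemma per_bc [simp]: "per N (bc N c)" and per_bd [simp]: "per N (bd N c)"
  by (simp_all add: per_def bc.rep_eq bd.rep_eq dvd_shift)

lemma per_TT [simp]: "per N (TT N m x)"
  by (simp add: TT_def)

lemma grade_bd: "grade_ge 0 (bd N c)"
  by (auto simp: grade_ge_def bd.rep_eq)

lemma grade_bc: "grade_le 0 (bc N c)" "c \<in> coords N m \<Longrightarrow> grade_ge (- int m) (bc N c)"
  by (auto simp: grade_ge_def grade_le_def bc.rep_eq coords_def)

lemma grade_TT: "grade_ge (- int m) (TT N m x)" "grade_le 1 (TT N m x)"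
proof -
  show "grade_ge (- int m) (TT N m x)"
    unfolding TT_def
    by (intro grade_ge_simps(2) grade_ge_sum grade_ge_simps(5) grade_bc(2) grade_ge_mono[OF grade_Eb(1)]) auto
  show "grade_le 1 (TT N m x)"
    unfolding TT_def
    by (intro grade_le_simps(2) grade_le_sum grade_le_simps(5) grade_le_mono[OF grade_bc(1)] grade_Eb(3)) auto
qed

lemma cbasis_emb:
  assumes c: "c \<in> coords N m"
  shows "cbasis N c = emb N (bc N c)"
proof (intro ext)
  fix p r s
  obtain j k where jk: "c = (j, k)" by fastforce
  then have k: "k < N" using c by (simp add: coords_def)
  have "p = - int j \<and> r = k \<and> s = (k + j) mod N \<longleftrightarrow>
    r < N \<and> s < N \<and> int N dvd int r - int s - p \<and> int s - (int s + p) = int j \<and> int N dvd int s + p - int k"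
    (is "?l \<longleftrightarrow> ?r")
  proof
    assume ?l
    then have "int s = (int k + int j) mod int N" by (simp add: of_nat_mod)
    then have "int N dvd int k + int j - int s" by simp
    with \<open>?l\<close> k show ?r by (auto simp: algebra_simps dvd_diff_commute)
  next
    assume ?r
    then have p: "p = - int j" by auto
    have "int N dvd (int r - int s - p) + (int s + p - int k)" using \<open>?r\<close> by (blast intro: dvd_add)
    then have "r = k" using k \<open>?r\<close> nat_cong_eq[of r N k] by simp
    moreover have "s = (k + j) mod N"
    proof -
      have "int N dvd int s - int (k + j)" using \<open>?r\<close> p by (simp add: algebra_simps)
      then have "s mod N = (k + j) mod N" by (metis mod_eq_dvd_iff of_nat_eq_iff of_nat_mod)
      then show ?thesis using \<open>?r\<close> by simp
    qed
    ultimately show ?l using p by simp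
  qed
  then show "cbasis N c p r s = emb N (bc N c) p r s"
    by (simp add: cbasis_def jk emb_def bc.rep_eq mod_eq_0_iff_dvd)
qed

lemma cdual_emb:
  assumes c: "c \<in> coords N m"
  shows "cdual N c = emb N (bd N c)"
proof (intro ext)
  fix p r s
  obtain j k where jk: "c = (j, k)" by fastforce
  then have k: "k < N" using c by (simp add: coords_def)
  have "p = int j \<and> r = (k + j) mod N \<and> s = k \<longleftrightarrow>
    r < N \<and> s < N \<and> int N dvd int r - int s - p \<and> (int s + p) - int s = int j \<and> int N dvd int s - int k"
    (is "?l \<longleftrightarrow> ?r")
  proof
    assume ?l
    then have "int r = (int k + int j) mod int N" by (simp add: of_nat_mod)
    then have "int N dvd int k + int j - int r" by simp
    with \<open>?l\<close> k show ?r by (auto simp: algebra_simps dvd_diff_commute)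
  next
    assume ?r
    then have p: "p = int j" and s: "s = k" using nat_cong_eq[of s N k] k by auto
    have "int N dvd int r - int (k + j)" using \<open>?r\<close> p s by (simp add: algebra_simps)
    then have "r mod N = (k + j) mod N" by (metis mod_eq_dvd_iff of_nat_eq_iff of_nat_mod)
    then show ?l using \<open>?r\<close> p s by simp
  qed
  then show "cdual N c p r s = emb N (bd N c) p r s"
    by (auto simp: cdual_def jk emb_def bd.rep_eq mod_eq_0_iff_dvd)
qed

lemma lE_emb: "N > 0 \<Longrightarrow> lE N = emb N Eb"
proof (intro ext)
  fix p r s assume N: "N > 0"
  have "p = 1 \<and> r < N \<and> s < N \<and> r = (s + 1) mod N \<longleftrightarrow>
    r < N \<and> s < N \<and> int N dvd int r - int s - p \<and> int s + p - int s = 1" (is "?l \<longleftrightarrow> ?r")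
  proof
    assume ?l
    then have "int r = (int s + 1) mod int N" by (metis of_nat_1 of_nat_add of_nat_mod)
    then have "int N dvd int s + 1 - int r" by simp
    with \<open>?l\<close> N show ?r by (auto simp: algebra_simps dvd_diff_commute)
  next
    assume ?r
    then have p: "p = 1" by simp
    have "int N dvd int r - int (s + 1)" using \<open>?r\<close> p by (simp add: algebra_simps)
    then have "r mod N = (s + 1) mod N" by (metis mod_eq_dvd_iff of_nat_eq_iff of_nat_mod)
    then show ?l using \<open>?r\<close> p by simp
  qed
  then show "lE N p r s = emb N Eb p r s"
    by (auto simp: lE_def emb_def Eb.rep_eq mod_eq_0_iff_dvd)
qed

lemma lF_emb: "N > 0 \<Longrightarrow> lF N \<alpha> = emb N (Fb \<alpha>)"
  by (simp add: lF_def lI_emb lE_emb emb_linear Fb_def)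

lemma emb_combination:
  "(\<lambda>p r s. \<Sum>c\<in>S. y c * emb N (f c) p r s) = emb N (\<Sum>c\<in>S. y c *\<^sub>R f c)"
  by (simp add: fun_eq_iff emb_sum flip: emb_linear(3)) (simp add: lscale_def)

lemma Tpt_emb: "N > 0 \<Longrightarrow> Tpt N m x = emb N (TT N m x)"
proof -
  assume N: "N > 0"
  have "(\<lambda>p r s. \<Sum>c\<in>coords N m. x c * cbasis N c p r s) = emb N (\<Sum>c\<in>coords N m. x c *\<^sub>R bc N c)"
    unfolding emb_combination[symmetric] by (simp add: cbasis_emb)
  then have "Tpt N m x = ladd (lE N) (emb N (\<Sum>c\<in>coords N m. x c *\<^sub>R bc N c))"
    by (simp add: Tpt_def ladd_def fun_eq_iff)
  then show ?thesis by (simp add: lE_emb N emb_linear TT_def)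
qed

lemma gradT_emb: "gradT N m f x = emb N (\<Sum>c\<in>coords N m. pd f c x *\<^sub>R bd N c)"
  unfolding emb_combination[symmetric] gradT_def by (simp add: cdual_emb)

lemma coord_emb:
  assumes c: "c \<in> coords N m" and per: "per N V"
  shows "coord N c (emb N V) = cf c V"
proof -
  obtain j k where jk: "c = (j, k)" by fastforce
  then have k: "k < N" using c by (simp add: coords_def)
  define s where "s = (k + j) mod N"
  have s: "s < N" using k by (simp add: s_def)
  have "int s = (int k + int j) mod int N" by (simp add: s_def of_nat_mod)
  then have d: "int N dvd int k + int j - int s" by simp
  then have "emb N V (- int j) k s = ent V (int s - int j) (int s)"
    using k s by (simp add: emb_def mod_eq_0_iff_dvd algebra_simps)
  also have "\<dots> = ent V (int k) (int k + int j)"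
    by (rule per_cong[OF per]) (use d in \<open>auto simp: algebra_simps dvd_diff_commute\<close>)
  finally show ?thesis by (simp add: coord_def jk cf_def s_def)
qed

lemma tr_bd:
  assumes c: "c \<in> coords N m"
  shows "tr N (V * bd N c) = cf c V"
proof -
  obtain j k where jk: "c = (j, k)" by fastforce
  then have k: "k < N" using c by (simp add: coords_def)
  have "ent (V * bd N c) (int i) (int i) = (if i = k then cf c V else 0)" if i: "i < N" for i
  proof -
    have "ent (V * bd N c) (int i) (int i) = (\<Sum>l\<in>{int i + int j}. ent V (int i) l * ent (bd N c) l (int i))"
      by (rule times_band_ent) (auto simp: bd.rep_eq jk split: if_splits)
    then show ?thesis using nat_cong_eq[OF i k] by (auto simp: bd.rep_eq jk cf_def)
  qed
  then have "tr N (V * bd N c) = (\<Sum>i<N. if i = k then cf c V else 0)"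
    by (simp add: tr_def)
  then show ?thesis using k by simp
qed

text \<open>Periodicity reduces the entry (i, l) to the row k = i mod N, and l - i, between 0 and m,
  gives the other index; exactly one basis matrix is nonzero there.\<close>

lemma tangent_decomposition:
  assumes N: "N > 0" and V: "per N V" "grade_le 0 V" "grade_ge (- int m) V"
  shows "V = (\<Sum>c\<in>coords N m. cf c V *\<^sub>R bc N c)"
proof (rule band_eqI)
  fix i l :: int
  define k where "k = nat (i mod int N)"
  have k: "int k = i mod int N" "k < N" using N by (auto simp: k_def nat_less_iff)
  have d: "int N dvd i - int k" unfolding k(1) by simp
  show "ent V i l = ent (\<Sum>c\<in>coords N m. cf c V *\<^sub>R bc N c) i l"
  proof (cases "0 \<le> l - i \<and> l - i \<le> int m")
    case True
    define j where "j = nat (l - i)"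
    have j: "int j = l - i" "j \<le> m" using True by (auto simp: j_def)
    have eq: "cf c V * ent (bc N c) i l = (if c = (j, k) then ent V i l else 0)" if "c \<in> coords N m" for c
    proof (cases "c = (j, k)")
      case True
      have "ent V (int k) (int k + int j) = ent V i l"
        by (rule per_cong[OF V(1)]) (use d j in \<open>auto simp: dvd_diff_commute\<close>)
      then show ?thesis using True d j by (simp add: cf_def bc.rep_eq)
    next
      case False
      obtain j' k' where c: "c = (j', k')" by fastforce
      have "\<not> (l - i = int j' \<and> int N dvd i - int k')"
      proof
        assume a: "l - i = int j' \<and> int N dvd i - int k'"
        then have "int N dvd (i - int k') - (i - int k)" using d by (blast intro: dvd_diff)
        then have "k = k'" using nat_cong_eq[of k N k'] k(2) that c by (simp add: coords_def)
        then show False using a j False c by simp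
      qed
      then have "ent (bc N c) i l = 0" by (auto simp: bc.rep_eq c)
      then show ?thesis using False by simp
    qed
    have "ent (\<Sum>c\<in>coords N m. cf c V *\<^sub>R bc N c) i l = (\<Sum>c\<in>coords N m. if c = (j, k) then ent V i l else 0)"
      unfolding ent_sum by (rule sum.cong[OF refl]) (simp add: ent_simps eq)
    also have "\<dots> = ent V i l"
      using j k by (simp add: coords_def)
    finally show ?thesis by simp
  next
    case False
    have "ent (bc N c) i l = 0" if "c \<in> coords N m" for c
      using False that by (auto simp: bc.rep_eq coords_def)
    moreover have "ent V i l = 0"
      using False grade_leD[OF V(2), of l i] grade_geD[OF V(3), of i l] grade_leD[OF V(2), of i l] by force
    ultimately show ?thesis by (simp add: ent_sum ent_simps)
  qed
qed

section \<open>The pencil of brackets in coordinates\<close>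

lemma TT_pencil: "TT N m x + s *\<^sub>R Fb \<alpha> = (1 - s * \<alpha>) *\<^sub>R Eb + ((\<Sum>c\<in>coords N m. x c *\<^sub>R bc N c) + s *\<^sub>R 1)"
  by (simp add: TT_def Fb_def algebra_simps)

lemma TT_update:
  assumes "c \<in> coords N m"
  shows "TT N m (x(c := t)) = TT N m x + (t - x c) *\<^sub>R bc N c"
proof -
  have "(\<Sum>d\<in>coords N m. (x(c := t)) d *\<^sub>R bc N d)
      = (\<Sum>d\<in>coords N m. x d *\<^sub>R bc N d + (if d = c then (t - x c) *\<^sub>R bc N c else 0))"
    by (intro sum.cong refl) (auto simp: algebra_simps)
  then show ?thesis using assms by (simp add: TT_def sum.distrib)
qed

definition pencil :: "nat \<Rightarrow> nat \<Rightarrow> real \<Rightarrow> real \<Rightarrow> nat \<times> nat \<Rightarrow> nat \<times> nat \<Rightarrow> (nat \<times> nat \<Rightarrow> real) \<Rightarrow> real" where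
  "pencil N m \<alpha> s a b x = qb N (TT N m x + s *\<^sub>R Fb \<alpha>) (TT N m x + s *\<^sub>R Fb \<alpha>) (bd N a) (bd N b)"

text \<open>Expanding both slots exhibits a polynomial of degree at most two in the
  coordinates.\<close>

lemma smooth_pencil: "smoothT N m (pencil N m \<alpha> s a b)"
proof -
  let ?C = "coords N m" and ?K = "(1 - s * \<alpha>) *\<^sub>R Eb + s *\<^sub>R 1" and ?X = "bd N a" and ?Y = "bd N b"
  have "pencil N m \<alpha> s a b = (\<lambda>x. qb N ?K ?K ?X ?Y + (\<Sum>c\<in>?C. x c * qb N ?K (bc N c) ?X ?Y)
    + (\<Sum>c\<in>?C. x c * (qb N (bc N c) ?K ?X ?Y + (\<Sum>d\<in>?C. x d * qb N (bc N c) (bc N d) ?X ?Y))))"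
  proof
    fix x
    have "TT N m x + s *\<^sub>R Fb \<alpha> = ?K + (\<Sum>c\<in>?C. x c *\<^sub>R bc N c)"
      unfolding TT_pencil by simp
    then show "pencil N m \<alpha> s a b x = qb N ?K ?K ?X ?Y + (\<Sum>c\<in>?C. x c * qb N ?K (bc N c) ?X ?Y)
      + (\<Sum>c\<in>?C. x c * (qb N (bc N c) ?K ?X ?Y + (\<Sum>d\<in>?C. x d * qb N (bc N c) (bc N d) ?X ?Y)))"
      unfolding pencil_def
      by (simp only: qb_linear(1)[of N ?K] qb_linear(3)[of N _ ?K] qb_sum qb_linear(2,4) sum.distrib[symmetric])
        (simp add: qb_linear(2,4) qb_sum sum.distrib sum_distrib_left distrib_left, subst sum.swap,
          simp add: mult.left_commute)
  qed
  then show ?thesis by (simp only:) (intro smoothT_intros smoothT_sum)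
qed

lemma pd_pencil:
  assumes e: "e \<in> coords N m"
  shows "pdiff (pencil N m \<alpha> s a b) e \<and> pd (pencil N m \<alpha> s a b) e
    = (\<lambda>x. qb N (bc N e) (TT N m x + s *\<^sub>R Fb \<alpha>) (bd N a) (bd N b) + qb N (TT N m x + s *\<^sub>R Fb \<alpha>) (bc N e) (bd N a) (bd N b))"
proof (rule pdI)
  fix x
  let ?L = "TT N m x + s *\<^sub>R Fb \<alpha>" and ?X = "bd N a" and ?Y = "bd N b"
  have "pencil N m \<alpha> s a b (x(e := t)) = qb N ?L ?L ?X ?Y + (t - x e) * (qb N (bc N e) ?L ?X ?Y + qb N ?L (bc N e) ?X ?Y)
     + (t - x e) * (t - x e) * qb N (bc N e) (bc N e) ?X ?Y" for t
  proof -
    have "TT N m (x(e := t)) + s *\<^sub>R Fb \<alpha> = ?L + (t - x e) *\<^sub>R bc N e"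
      using TT_update[OF e] by simp
    then show ?thesis
      unfolding pencil_def by (simp only: qb_linear) (simp add: algebra_simps)
  qed
  moreover have "((\<lambda>t. A + (t - r) * B + (t - r) * (t - r) * D) has_real_derivative B) (at r)" for A B D r :: real
    by (auto intro!: derivative_eq_intros)
  ultimately show "((\<lambda>t. pencil N m \<alpha> s a b (x(e := t))) has_real_derivative
      qb N (bc N e) ?L ?X ?Y + qb N ?L (bc N e) ?X ?Y) (at (x e))"
    by simp
qed

text \<open>Tangency enters here: the ambient field has grades between -m and 0, so its components
  along the coordinates determine it. Differentiating along the coordinates with bracket
  coefficients is therefore differentiating along the ambient field, and the ambient Jacobi identity
  restricts.\<close>

lemma hvf_coordinates:
  assumes N: "N \<ge> 2" and L: "L = TT N m x + s *\<^sub>R Fb \<alpha>" and X: "per N X"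
  shows "hvf N L X = - (\<Sum>e\<in>coords N m. qb N L L X (bd N e) *\<^sub>R bc N e)"
proof -
  have per: "per N L" by (simp add: L)
  have "grade_ge (- int m) L"
    unfolding L by (intro grade_ge_simps grade_TT(1) grade_ge_mono[OF grade_Fb(1)]) simp
  then have "grade_ge (- int m) (hvf N L X)" by (rule grade_ge_hvf)
  moreover have "grade_le 0 (hvf N L X)"
  proof (rule grade_le_hvf[OF N per X])
    show "L = (1 - s * \<alpha>) *\<^sub>R Eb + ((\<Sum>c\<in>coords N m. x c *\<^sub>R bc N c) + s *\<^sub>R 1)"
      unfolding L by (rule TT_pencil)
    show "grade_le 0 ((\<Sum>c\<in>coords N m. x c *\<^sub>R bc N c) + s *\<^sub>R 1)"
      by (intro grade_le_simps grade_le_sum grade_bc(1) diagonal_grades(2)) simp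
  qed
  ultimately have "hvf N L X = (\<Sum>e\<in>coords N m. cf e (hvf N L X) *\<^sub>R bc N e)"
    using N per X by (intro tangent_decomposition) auto
  also have "\<dots> = (\<Sum>e\<in>coords N m. - (qb N L L X (bd N e) *\<^sub>R bc N e))"
  proof (rule sum.cong[OF refl])
    fix e assume e: "e \<in> coords N m"
    have "cf e (hvf N L X) = - qb N L L X (bd N e)"
      using tr_bd[OF e, of "hvf N L X"] tr_commute[of N "hvf N L X" "bd N e"] qb_hvf[OF per X, of "bd N e"] per X
      by simp
    then show "cf e (hvf N L X) *\<^sub>R bc N e = - (qb N L L X (bd N e) *\<^sub>R bc N e)" by simp
  qed
  finally show ?thesis by (simp add: sum_negf)
qed

lemma pencil_jacobi:
  assumes N: "N \<ge> 2"
  shows "(\<Sum>e\<in>coords N m. pencil N m \<alpha> s a e x * pd (pencil N m \<alpha> s b c) e x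
    + pencil N m \<alpha> s b e x * pd (pencil N m \<alpha> s c a) e x
    + pencil N m \<alpha> s c e x * pd (pencil N m \<alpha> s a b) e x) = 0"
proof -
  define L where "L = TT N m x + s *\<^sub>R Fb \<alpha>"
  have per: "per N L" by (simp add: L_def)
  have "(\<Sum>e\<in>coords N m. pencil N m \<alpha> s a e x * pd (pencil N m \<alpha> s b c) e x)
      = - (qb N L (hvf N L (bd N a)) (bd N b) (bd N c) + qb N (hvf N L (bd N a)) L (bd N b) (bd N c))" for a b c
  proof -
    have "(\<Sum>e\<in>coords N m. pencil N m \<alpha> s a e x * pd (pencil N m \<alpha> s b c) e x)
      = (\<Sum>e\<in>coords N m. qb N L L (bd N a) (bd N e) * (qb N (bc N e) L (bd N b) (bd N c) + qb N L (bc N e) (bd N b) (bd N c)))"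
      by (rule sum.cong[OF refl]) (simp add: pd_pencil L_def pencil_def)
    also have "\<dots> = qb N (- hvf N L (bd N a)) L (bd N b) (bd N c) + qb N L (- hvf N L (bd N a)) (bd N b) (bd N c)"
      unfolding hvf_coordinates[OF N L_def per_bd] minus_minus qb_sum qb_linear
      by (simp add: distrib_left sum.distrib)
    also have "\<dots> = - (qb N L (hvf N L (bd N a)) (bd N b) (bd N c) + qb N (hvf N L (bd N a)) L (bd N b) (bd N c))"
      using qb_linear(2)[of N "-1" "hvf N L (bd N a)"] qb_linear(4)[of N L "-1" "hvf N L (bd N a)"] by simp
    finally show ?thesis .
  qed
  then show ?thesis
    using qb_jacobi[OF per per_bd per_bd per_bd, of b c a]
    by (simp add: sum.distrib)
qed

section \<open>The linear bracket and the linear combinations\<close>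

definition lbT :: "nat \<Rightarrow> nat \<Rightarrow> real \<Rightarrow> nat \<times> nat \<Rightarrow> nat \<times> nat \<Rightarrow> (nat \<times> nat \<Rightarrow> real) \<Rightarrow> real" where
  "lbT N m \<alpha> a b x = lb N \<alpha> (TT N m x) (bd N a) (bd N b)"

lemma pencil_affine: "pencil N m \<alpha> s a b x = pencil N m \<alpha> 0 a b x + s * lbT N m \<alpha> a b x"
  unfolding pencil_def lbT_def
  using qb_pencil[of N "TT N m x" "bd N a" "bd N b" s \<alpha>] grade_bd by simp

lemma combination_jacobi:
  fixes c1 c2 \<alpha> :: real and N m :: nat
  assumes N: "N \<ge> 2"
  defines "P \<equiv> \<lambda>a b x. c1 * lbT N m \<alpha> a b x + c2 * pencil N m \<alpha> 0 a b x"
  shows "(\<Sum>e\<in>coords N m. P a e x * pd (P b c) e x + P b e x * pd (P c a) e x + P c e x * pd (P a b) e x) = 0"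
    and "smoothT N m (P a b)"
proof -
  let ?C = "coords N m"
  define p0 p1 where "p0 = pencil N m \<alpha> 0" and "p1 = lbT N m \<alpha>"
  have p1: "p1 a b = (\<lambda>x. 1 * pencil N m \<alpha> 1 a b x + (-1) * p0 a b x)" for a b
    using pencil_affine[of N m \<alpha> 1 a b] by (auto simp: p0_def p1_def)
  have sm: "smoothT N m (p0 a b)" "smoothT N m (p1 a b)" for a b
    unfolding p1 unfolding p0_def by (intro smoothT_intros smooth_pencil)+
  then show "smoothT N m (P a b)"
    unfolding P_def p0_def[symmetric] p1_def[symmetric] by (intro smoothT_intros)
  have pdl: "pd (\<lambda>x. r * p1 a b x + q * p0 a b x) e x = r * pd (p1 a b) e x + q * pd (p0 a b) e x"
    if "e \<in> ?C" for r q a b e x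
    using pd_add[of "\<lambda>x. r * p1 a b x" e "\<lambda>x. q * p0 a b x"] pd_mult[of "\<lambda>x. r" e "p1 a b"]
      pd_mult[of "\<lambda>x. q" e "p0 a b"] pd_const[of r e] pd_const[of q e]
      smoothT_local(3)[OF sm(1) that] smoothT_local(3)[OF sm(2) that] by simp
  define J where "J r q = (\<Sum>e\<in>?C. (r * p1 a e x + q * p0 a e x) * (r * pd (p1 b c) e x + q * pd (p0 b c) e x)
    + (r * p1 b e x + q * p0 b e x) * (r * pd (p1 c a) e x + q * pd (p0 c a) e x)
    + (r * p1 c e x + q * p0 c e x) * (r * pd (p1 a b) e x + q * pd (p0 a b) e x))" for r q
  define A where "A u v = (\<Sum>e\<in>?C. u a e x * pd (v b c) e x + u b e x * pd (v c a) e x + u c e x * pd (v a b) e x)"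
    for u v :: "nat \<times> nat \<Rightarrow> nat \<times> nat \<Rightarrow> (nat \<times> nat \<Rightarrow> real) \<Rightarrow> real"
  have J: "J r q = r * r * A p1 p1 + r * q * (A p1 p0 + A p0 p1) + q * q * A p0 p0" for r q
    unfolding J_def A_def sum_distrib_left sum.distrib[symmetric]
    by (rule sum.cong[OF refl]) (simp add: algebra_simps)
  have J0: "J s 1 = 0" for s
  proof -
    have eq: "pencil N m \<alpha> s a b = (\<lambda>x. s * p1 a b x + 1 * p0 a b x)" for a b
      using pencil_affine[of N m \<alpha> s a b] by (auto simp: p0_def p1_def)
    have "(\<Sum>e\<in>?C. pencil N m \<alpha> s a e x * pd (pencil N m \<alpha> s b c) e x
      + pencil N m \<alpha> s b e x * pd (pencil N m \<alpha> s c a) e x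
      + pencil N m \<alpha> s c e x * pd (pencil N m \<alpha> s a b) e x) = J s 1"
      unfolding J_def eq by (rule sum.cong[OF refl]) (simp only: pdl)
    then show ?thesis using pencil_jacobi[OF N] by simp
  qed
  \<comment> \<open>The pencil reaches the coefficients (s, 1) only. The values at s = 0, 1, -1
    annihilate all three coefficients of the quadratic form, which therefore vanishes at (c1, 0)
    too.\<close>
  have "A p0 p0 = 0" "A p1 p1 = 0" "A p1 p0 + A p0 p1 = 0"
    using J0[of 0] J0[of 1] J0[of "-1"] unfolding J by simp_all
  then have "J c1 c2 = 0" by (simp add: J)
  moreover have "(\<Sum>e\<in>?C. P a e x * pd (P b c) e x + P b e x * pd (P c a) e x + P c e x * pd (P a b) e x) = J c1 c2"
    unfolding J_def P_def p0_def[symmetric] p1_def[symmetric] by (rule sum.cong[OF refl]) (simp only: pdl)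
  ultimately show "(\<Sum>e\<in>?C. P a e x * pd (P b c) e x + P b e x * pd (P c a) e x + P c e x * pd (P a b) e x) = 0"
    by simp
qed

lemma ib2_coordinates:
  assumes N: "N > 0"
  shows "ib2 N m f g x = (\<Sum>a\<in>coords N m. \<Sum>b\<in>coords N m. pencil N m \<alpha> 0 a b x * pd f a x * pd g b x)"
proof -
  let ?L = "TT N m x" and ?X = "\<lambda>f. \<Sum>c\<in>coords N m. pd f c x *\<^sub>R bd N c"
  have "ib2 N m f g x = qb N ?L ?L (?X f) (?X g)"
    unfolding ib2_def Tpt_emb[OF N] gradT_emb by (rule pb2_emb[OF N]) simp_all
  also have "\<dots> = (\<Sum>a\<in>coords N m. pd f a x * (\<Sum>b\<in>coords N m. pd g b x * qb N ?L ?L (bd N a) (bd N b)))"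
    unfolding qb_sum(3) qb_linear(6) unfolding qb_sum(4) qb_linear(8) ..
  finally show ?thesis by (simp add: pencil_def sum_distrib_left mult_ac)
qed

text \<open>R is the identity on nonnegative grades, so the two halves of the bracket coincide and R
  disappears.\<close>

lemma pb1_emb:
  assumes "N > 0" "per N L" "per N X" "per N Y" "grade_ge 0 X" "grade_ge 0 Y"
  shows "pb1 N \<alpha> (emb N L) (emb N X) (emb N Y) = lb N \<alpha> L X Y"
proof -
  have "neg A = 0" if "grade_ge 0 A" for A
    using that by (intro band_eqI) (simp add: restr.rep_eq ent_simps grade_ge_def)
  then have R: "Rop (emb N X) = emb N X" "Rop (emb N Y) = emb N Y"
    using assms by (simp_all add: projections_emb)
  show ?thesis
    using assms unfolding pb1_def R
    by (simp add: lbrF_def lF_emb emb_lmul emb_linear lpair_emb lb_def distrib_right mult.assoc)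
qed

lemma lb_sum:
  "lb N \<alpha> L (\<Sum>a\<in>A. f a *\<^sub>R X a) (\<Sum>b\<in>B. g b *\<^sub>R Y b) = (\<Sum>a\<in>A. \<Sum>b\<in>B. f a * g b * lb N \<alpha> L (X a) (Y b))"
  by (simp add: lb_def left_diff_distrib sum_distrib_left sum_distrib_right tr_sum sum_subtractf
      right_diff_distrib mult_ac sum.swap[of _ A B])

lemma ib1_coordinates:
  assumes N: "N > 0"
  shows "ib1 N m \<alpha> f g x = (\<Sum>a\<in>coords N m. \<Sum>b\<in>coords N m. lbT N m \<alpha> a b x * pd f a x * pd g b x)"
  unfolding ib1_def Tpt_emb[OF N] gradT_emb
  by (subst pb1_emb[OF N]) (simp_all add: lb_sum lbT_def mult_ac grade_ge_sum grade_bd)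

lemma brackets_compatible:
  assumes N: "N \<ge> 2"
  shows "poissonT N m (\<lambda>f g y. c1 * ib1 N m \<alpha> f g y + c2 * ib2 N m f g y)"
proof -
  define P where "P a b x = c1 * lbT N m \<alpha> a b x + c2 * pencil N m \<alpha> 0 a b x" for a b x
  have "poissonT N m (\<lambda>f g x. \<Sum>a\<in>coords N m. \<Sum>b\<in>coords N m. P a b x * pd f a x * pd g b x)"
  proof (rule poissonT_bivector)
    fix a b x
    show "smoothT N m (P a b)"
      unfolding P_def[abs_def] by (rule combination_jacobi(2)[OF N])
    have "pencil N m \<alpha> 0 a b x = - pencil N m \<alpha> 0 b a x"
      unfolding pencil_def by (rule qb_skew) simp_all
    moreover have "lbT N m \<alpha> a b x = - lbT N m \<alpha> b a x"
      by (simp add: lbT_def lb_def left_diff_distrib)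
    ultimately show "P a b x = - P b a x" by (simp add: P_def)
  next
    fix a b c x
    show "(\<Sum>e\<in>coords N m. P a e x * pd (P b c) e x + P b e x * pd (P c a) e x + P c e x * pd (P a b) e x) = 0"
      unfolding P_def[abs_def] by (rule combination_jacobi(1)[OF N])
  qed
  moreover have "(\<lambda>f g y. c1 * ib1 N m \<alpha> f g y + c2 * ib2 N m f g y)
    = (\<lambda>f g x. \<Sum>a\<in>coords N m. \<Sum>b\<in>coords N m. P a b x * pd f a x * pd g b x)"
    using N by (simp add: fun_eq_iff ib1_coordinates ib2_coordinates[where \<alpha> = \<alpha>] P_def sum_distrib_left
        distrib_right sum.distrib mult.assoc)
  ultimately show ?thesis by simp
qed

section \<open>Functions constant on parabolas\<close>

text \<open>Without joint continuity, the moving ordinate has to be handled by the bound itself: at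
  the abscissa of the n-th point, the values at y + h and at y are both compared with the value at
  that point's own ordinate, and then only limits at fixed ordinates remain. The strict inequality
  for h leaves room for the moving ordinate.\<close>

lemma closed_lipschitz_along_ordinate:
  fixes f :: "real \<Rightarrow> real \<Rightarrow> real"
  assumes contx: "\<And>y. continuous_on UNIV (\<lambda>x. f x y)"
  shows "closed {p. \<forall>h. \<bar>h\<bar> < r \<longrightarrow> \<bar>f (fst p) (snd p + h) - f (fst p) (snd p)\<bar> \<le> K * \<bar>h\<bar>}" (is "closed ?E")
  unfolding closed_sequential_limits
proof (intro allI impI, elim conjE)
  fix p l assume pE: "\<forall>n. p n \<in> ?E" and lim: "p \<longlonglongrightarrow> l"
  obtain x y where l: "l = (x, y)" by fastforce
  define X Y where "X n = fst (p n)" and "Y n = snd (p n)" for n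
  have X: "X \<longlonglongrightarrow> x" and Y: "Y \<longlonglongrightarrow> y"
    using tendsto_fst[OF lim] tendsto_snd[OF lim] l by (simp_all add: X_def[abs_def] Y_def[abs_def])
  have lip: "\<bar>f (X n) z - f (X n) (Y n)\<bar> \<le> K * \<bar>z - Y n\<bar>" if "\<bar>z - Y n\<bar> < r" for n z
    using pE[rule_format, of n] that by (auto simp: X_def Y_def dest: spec[of _ "z - snd (p n)"])
  have fX: "(\<lambda>n. f (X n) z) \<longlonglongrightarrow> f x z" for z
    using contx[of z] X by (auto simp: continuous_on_eq_continuous_at intro: isCont_tendsto_compose)
  have "\<bar>f x (y + h) - f x y\<bar> \<le> K * \<bar>h\<bar>" if h: "\<bar>h\<bar> < r" for h
  proof -
    have h': "(\<lambda>n. \<bar>y + h - Y n\<bar>) \<longlonglongrightarrow> \<bar>h\<bar>" and y': "(\<lambda>n. \<bar>y - Y n\<bar>) \<longlonglongrightarrow> 0"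
      by (rule tendsto_eq_intros Y | simp)+
    have ev: "\<forall>\<^sub>F n in sequentially. \<bar>f (X n) (y + h) - f (X n) y\<bar> \<le> K * \<bar>y + h - Y n\<bar> + K * \<bar>y - Y n\<bar>"
    proof -
      have "\<forall>\<^sub>F n in sequentially. \<bar>y + h - Y n\<bar> < r"
        using h' h by (rule order_tendstoD)
      moreover have "\<forall>\<^sub>F n in sequentially. \<bar>y - Y n\<bar> < r"
        using y' by (rule order_tendstoD) (use h in auto)
      ultimately show ?thesis
      proof eventually_elim
        case (elim n)
        then show ?case using lip[of "y + h" n] lip[of y n] by linarith
      qed
    qed
    have "(\<lambda>n. \<bar>f (X n) (y + h) - f (X n) y\<bar>) \<longlonglongrightarrow> \<bar>f x (y + h) - f x y\<bar>"
      by (intro tendsto_intros fX)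
    from tendsto_le[OF sequentially_bot _ this ev, of "K * \<bar>h\<bar> + K * 0"]
    show ?thesis
      using tendsto_add[OF tendsto_mult_left[OF h', of K] tendsto_mult_left[OF y', of K]] by simp
  qed
  then show "l \<in> ?E" by (simp add: l)
qed

lemma differentiable_imp_lipschitz_at:
  fixes g :: "real \<Rightarrow> real"
  assumes "g differentiable (at y)"
  shows "\<exists>n. \<forall>h. \<bar>h\<bar> < 1 / real (Suc n) \<longrightarrow> \<bar>g (y + h) - g y\<bar> \<le> real (Suc n) * \<bar>h\<bar>"
proof -
  obtain D where D: "(g has_real_derivative D) (at y)"
    using assms real_differentiable_def by blast
  then have lim: "(\<lambda>h. (g (y + h) - g y) / h) \<midarrow>0\<rightarrow> D"
    by (simp add: DERIV_def)
  obtain d where d: "d > 0" "\<And>h. h \<noteq> 0 \<Longrightarrow> \<bar>h\<bar> < d \<Longrightarrow> \<bar>(g (y + h) - g y) / h - D\<bar> < 1"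
    using LIM_D[OF lim zero_less_one] by auto
  obtain n where n: "real n > 1 / d" "real n > \<bar>D\<bar> + 1"
    using reals_Archimedean2[of "max (1 / d) (\<bar>D\<bar> + 1)"] by auto
  have "\<bar>g (y + h) - g y\<bar> \<le> real (Suc n) * \<bar>h\<bar>" if h: "\<bar>h\<bar> < 1 / real (Suc n)" for h
  proof (cases "h = 0")
    case False
    have "1 / real (Suc n) < d"
    proof -
      have "1 < real n * d" using n(1) d(1) by (simp add: pos_divide_less_eq)
      then show ?thesis using d(1) by (simp add: pos_divide_less_eq algebra_simps)
    qed
    then have "\<bar>(g (y + h) - g y) / h - D\<bar> < 1" using d(2)[OF False] h by linarith
    then have "\<bar>(g (y + h) - g y) / h\<bar> \<le> real (Suc n)" using n(2) by linarith
    then show ?thesis using False by (simp add: abs_divide pos_divide_le_eq)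
  qed simp
  then show ?thesis by blast
qed

text \<open>If no \<open>E n\<close> contained a portion of P, the sets \<open>P - E n\<close> would
  be relatively open and dense in P, but their intersection is empty.\<close>

lemma Baire_portion:
  fixes P :: "'a::{real_normed_vector,heine_borel} set"
  assumes "closed P" "P \<noteq> {}" "\<And>n::nat. closed (E n)" "P \<subseteq> (\<Union>n. E n)"
  obtains n p \<rho> where "p \<in> P" "\<rho> > 0" "ball p \<rho> \<inter> P \<subseteq> E n"
proof -
  have "\<exists>n. \<not> P \<subseteq> closure (P - E n)"
  proof (rule ccontr)
    assume "\<not> ?thesis"
    then have *: "P \<subseteq> closure (P - E n)" for n by blast
    have "P \<subseteq> closure (\<Inter>(range (\<lambda>n. P - E n)))"
    proof (rule Baire[OF assms(1)])
      fix T assume "T \<in> range (\<lambda>n. P - E n)"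
      then obtain n where T: "T = P - E n" by blast
      have "openin (top_of_set P) (P \<inter> - E n)"
        using assms(3) by (intro openin_open_Int) auto
      then show "openin (top_of_set P) T \<and> P \<subseteq> closure T"
        using * by (simp add: T Diff_eq)
    qed auto
    moreover have "\<Inter>(range (\<lambda>n. P - E n)) = {}" using assms(4) by blast
    ultimately show False using assms(2) by (metis closure_empty subset_empty)
  qed
  then obtain n p where p: "p \<in> P" "p \<notin> closure (P - E n)" by blast
  then obtain \<rho> where "\<rho> > 0" "\<forall>y\<in>P - E n. \<not> dist y p < \<rho>"
    unfolding closure_approachable by blast
  then show ?thesis using p(1) by (intro that[of p \<rho> n]) (auto simp: dist_commute)
qed

text \<open>Baire's theorem on the equation f_x = f_y, in the version of Chernoff and Royden (no joint
  continuity of f is assumed), for the family of parabolas y = x^2 + c instead of lines.\<close>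

lemma constant_on_parabolas:
  fixes f :: "real \<Rightarrow> real \<Rightarrow> real"
  assumes contx: "\<And>y. continuous_on UNIV (\<lambda>x. f x y)"
    and diffy: "\<And>x y. f x differentiable (at y)"
    and tangent: "\<And>x y. ((\<lambda>t. f (x + t) (y + 2 * x * t)) has_real_derivative 0) (at 0)"
  shows "f x (c + x\<^sup>2) = f x' (c + x'\<^sup>2)"
proof -
  \<comment> \<open>The label c straightens the parabolas to horizontal lines. P consists of the
    points without a neighbourhood in which F is independent of x, and \<open>E n\<close> of those
    where F is Lipschitz in c at a fixed scale; differentiability in the ordinate makes the
    \<open>E n\<close> cover the plane.\<close>
  define F where "F x c = f x (c + x\<^sup>2)" for x c
  define good where "good p \<longleftrightarrow> (\<exists>\<epsilon>>0. \<forall>c'. \<bar>c' - snd p\<bar> < \<epsilon> \<longrightarrow>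
      (\<forall>x x'. \<bar>x - fst p\<bar> < \<epsilon> \<longrightarrow> \<bar>x' - fst p\<bar> < \<epsilon> \<longrightarrow> F x c' = F x' c'))" for p :: "real \<times> real"
  define P where "P = - Collect good"
  define E where "E n = {p. \<forall>h. \<bar>h\<bar> < 1 / real (Suc n) \<longrightarrow>
      \<bar>F (fst p) (snd p + h) - F (fst p) (snd p)\<bar> \<le> real (Suc n) * \<bar>h\<bar>}" for n
  have contc: "continuous_on UNIV (F x)" for x
  proof -
    have "continuous_on UNIV (f x)"
      using diffy by (simp add: continuous_at_imp_continuous_on differentiable_imp_continuous_within)
    then show ?thesis
      unfolding F_def by (rule continuous_on_compose2) (auto intro!: continuous_intros)
  qed
  have "open (Collect good)"
    unfolding open_dist
  proof (intro ballI)
    fix p assume "p \<in> Collect good"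
    then obtain e where e: "e > 0" "\<And>c' x x'. \<bar>c' - snd p\<bar> < e \<Longrightarrow> \<bar>x - fst p\<bar> < e \<Longrightarrow> \<bar>x' - fst p\<bar> < e \<Longrightarrow> F x c' = F x' c'"
      by (auto simp: good_def)
    have "good q" if q: "dist q p < e / 2" for q
    proof -
      have "\<bar>fst q - fst p\<bar> < e / 2" "\<bar>snd q - snd p\<bar> < e / 2"
        using q dist_fst_le[of q p] dist_snd_le[of q p] by (auto simp: dist_real_def)
      then show ?thesis
        unfolding good_def using e(1) by (intro exI[of _ "e / 2"] conjI allI impI e(2)) linarith+
    qed
    then show "\<exists>e>0. \<forall>y. dist y p < e \<longrightarrow> y \<in> Collect good"
      using e(1) by (intro exI[of _ "e / 2"]) auto
  qed
  then have "closed P" unfolding P_def by (rule closed_Compl)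
  have "closed (E n)" for n
  proof -
    let ?E = "{p. \<forall>h. \<bar>h\<bar> < 1 / real (Suc n) \<longrightarrow> \<bar>f (fst p) (snd p + h) - f (fst p) (snd p)\<bar> \<le> real (Suc n) * \<bar>h\<bar>}"
    have "E n = (\<lambda>p. (fst p, snd p + (fst p)\<^sup>2)) -` ?E"
      by (auto simp: E_def F_def algebra_simps)
    moreover have "closed ((\<lambda>p::real \<times> real. (fst p, snd p + (fst p)\<^sup>2)) -` ?E)"
      by (intro continuous_closed_vimage closed_lipschitz_along_ordinate contx continuous_intros)
    ultimately show ?thesis by simp
  qed
  moreover have "P \<subseteq> (\<Union>n. E n)"
  proof
    fix p
    show "p \<in> (\<Union>n. E n)"
      using differentiable_imp_lipschitz_at[OF diffy[of "fst p" "snd p + (fst p)\<^sup>2"]]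
      by (auto simp: E_def F_def algebra_simps)
  qed
  have leaf: "F x c = F x' c" if S: "convex S" "\<And>\<xi>. \<xi> \<in> S \<Longrightarrow> (\<xi>, c) \<notin> P" "x \<in> S" "x' \<in> S" for S x x' c
  proof -
    have "((\<lambda>x. F x c) has_real_derivative 0) (at \<xi> within S)" if \<xi>: "\<xi> \<in> S" for \<xi>
    proof -
      have "good (\<xi>, c)" using S(2)[OF \<xi>] by (simp add: P_def)
      then obtain e where e: "e > 0" "\<And>c' x x'. \<bar>c' - c\<bar> < e \<Longrightarrow> \<bar>x - \<xi>\<bar> < e \<Longrightarrow> \<bar>x' - \<xi>\<bar> < e \<Longrightarrow> F x c' = F x' c'"
        unfolding good_def fst_conv snd_conv by blast
      have "((\<lambda>x. F \<xi> c) has_real_derivative 0) (at \<xi> within S)" by simp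
      then show ?thesis
        by (rule has_field_derivative_transform_within[OF _ e(1) \<xi>])
          (rule e(2), use e(1) in \<open>auto simp: dist_real_def\<close>)
    qed
    then obtain b where "\<forall>x\<in>S. F x c = b"
      using has_field_derivative_zero_constant[OF S(1)] by blast
    then show ?thesis using S by simp
  qed
  have "P = {}"
  proof (rule ccontr)
    assume "P \<noteq> {}"
    then obtain n p \<rho> where p: "p \<in> P" "\<rho> > 0" "ball p \<rho> \<inter> P \<subseteq> E n"
      using Baire_portion[OF \<open>closed P\<close> _ \<open>\<And>n. closed (E n)\<close> \<open>P \<subseteq> _\<close>] by metis
    obtain x0 c0 where pxc: "p = (x0, c0)" by fastforce
    define K where "K = real (Suc n)"
    \<comment> \<open>Two coordinate deviations of at most \<delta> stay inside the ball of radius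
      \<rho>, and increments of size up to 2 \<delta> are admissible for the bound in
      \<open>E n\<close>.\<close>
    define \<delta> where "\<delta> = min (\<rho> / 3) (1 / (3 * K))"
    have K: "K > 0" by (simp add: K_def)
    then have \<delta>: "\<delta> > 0" "2 * \<delta> < 1 / K" "2 * \<delta> < \<rho>"
      using p(2) by (auto simp: \<delta>_def min_def field_simps)
    have lipP: "\<bar>F x (c + h) - F x c\<bar> \<le> K * \<bar>h\<bar>"
      if "(x, c) \<in> P" "\<bar>x - x0\<bar> \<le> \<delta>" "\<bar>c - c0\<bar> \<le> \<delta>" "\<bar>h\<bar> \<le> 2 * \<delta>" for x c h
    proof -
      have "dist p (x, c) \<le> \<bar>x0 - x\<bar> + \<bar>c0 - c\<bar>"
        using sqrt_sum_squares_le_sum_abs[of "x0 - x" "c0 - c"] by (simp add: pxc dist_Pair_Pair dist_real_def)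
      then have "(x, c) \<in> E n" using p(3) that \<delta> by auto
      then show ?thesis using that \<delta> by (auto simp: E_def K_def)
    qed
    \<comment> \<open>The bound spreads from P to abscissas outside it. From x one moves towards x2
      up to the nearest abscissa xs of a point of P in the strip; on the way F is constant on each
      leaf, so the difference at x equals that at xs. As cs lies between c1 and c2, the two bounds
      at (xs, cs) add up to K (c2 - c1).\<close>
    have lip: "\<bar>F x c2 - F x c1\<bar> \<le> K * (c2 - c1)"
      if hit: "(x2, c1) \<in> P \<or> (x2, c2) \<in> P" "\<bar>x2 - x0\<bar> \<le> \<delta>" and x: "\<bar>x - x0\<bar> \<le> \<delta>"
        and c: "c1 < c2" "\<bar>c1 - c0\<bar> \<le> \<delta>" "\<bar>c2 - c0\<bar> \<le> \<delta>" for x x2 c1 c2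
    proof -
      let ?S = "P \<inter> (closed_segment x x2 \<times> {c1..c2})"
      have S: "compact ?S" using \<open>closed P\<close> by (intro closed_Int_compact compact_Times) auto
      have S': "?S \<noteq> {}" using hit c by auto
      have "continuous_on ?S (\<lambda>q. \<bar>fst q - x\<bar>)" by (intro continuous_intros)
      from continuous_attains_inf[OF S S' this]
      obtain q where q: "q \<in> ?S" "\<And>q'. q' \<in> ?S \<Longrightarrow> \<bar>fst q - x\<bar> \<le> \<bar>fst q' - x\<bar>"
        by blast
      obtain xs cs where qq: "q = (xs, cs)" by fastforce
      have xs: "(xs, cs) \<in> P" "xs \<in> closed_segment x x2" "c1 \<le> cs" "cs \<le> c2"
        using q(1) qq by auto
      have xs0: "\<bar>xs - x0\<bar> \<le> \<delta>"
        using xs(2) hit(2) x by (auto simp: closed_segment_eq_real_ivl split: if_splits)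
      define g where "g t = xs + t * (x - xs)" for t
      have noP: "(g t, c) \<notin> P" if "t \<in> {0<..1}" "xs \<noteq> x" "c \<in> {c1..c2}" for t c
      proof
        assume "(g t, c) \<in> P"
        moreover have gt: "g t \<in> closed_segment x xs"
          using that(1) by (auto simp: g_def closed_segment_def algebra_simps intro!: exI[of _ "1 - t"])
        then have "g t \<in> closed_segment x x2"
          using xs(2) by (meson closed_segment_subset convex_closed_segment ends_in_segment(1) subsetD)
        ultimately have "\<bar>xs - x\<bar> \<le> \<bar>g t - x\<bar>" using q(2)[of "(g t, c)"] that(3) by (simp add: qq)
        moreover have "g t - x = (1 - t) * (xs - x)" by (simp add: g_def algebra_simps)
        then have "\<bar>g t - x\<bar> = (1 - t) * \<bar>xs - x\<bar>" using that(1) by (simp add: abs_mult)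
        moreover have "(1 - t) * \<bar>xs - x\<bar> < 1 * \<bar>xs - x\<bar>"
          using that by (intro mult_strict_right_mono) auto
        ultimately show False by simp
      qed
      have "F xs c = F x c" if ne: "xs \<noteq> x" and cc: "c1 < c" "c < c2" for c
      proof -
        \<comment> \<open>Along a leaf both arguments of f move, so F need not be continuous in x.
          The abscissa xs is approached at a fixed ordinate instead, where f is continuous; the
          label \<open>?ct\<close> then varies and tends to c, and F at x is continuous in the
          label.\<close>
        let ?ct = "\<lambda>t. c + xs\<^sup>2 - (g t)\<^sup>2"
        have g0: "(g \<longlongrightarrow> xs) (at_right 0)"
          unfolding g_def by (rule tendsto_eq_intros | simp)+
        have c0: "(?ct \<longlongrightarrow> c) (at_right 0)"
          by (rule tendsto_eq_intros g0 | simp)+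
        have fA: "((\<lambda>t. f (g t) (c + xs\<^sup>2)) \<longlongrightarrow> f xs (c + xs\<^sup>2)) (at_right 0)"
          using contx[of "c + xs\<^sup>2"] g0
          by (auto simp: continuous_on_eq_continuous_at intro: isCont_tendsto_compose)
        have fB: "((\<lambda>t. F x (?ct t)) \<longlongrightarrow> F x c) (at_right 0)"
          using contc[of x] c0 by (auto simp: continuous_on_eq_continuous_at intro: isCont_tendsto_compose)
        have "\<forall>\<^sub>F t in at_right 0. f (g t) (c + xs\<^sup>2) = F x (?ct t)"
        proof -
          have "\<forall>\<^sub>F t in at_right 0. c1 < ?ct t" "\<forall>\<^sub>F t in at_right 0. ?ct t < c2"
            using c0 cc by (auto intro: order_tendstoD)
          moreover have "\<forall>\<^sub>F t in at_right 0. t \<in> {0<..<1::real}"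
            by (rule eventually_at_right_real) simp
          ultimately show ?thesis
          proof eventually_elim
            case (elim t)
            have "convex (g ` {0<..1})"
            proof -
              have "g ` {0<..1} = (\<lambda>u. xs + u) ` ((\<lambda>t. (x - xs) * t) ` {0<..1})"
                by (auto simp: g_def image_image mult.commute)
              then show ?thesis
                using convex_translation[OF convex_scaling[of "{0<..1::real}" "x - xs"], of xs] by simp
            qed
            moreover have "x \<in> g ` {0<..1}" by (rule image_eqI[of _ _ 1]) (auto simp: g_def)
            moreover have "g t \<in> g ` {0<..1}" using elim by auto
            moreover have "(\<xi>, ?ct t) \<notin> P" if "\<xi> \<in> g ` {0<..1}" for \<xi>
              using that noP ne elim by auto
            ultimately have "F (g t) (?ct t) = F x (?ct t)" by (intro leaf[of "g ` {0<..1}"]) auto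
            then show ?case by (simp add: F_def)
          qed
        qed
        from tendsto_unique[OF trivial_limit_at_right_real Lim_transform_eventually[OF fA this] fB]
        show ?thesis by (simp add: F_def)
      qed
      \<comment> \<open>The end labels were excluded so that the perturbed label stays in the strip;
        they follow by continuity in c.\<close>
      then have "{c1<..<c2} \<subseteq> {c. F xs c = F x c}" by (cases "xs = x") auto
      moreover have "closed {c. F xs c = F x c}" by (intro closed_Collect_eq contc)
      ultimately have "closure {c1<..<c2} \<subseteq> {c. F xs c = F x c}" by (rule closure_minimal)
      then have eq: "F xs c = F x c" if "c1 \<le> c" "c \<le> c2" for c
        using c(1) that by (auto simp: closure_greaterThanLessThan)
      have "\<bar>F xs c2 - F xs cs\<bar> \<le> K * \<bar>c2 - cs\<bar>" "\<bar>F xs c1 - F xs cs\<bar> \<le> K * \<bar>c1 - cs\<bar>"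
        using lipP[OF xs(1) xs0, of "c2 - cs"] lipP[OF xs(1) xs0, of "c1 - cs"] xs(3,4) c by auto
      then have "\<bar>F x c2 - F x c1\<bar> \<le> K * (c2 - cs) + K * (cs - c1)"
        using eq[of c1] eq[of c2] xs(3,4) c(1) by auto
      then show ?thesis by (simp add: algebra_simps)
    qed
    have "F x c = F x' c" if x: "\<bar>x - x0\<bar> < \<delta>" "\<bar>x' - x0\<bar> < \<delta>" and c: "\<bar>c - c0\<bar> < \<delta>" for x x' c
    proof (cases "\<exists>x2. \<bar>x2 - x0\<bar> \<le> \<delta> \<and> (x2, c) \<in> P")
      case False
      show ?thesis
        by (rule leaf[of "{x0 - \<delta>..x0 + \<delta>}"]) (use False x in \<open>auto simp: abs_le_iff\<close>)
    next
      case True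
      then obtain x2 where x2: "\<bar>x2 - x0\<bar> \<le> \<delta>" "(x2, c) \<in> P" by blast
      let ?S = "{x0 - \<delta><..<x0 + \<delta>}"
      have "((\<lambda>x. F x c) has_real_derivative 0) (at \<xi>)" if \<xi>: "\<xi> \<in> ?S" for \<xi>
      proof -
        \<comment> \<open>The tangent line and the parabola differ by t^2 in the ordinate. The
          derivative along the tangent is zero, and \<open>lip\<close> bounds the difference by K
          t^2, so F has derivative zero along the leaf. The point x2 of P on this leaf makes
          \<open>lip\<close> applicable.\<close>
        define T where "T t = f (\<xi> + t) (c + \<xi>\<^sup>2 + 2 * \<xi> * t)" for t
        define R where "R t = F (\<xi> + t) c - T t" for t
        have R: "R t = F (\<xi> + t) c - F (\<xi> + t) (c - t\<^sup>2)" for t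
          by (simp add: R_def T_def F_def power2_eq_square algebra_simps)
        have small: "\<forall>\<^sub>F t in at 0. norm (R t / t) \<le> K * \<bar>t\<bar>"
        proof -
          have "\<forall>\<^sub>F t in at 0. \<bar>\<xi> + t - x0\<bar> < \<delta>"
          proof (rule order_tendstoD(2))
            show "((\<lambda>t. \<bar>\<xi> + t - x0\<bar>) \<longlongrightarrow> \<bar>\<xi> + 0 - x0\<bar>) (at 0)" by (intro tendsto_intros)
          qed (use \<xi> in \<open>auto simp: abs_less_iff\<close>)
          moreover have "\<forall>\<^sub>F t in at 0. \<bar>c - t\<^sup>2 - c0\<bar> < \<delta>"
          proof (rule order_tendstoD(2))
            show "((\<lambda>t. \<bar>c - t\<^sup>2 - c0\<bar>) \<longlongrightarrow> \<bar>c - 0\<^sup>2 - c0\<bar>) (at 0)" by (intro tendsto_intros)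
          qed (use c in auto)
          moreover have "\<forall>\<^sub>F t in at (0::real). t \<noteq> 0" by (simp add: eventually_at_filter)
          ultimately show ?thesis
          proof eventually_elim
            case (elim t)
            have "\<bar>R t\<bar> \<le> K * (c - (c - t\<^sup>2))"
              unfolding R by (rule lip[of x2]) (use x2 elim c in auto)
            then have "\<bar>R t\<bar> \<le> K * \<bar>t\<bar> * \<bar>t\<bar>" by (simp add: power2_eq_square mult.assoc)
            then show ?case using elim by (simp add: abs_divide pos_divide_le_eq)
          qed
        qed
        have "((\<lambda>t. K * \<bar>t\<bar>) \<longlongrightarrow> K * \<bar>0\<bar>) (at 0)"
          by (intro tendsto_intros)
        then have "((\<lambda>t. K * \<bar>t\<bar>) \<longlongrightarrow> 0) (at 0)" by simp
        with small have "((\<lambda>t. R t / t) \<longlongrightarrow> 0) (at 0)" by (rule Lim_null_comparison)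
        moreover have "R 0 = 0" by (simp add: R)
        ultimately have "(R has_real_derivative 0) (at 0)" by (simp add: DERIV_def)
        from DERIV_add[OF tangent[of \<xi> "c + \<xi>\<^sup>2", folded T_def] this]
        have "((\<lambda>t. F (\<xi> + t) c) has_real_derivative 0) (at 0)" by (simp add: R_def)
        then show ?thesis
          using DERIV_shift[of "\<lambda>x. F x c" 0 0 \<xi>] by (simp add: add.commute)
      qed
      then obtain b where "\<forall>x\<in>?S. F x c = b"
        using has_field_derivative_zero_constant[of ?S "\<lambda>x. F x c"] by (auto intro: has_field_derivative_at_within)
      then show ?thesis using x by (auto simp: abs_less_iff)
    qed
    then have "good p" unfolding good_def pxc using \<delta>(1) by auto
    then show False using p(1) by (simp add: P_def)
  qed
  then have "F x c = F x' c" by (intro leaf[of UNIV]) auto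
  then show ?thesis by (simp add: F_def)
qed

section \<open>Shifts, idempotents and central series\<close>

lift_definition Es :: "int \<Rightarrow> band" is "\<lambda>p i l. if i - l = p then 1 else 0"
  by (rule_tac x = int in exI) auto

text \<open>The idempotent E_kk repeated periodically; an integer index, meaningful modulo N, keeps
  the commutation with shifts free of case distinctions.\<close>

lift_definition eb :: "nat \<Rightarrow> int \<Rightarrow> band" is "\<lambda>N k i l. if i = l \<and> int N dvd i - k then 1 else 0"
  by (rule exI[of _ 0]) simp

text \<open>The scalar matrix of the series a in the variable lambda^N, which is
  \<open>Es (int N)\<close>.\<close>

lift_definition zseries :: "nat \<Rightarrow> real fps \<Rightarrow> band"
  is "\<lambda>N a i l. if l \<le> i \<and> int N dvd i - l then fps_nth a (nat ((i - l) div int N)) else 0"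
  by (rule exI[of _ 0]) simp

lemma Eb_eq_Es: "Eb = Es 1"
  by (rule band_eqI) (simp add: Eb.rep_eq Es.rep_eq)

lemma Es_0: "Es 0 = 1"
  by (rule band_eqI) (simp add: Es.rep_eq ent_simps)

lemma ent_Es_mult: "ent (Es p * A) i l = ent A (i - p) l" "ent (A * Es p) i l = ent A i (l + p)"
proof -
  have "ent (Es p * A) i l = (\<Sum>r\<in>{i - p}. ent (Es p) i r * ent A r l)"
    by (rule times_band_ent) (auto simp: Es.rep_eq split: if_splits)
  then show "ent (Es p * A) i l = ent A (i - p) l" by (simp add: Es.rep_eq)
  have "ent (A * Es p) i l = (\<Sum>r\<in>{l + p}. ent A i r * ent (Es p) r l)"
    by (rule times_band_ent) (auto simp: Es.rep_eq split: if_splits)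
  then show "ent (A * Es p) i l = ent A i (l + p)" by (simp add: Es.rep_eq)
qed

lemma Es_mult: "Es p * Es q = Es (p + q)"
  by (rule band_eqI) (auto simp: ent_Es_mult Es.rep_eq)

lemma per_Es [simp]: "per N (Es p)" and per_eb [simp]: "per N (eb N k)"
  by (simp_all add: per_def Es.rep_eq eb.rep_eq dvd_shift)

lemma diagonal_eb [simp]: "diagonal (eb N k)"
  by (simp add: diagonal_def eb.rep_eq)

lemma eb_mult: "eb N k * eb N l = (if int N dvd k - l then eb N k else 0)"
proof (rule band_eqI)
  fix i j
  have "int N dvd k - l" if "int N dvd i - k" "int N dvd i - l"
    using dvd_diff[OF that(2,1)] by simp
  moreover have "int N dvd i - l" if "int N dvd i - k" "int N dvd k - l"
    using dvd_add[OF that] by simp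
  ultimately show "ent (eb N k * eb N l) i j = ent (if int N dvd k - l then eb N k else 0) i j"
    by (auto simp: diagonal_mult_left eb.rep_eq ent_simps)
qed

lemma eb_shift: "eb N k * Es p = Es p * eb N (k - p)"
  by (rule band_eqI) (auto simp: ent_Es_mult eb.rep_eq algebra_simps)

lemma eb_cong: "int N dvd k - l \<Longrightarrow> eb N k = eb N l"
proof (rule band_eqI)
  fix i j assume d: "int N dvd k - l"
  have "int N dvd i - k \<longleftrightarrow> int N dvd i - l"
    using dvd_add_left_iff[OF d, of "i - k"] by (simp add: add.commute)
  then show "ent (eb N k) i j = ent (eb N l) i j" by (simp add: eb.rep_eq)
qed

lemma sum_eb:
  assumes "N > 0"
  shows "(\<Sum>k<N. eb N (int k)) = 1"
proof (rule band_eqI)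
  fix i l
  define r where "r = nat (i mod int N)"
  have r: "int r = i mod int N" "r < N" using assms by (auto simp: r_def nat_less_iff)
  have d: "int N dvd i - int r" unfolding r(1) by simp
  have "int N dvd i - int k \<longleftrightarrow> k = r" if "k < N" for k
  proof
    assume "int N dvd i - int k"
    then have "int N dvd (i - int r) - (i - int k)" using d by (blast intro: dvd_diff)
    then show "k = r" using nat_cong_eq[OF that r(2)] by simp
  qed (use d in simp)
  then have "(\<Sum>k<N. ent (eb N (int k)) i l) = (\<Sum>k<N. if k = r then (if i = l then 1 else 0) else 0)"
    by (intro sum.cong refl) (auto simp: eb.rep_eq)
  then show "ent (\<Sum>k<N. eb N (int k)) i l = ent 1 i l"
    using r(2) by (simp add: ent_sum ent_simps)
qed

lemma sum_eb_pred:
  assumes "N > 0"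
  shows "(\<Sum>k<N - 1. eb N (int k)) = 1 - eb N (int N - 1)"
proof -
  obtain n where n: "N = Suc n" using assms by (metis Suc_pred)
  have "(\<Sum>k<n. eb N (int k)) + eb N (int n) = 1"
    using sum_eb[OF assms] unfolding n by simp
  then show ?thesis by (simp add: n algebra_simps)
qed

lemma tr_Es_eb:
  assumes N: "N > 0" and A: "per N A"
  shows "tr N (A * (Es p * eb N k)) = ent A k (k + p)"
proof -
  define r where "r = nat (k mod int N)"
  have r: "int r = k mod int N" "r < N" using N by (auto simp: r_def nat_less_iff)
  have d: "int N dvd int r - k" unfolding r(1) by (simp add: dvd_diff_commute)
  have "int N dvd int j - k \<longleftrightarrow> j = r" if "j < N" for j
  proof
    assume "int N dvd int j - k"
    then have "int N dvd (int j - k) - (int r - k)" using d by (blast intro: dvd_diff)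
    then show "j = r" using nat_cong_eq[OF that r(2)] by simp
  qed (use d in simp)
  then have "tr N (A * Es p * eb N k) = (\<Sum>j<N. if j = r then ent A (int r) (int r + p) else 0)"
    unfolding tr_def by (intro sum.cong refl) (auto simp: diagonal_mult_right ent_Es_mult eb.rep_eq)
  then have "tr N (A * Es p * eb N k) = ent A (int r) (int r + p)" using r(2) by simp
  also have "\<dots> = ent A k (k + p)"
    by (rule per_cong[OF A d]) simp
  finally show ?thesis by (simp add: mult.assoc)
qed

lemma tr_nondegenerate:
  assumes N: "N > 0" and "per N A" "per N B" and eq: "\<And>M. per N M \<Longrightarrow> tr N (A * M) = tr N (B * M)"
  shows "A = B"
proof (rule band_eqI)
  fix i l
  show "ent A i l = ent B i l"
    using eq[of "Es (l - i) * eb N i"] tr_Es_eb[OF N assms(2), of "l - i" i] tr_Es_eb[OF N assms(3), of "l - i" i]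
    by simp
qed

section \<open>Power series in lambda^N as central elements\<close>

lemma per_zseries [simp]: "per N (zseries N a)"
  by (simp add: per_def zseries.rep_eq)

lemma grade_zseries: "grade_ge 0 (zseries N a)"
  by (simp add: grade_ge_def zseries.rep_eq)

lemma zseries_central:
  assumes M: "per N M"
  shows "zseries N a * M = M * zseries N a"
proof (rule band_eqI)
  fix i l
  obtain b where b: "grade_ge b M" using ent_bounded by blast
  have eq: "ent (zseries N a) i r * ent M r l = ent M i (l + i - r) * ent (zseries N a) (l + i - r) l" for r
  proof (cases "int N dvd i - r")
    case True
    have "ent M i (l + i - r) = ent M r l"
      by (rule per_cong[OF M True]) simp
    then show ?thesis by (simp add: zseries.rep_eq)
  qed (simp add: zseries.rep_eq)
  have "ent (zseries N a * M) i l = (\<Sum>r\<in>{l + b..i - 0}. ent (zseries N a) i r * ent M r l)"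
    by (rule times_band_ent_interval[OF grade_zseries b]) auto
  also have "\<dots> = (\<Sum>r\<in>{l + 0..i - b}. ent M i r * ent (zseries N a) r l)"
    by (rule sum.reindex_bij_witness[of _ "\<lambda>r. l + i - r" "\<lambda>r. l + i - r"]) (auto simp: eq)
  also have "\<dots> = ent (M * zseries N a) i l"
    by (rule times_band_ent_interval[OF b grade_zseries, symmetric]) auto
  finally show "ent (zseries N a * M) i l = ent (M * zseries N a) i l" .
qed

lemma dvd_nonneg_obtain:
  assumes "l \<le> i" "int N dvd i - l" "N > 0"
  obtains q where "i = l + int N * int q"
proof -
  obtain q' where q': "i - l = int N * q'" using assms(2) by (auto simp: dvd_def)
  then have "0 \<le> int N * q'" using assms(1) by linarith
  then have "0 \<le> q'" using assms(3) by (simp add: zero_le_mult_iff)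
  then show ?thesis using q' by (intro that[of "nat q'"]) simp
qed

lemma zseries_mult:
  assumes N: "N > 0"
  shows "zseries N a * zseries N b = zseries N (a * b)"
proof (rule band_eqI)
  fix i l
  show "ent (zseries N a * zseries N b) i l = ent (zseries N (a * b)) i l"
  proof (cases "l \<le> i \<and> int N dvd i - l")
    case False
    have "ent (zseries N a) i r * ent (zseries N b) r l = 0" for r
    proof (rule ccontr)
      assume "\<not> ?thesis"
      then have "r \<le> i" "l \<le> r" "int N dvd i - r" "int N dvd r - l"
        by (auto simp: zseries.rep_eq split: if_splits)
      then show False using False dvd_add[of "int N" "i - r" "r - l"] by simp
    qed
    then have "ent (zseries N a * zseries N b) i l = 0"
      unfolding times_band_ent_interval[OF grade_zseries grade_zseries order_refl order_refl]
      by (intro sum.neutral) blast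
    then show ?thesis using False by (auto simp: zseries.rep_eq)
  next
    case True
    then obtain q where q: "i = l + int N * int q" using dvd_nonneg_obtain N by blast
    have "ent (zseries N a * zseries N b) i l
        = (\<Sum>r\<in>(\<lambda>s. l + int N * int s) ` {0..q}. ent (zseries N a) i r * ent (zseries N b) r l)"
    proof (rule times_band_ent)
      fix r assume "ent (zseries N a) i r \<noteq> 0" "ent (zseries N b) r l \<noteq> 0"
      then have r: "r \<le> i" "l \<le> r" "int N dvd r - l" by (auto simp: zseries.rep_eq split: if_splits)
      then obtain s where s: "r = l + int N * int s" using dvd_nonneg_obtain N by blast
      then show "r \<in> (\<lambda>s. l + int N * int s) ` {0..q}"
        using r(1) q N by (intro image_eqI[of _ _ s]) simp_all
    qed simp
    also have "\<dots> = (\<Sum>s\<in>{0..q}. fps_nth a (q - s) * fps_nth b s)"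
    proof (subst sum.reindex)
      show "inj_on (\<lambda>s. l + int N * int s) {0..q}" using N by (auto simp: inj_on_def)
      have "ent (zseries N a) i (l + int N * int s) * ent (zseries N b) (l + int N * int s) l
          = fps_nth a (q - s) * fps_nth b s" if "s \<le> q" for s
      proof -
        have e: "i - (l + int N * int s) = int N * int (q - s)" using that q by (simp add: of_nat_diff algebra_simps)
        have "l + int N * int s \<le> i" using q that N by simp
        then show ?thesis using N by (simp add: zseries.rep_eq e)
      qed
      then show "sum ((\<lambda>r. ent (zseries N a) i r * ent (zseries N b) r l) \<circ> (\<lambda>s. l + int N * int s)) {0..q}
          = (\<Sum>s\<in>{0..q}. fps_nth a (q - s) * fps_nth b s)" by simp
    qed
    also have "\<dots> = fps_nth (b * a) q" 
      unfolding fps_mult_nth by (intro sum.cong refl) (rule mult.commute)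
    also have "\<dots> = ent (zseries N (a * b)) i l" using N q by (simp add: zseries.rep_eq mult.commute[of b a])
    finally show ?thesis .
  qed
qed

lemma zseries_1: "N > 0 \<Longrightarrow> zseries N 1 = 1"
proof (rule band_eqI)
  fix i l assume N: "N > 0"
  show "ent (zseries N 1) i l = ent 1 i l"
  proof (cases "l \<le> i \<and> int N dvd i - l")
    case True
    then obtain q where "i = l + int N * int q" using dvd_nonneg_obtain N by blast
    then show ?thesis using N by (auto simp: zseries.rep_eq ent_simps)
  qed (auto simp: zseries.rep_eq ent_simps)
qed

lemma zseries_power: "N > 0 \<Longrightarrow> zseries N a ^ n = zseries N (a ^ n)"
  by (induction n) (simp_all add: zseries_1 zseries_mult)

lemma zseries_linear: "N > 0 \<Longrightarrow> zseries N (1 - fps_const b * fps_X) = 1 - b *\<^sub>R Es (int N)"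
proof (rule band_eqI)
  fix i l assume N: "N > 0"
  show "ent (zseries N (1 - fps_const b * fps_X)) i l = ent (1 - b *\<^sub>R Es (int N)) i l"
  proof (cases "l \<le> i \<and> int N dvd i - l")
    case True
    then obtain q where q: "i = l + int N * int q" using dvd_nonneg_obtain N by blast
    then show ?thesis using N by (auto simp: zseries.rep_eq ent_simps Es.rep_eq fps_X_def)
  qed (auto simp: zseries.rep_eq ent_simps Es.rep_eq)
qed

text \<open>The constant term of 1 - b x is 1, so its formal N-th root and the inverse of that root
  exist; read as series in lambda^N they are central. The root serves to absorb a determinant in
  \<open>cunit_diagonal\<close>.\<close>

lemma central_root:
  assumes N: "N > 0"
  obtains u u' where "per N u" "per N u'" "u * u' = 1" "u' * u = 1" "u ^ N = 1 - b *\<^sub>R Es (int N)"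
    "\<And>M. per N M \<Longrightarrow> u * M = M * u" "\<And>M. per N M \<Longrightarrow> u' * M = M * u'"
proof -
  obtain n where n: "N = Suc n" using N by (metis Suc_pred)
  define a :: "real fps" where "a = 1 - fps_const b * fps_X"
  define r where "r = fps_radical (\<lambda>n x. root n x) N a"
  have a0: "fps_nth a 0 = 1" by (simp add: a_def)
  have rN: "r ^ N = a"
    using power_radical[of a "\<lambda>n x. root n x" n] a0 by (simp add: r_def n)
  have r0: "fps_nth r 0 \<noteq> 0" using N a0 by (simp add: r_def)
  show ?thesis
  proof (rule that[of "zseries N r" "zseries N (inverse r)"])
    show "zseries N r * zseries N (inverse r) = 1" "zseries N (inverse r) * zseries N r = 1"
      by (simp_all only: zseries_mult[OF N] inverse_mult_eq_1[OF r0] inverse_mult_eq_1'[OF r0] zseries_1[OF N])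
    show "zseries N r ^ N = 1 - b *\<^sub>R Es (int N)"
      by (simp only: zseries_power[OF N] rN a_def zseries_linear[OF N])
  qed (simp_all add: zseries_central)
qed

text \<open>For opposite matrix units X and Y this factors the signed transposition of two basis
  vectors into transvections.\<close>

lemma unipotent_triple:
  fixes X Y :: "'a::ring_1"
  assumes "X * X = 0" "X * Y * X = X"
  shows "(1 + X) * (1 - Y) * (1 + X) = 1 - X * Y - Y * X + X - Y"
  using assms by (simp add: algebra_simps)

section \<open>Invariance under conjugation\<close>

locale ad_invariant =
  fixes N :: nat and \<Phi> :: "band \<Rightarrow> real" and g :: "band \<Rightarrow> band"
  assumes N: "N \<ge> 2"
    and gradient: "\<And>A M. per N A \<Longrightarrow> per N M \<Longrightarrow>
      ((\<lambda>\<epsilon>. \<Phi> (A + \<epsilon> *\<^sub>R M)) has_real_derivative tr N (g A * M)) (at 0)"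
    and per_g: "\<And>A. per N A \<Longrightarrow> per N (g A)"
    and g_commute: "\<And>A. per N A \<Longrightarrow> g A * A = A * g A"
begin

lemma gradient_at:
  assumes "per N A" "per N M"
  shows "((\<lambda>t. \<Phi> (A + t *\<^sub>R M)) has_real_derivative tr N (g (A + r *\<^sub>R M) * M)) (at r)"
proof -
  have "((\<lambda>\<epsilon>. \<Phi> (A + (\<epsilon> + r) *\<^sub>R M)) has_real_derivative tr N (g (A + r *\<^sub>R M) * M)) (at 0)"
    using gradient[of "A + r *\<^sub>R M" M] assms by (simp add: algebra_simps)
  then show ?thesis using DERIV_shift[of "\<lambda>t. \<Phi> (A + t *\<^sub>R M)" _ 0 r] by simp
qed

text \<open>For n^2 = 0 the conjugates of L by 1 + x n are L + x A - x^2 B, a parabola in the plane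
  L + x A - y B. At every point M of this plane the commutator [n, M] is A - 2 x B, which depends on
  x only; so the derivative vanishes in the direction of every translated parabola y = x^2 + c, as
  \<open>constant_on_parabolas\<close> demands.\<close>

lemma invariant_square_zero:
  assumes per: "per N n" "per N L" and n: "n * n = 0"
  shows "\<Phi> ((1 + n) * L * (1 - n)) = \<Phi> L"
proof -
  define A B where "A = n * L - L * n" and "B = n * L * n"
  have pAB: "per N A" "per N B" using per by (simp_all add: A_def B_def)
  define f where "f x y = \<Phi> (L + x *\<^sub>R A - y *\<^sub>R B)" for x y
  have fx: "(\<lambda>x. f x y) differentiable (at x)" for x y
    using gradient_at[of "L - y *\<^sub>R B" A x] per pAB
    unfolding real_differentiable_def f_def by (auto simp: algebra_simps)
  have fy: "f x differentiable (at y)" for x y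
    using gradient_at[of "L + x *\<^sub>R A" "- B" y] per pAB
    unfolding real_differentiable_def f_def[abs_def] by auto
  have nn: "n * (n * M) = 0" for M using n by (simp flip: mult.assoc)
  have "f 1 (0 + 1\<^sup>2) = f 0 (0 + 0\<^sup>2)"
  proof (rule constant_on_parabolas[where f = f])
    show "continuous_on UNIV (\<lambda>x. f x y)" for y
      using fx by (simp add: continuous_at_imp_continuous_on differentiable_imp_continuous_within)
    show "f x differentiable (at y)" for x y by (rule fy)
    fix x y
    define M where "M = L + x *\<^sub>R A - y *\<^sub>R B"
    have pM: "per N M" using per pAB by (simp add: M_def)
    have "A - (2 * x) *\<^sub>R B = n * M - M * n"
      by (simp add: M_def A_def B_def algebra_simps n nn flip: scaleR_2)
    then have "tr N (g M * (A - (2 * x) *\<^sub>R B)) = tr N (g M * (n * M)) - tr N (g M * (M * n))"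
      by (simp add: right_diff_distrib)
    also have "\<dots> = 0"
      using tr_commute[of N "g M * n" M] g_commute[OF pM] per_g[OF pM] pM per
      by (simp flip: mult.assoc)
    finally have "((\<lambda>t. \<Phi> (M + t *\<^sub>R (A - (2 * x) *\<^sub>R B))) has_real_derivative 0) (at 0)"
      using gradient[OF pM, of "A - (2 * x) *\<^sub>R B"] pAB by simp
    then show "((\<lambda>t. f (x + t) (y + 2 * x * t)) has_real_derivative 0) (at 0)"
      unfolding f_def M_def by (simp add: algebra_simps)
  qed
  then show ?thesis by (simp add: f_def A_def B_def algebra_simps)
qed

section \<open>Units whose conjugation preserves the function\<close>

definition cinv :: "band \<Rightarrow> band \<Rightarrow> bool" where
  "cinv a b \<longleftrightarrow> per N a \<and> per N b \<and> a * b = 1 \<and> b * a = 1 \<and> (\<forall>L. per N L \<longrightarrow> \<Phi> (a * L * b) = \<Phi> L)"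

definition cunit :: "band \<Rightarrow> bool" where "cunit a \<longleftrightarrow> (\<exists>b. cinv a b)"

lemma cunit_square_zero: "per N n \<Longrightarrow> n * n = 0 \<Longrightarrow> cunit (1 + n)"
  unfolding cunit_def cinv_def using invariant_square_zero[of n]
  by (intro exI[of _ "1 - n"]) (simp add: algebra_simps)

lemma cunit_square_zero': "per N n \<Longrightarrow> n * n = 0 \<Longrightarrow> cunit (1 - n)"
  using cunit_square_zero[of "- n"] by simp

lemma cunit_central:
  assumes "per N z" "per N w" "z * w = 1" "w * z = 1" "\<And>M. per N M \<Longrightarrow> z * M = M * z"
  shows "cunit z"
  unfolding cunit_def cinv_def using assms by (intro exI[of _ w]) (simp add: mult.assoc)

lemma cunit_mult:
  assumes "cunit a" "cunit b"
  shows "cunit (a * b)"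
proof -
  obtain a' b' where a: "cinv a a'" and b: "cinv b b'" using assms by (auto simp: cunit_def)
  have "cinv (a * b) (b' * a')"
    unfolding cinv_def
  proof (intro conjI allI impI)
    show "per N (a * b)" "per N (b' * a')" using a b by (simp_all add: cinv_def)
    have "a * b * (b' * a') = a * (b * b') * a'" "b' * a' * (a * b) = b' * (a' * a) * b"
      by (simp_all only: mult.assoc)
    then show "a * b * (b' * a') = 1" "b' * a' * (a * b) = 1" using a b by (simp_all add: cinv_def)
    fix L assume L: "per N L"
    have "\<Phi> (a * (b * L * b') * a') = \<Phi> L" using a b L by (simp add: cinv_def)
    then show "\<Phi> (a * b * L * (b' * a')) = \<Phi> L" by (simp add: mult.assoc)
  qed
  then show ?thesis by (auto simp: cunit_def)
qed

text \<open>Whitehead's factorization of a diagonal matrix with entries u', u into transvections.\<close>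

lemma cunit_whitehead:
  assumes xy: "per N x" "per N y" and u: "per N u" "per N u'" "u * u' = 1" "u' * u = 1"
    and cu: "\<And>M. per N M \<Longrightarrow> u * M = M * u" "\<And>M. per N M \<Longrightarrow> u' * M = M * u'"
    and sq: "x * x = 0" "y * y = 0" "x * y * x = x" "y * x * y = y"
  shows "cunit (1 - x * y - y * x + u' * (x * y) + u * (y * x))"
proof -
  have w: "cunit (1 - X * Y - Y * X + X - Y)"
    if "per N X" "per N Y" "X * X = 0" "Y * Y = 0" "X * Y * X = X" for X Y
    using cunit_mult[OF cunit_mult[OF cunit_square_zero cunit_square_zero'] cunit_square_zero, of X Y X]
      unipotent_triple[of X Y] that by simp
  have uu: "u' * (u * M) = M" "u * (u' * M) = M" for M using u by (simp_all flip: mult.assoc)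
  have X: "(u' * x) * (u * y) = x * y" "(u * y) * (u' * x) = y * x"
    "(u' * x) * (u' * x) = 0" "(u * y) * (u * y) = 0"
  proof -
    have "(u' * x) * (u * y) = u' * (u * x) * y" "(u * y) * (u' * x) = u * (u' * y) * x"
      "(u' * x) * (u' * x) = u' * u' * (x * x)" "(u * y) * (u * y) = u * u * (y * y)"
      using cu(1)[OF xy(1)] cu(2)[OF xy(2)] cu(2)[OF xy(1)] cu(1)[OF xy(2)] by (metis mult.assoc)+
    then show "(u' * x) * (u * y) = x * y" "(u * y) * (u' * x) = y * x"
      "(u' * x) * (u' * x) = 0" "(u * y) * (u * y) = 0" using uu sq by simp_all
  qed
  have XYX: "(u' * x) * (u * y) * (u' * x) = u' * x"
  proof -
    have "(x * y) * (u' * x) = u' * (x * y * x)"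
      using cu(2)[of "x * y"] xy by (simp flip: mult.assoc)
    then show ?thesis by (simp add: X sq)
  qed
  have 1: "cunit (1 - x * y - y * x + u' * x - u * y)"
    using w[of "u' * x" "u * y"] xy u X XYX by simp
  have 2: "cunit (1 - x * y - y * x + (- x) - (- y))"
    using w[of "- x" "- y"] xy sq by simp
  \<comment> \<open>A signed transposition weighted by u' and u, times an unweighted one, is
    diagonal with entries u' and u.\<close>
  have "(1 - x * y - y * x + u' * x - u * y) * (1 - x * y - y * x + (- x) - (- y))
      = 1 - x * y - y * x + u' * (x * y) + u * (y * x)"
  proof -
    have s: "x * (x * M) = 0" "y * (y * M) = 0" "x * (y * x) = x" "y * (x * y) = y"
      "x * (y * (x * M)) = x * M" "y * (x * (y * M)) = y * M" for M
      using sq by (simp_all flip: mult.assoc)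
    show ?thesis
      using sq by (simp add: algebra_simps s)
  qed
  then show ?thesis using cunit_mult[OF 1 2] by simp
qed

lemma dvd_small: "\<bar>d\<bar> < int N \<Longrightarrow> int N dvd d \<longleftrightarrow> d = 0"
  using zdvd_imp_le[of "int N" "\<bar>d\<bar>"] by auto

text \<open>The matrix diag(1, ..., 1, d), d = 1 - b lambda^N, has determinant d and is in general
  no product of transvections. With u^N = d it equals u times diag(u', ..., u', u^(N-1)): the first
  factor is central, the second has determinant 1 and is a product of N - 1 matrices of Whitehead's
  type.\<close>

lemma cunit_diagonal:
  "cunit (1 - b *\<^sub>R (Es (int N) * eb N (int N - 1)))"
proof -
  have N0: "N > 0" using N by simp
  obtain u u' where u: "per N u" "per N u'" "u * u' = 1" "u' * u = 1" "u ^ N = 1 - b *\<^sub>R Es (int N)"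
    and cu: "\<And>M. per N M \<Longrightarrow> u * M = M * u" "\<And>M. per N M \<Longrightarrow> u' * M = M * u'"
    using central_root[OF N0] by metis
  define e where "e = eb N (int N - 1)"
  define S where "S K = (\<Sum>k<K. eb N (int k))" for K
  have pS: "per N (S K)" for K by (simp add: S_def)
  have Sorth: "S K * eb N j = 0" if "\<And>k. k < K \<Longrightarrow> \<not> int N dvd int k - j" for K j
    unfolding S_def sum_distrib_right by (rule sum.neutral) (simp add: eb_mult that)
  \<comment> \<open>The first K diagonal entries are u' and the last is u^K; a Whitehead factor in
    the rows K and N - 1 leads to K + 1.\<close>
  define H where "H K = 1 - S K - e + u' * S K + u ^ K * e" for K
  have "cunit (H K)" if "K \<le> N - 1" for K
    using that
  proof (induction K)
    case 0
    have "H 0 = 1" by (simp add: H_def S_def)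
    then show ?case using cunit_square_zero[of 0] by simp
  next
    case (Suc K)
    define f where "f = eb N (int K)"
    have K: "K < N - 1" using Suc.prems by simp
    \<comment> \<open>Matrix units, up to powers of lambda, between the indices N - 1 and K: a shift
      by K + 1 takes N - 1 to N + K, which is K modulo N.\<close>
    define x y where "x = Es (int K + 1) * e" and "y = Es (- int K - 1) * f"
    have nd: "\<not> int N dvd int K - (int N - 1)" "\<not> int N dvd int N - 1 - int K"
      using K by (subst dvd_small; force)+
    have x': "x = f * Es (int K + 1)"
    proof -
      have "f * Es (int K + 1) = Es (int K + 1) * eb N (- 1)" by (simp add: f_def eb_shift)
      moreover have "eb N (- 1) = e" unfolding e_def by (rule eb_cong) simp
      ultimately show ?thesis by (simp add: x_def)
    qed
    have y': "y = e * Es (- int K - 1)"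
    proof -
      have "e * Es (- int K - 1) = Es (- int K - 1) * eb N (int N + int K)" by (simp add: e_def eb_shift)
      moreover have "eb N (int N + int K) = f" unfolding f_def by (rule eb_cong) simp
      ultimately show ?thesis by (simp add: y_def)
    qed
    have ef: "e * e = e" "f * f = f" "e * f = 0" "f * e = 0"
      using nd by (simp_all add: e_def f_def eb_mult)
    have E: "Es (int K + 1) * Es (- int K - 1) = 1" "Es (- int K - 1) * Es (int K + 1) = 1"
      by (simp_all add: Es_mult Es_0)
    have xy: "x * y = f"
    proof -
      have "x * y = f * (Es (int K + 1) * Es (- int K - 1)) * f" by (simp only: x' y_def mult.assoc)
      then show ?thesis by (simp add: E ef)
    qed
    have yx: "y * x = e"
    proof -
      have "y * x = e * (Es (- int K - 1) * Es (int K + 1)) * e" by (simp only: y' x_def mult.assoc)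
      then show ?thesis by (simp add: E ef)
    qed
    have xx: "x * x = 0" "y * y = 0"
    proof -
      have "x * x = (Es (int K + 1) * e) * (f * Es (int K + 1))" using x_def x' by metis
      also have "\<dots> = Es (int K + 1) * (e * f) * Es (int K + 1)" by (simp only: mult.assoc)
      finally show "x * x = 0" by (simp add: ef)
      have "y * y = (Es (- int K - 1) * f) * (e * Es (- int K - 1))" using y_def y' by metis
      also have "\<dots> = Es (- int K - 1) * (f * e) * Es (- int K - 1)" by (simp only: mult.assoc)
      finally show "y * y = 0" by (simp add: ef)
    qed
    have xyx: "x * y * x = x" "y * x * y = y"
    proof -
      have "f * f * Es (int K + 1) = f * Es (int K + 1)" "e * e * Es (- int K - 1) = e * Es (- int K - 1)"
        by (simp_all add: ef)
      then show "x * y * x = x" "y * x * y = y" unfolding xy yx by (simp_all add: x' y' mult.assoc)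
    qed
    have "cunit (1 - x * y - y * x + u' * (x * y) + u * (y * x))"
      by (rule cunit_whitehead[OF _ _ u(1-4) cu xx xyx]) (simp_all add: x_def y_def e_def f_def)
    then have h: "cunit (1 - f - e + u' * f + u * e)" unfolding xy yx .
    have Sf: "S K * f = 0" unfolding f_def
      by (rule Sorth, subst dvd_small) (use K in auto)
    have Se: "S K * e = 0" unfolding e_def
      by (rule Sorth, subst dvd_small) (use K in auto)
    have Hf: "H K * f = f" "H K * e = u ^ K * e"
      unfolding H_def using Sf Se ef by (simp_all add: algebra_simps)
    have "H K * (1 - f - e + u' * f + u * e) = H K - H K * f - H K * e + u' * (H K * f) + u * (H K * e)"
    proof -
      have p: "per N (H K)" using u pS by (simp add: H_def e_def)
      have "H K * (u' * f) = u' * (H K * f)" "H K * (u * e) = u * (H K * e)"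
        using cu[OF p] by (simp_all flip: mult.assoc)
      then show ?thesis by (simp add: algebra_simps)
    qed
    also have "\<dots> = H (Suc K)"
      unfolding Hf unfolding H_def by (simp add: S_def f_def algebra_simps)
    finally show ?case using cunit_mult[OF Suc.IH h] Suc.prems by simp
  qed
  then have "cunit (u * H (N - 1))"
    using cunit_mult[OF cunit_central[OF u(1-4) cu(1)]] by simp
  moreover have "S (N - 1) = 1 - e"
    using sum_eb_pred[OF N0] by (simp add: S_def e_def)
  moreover have "u * H (N - 1) = 1 - e + u ^ N * e" if "S (N - 1) = 1 - e"
  proof -
    have "H (N - 1) = u' * (1 - e) + u ^ (N - 1) * e" unfolding H_def that by simp
    then have "u * H (N - 1) = (u * u') * (1 - e) + (u * u ^ (N - 1)) * e"
      by (simp only: distrib_left mult.assoc)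
    also have "u * u ^ (N - 1) = u ^ N" using N0 by (metis power_minus_mult power_commutes)
    finally show ?thesis using u by simp
  qed
  moreover have "1 - e + u ^ N * e = 1 - b *\<^sub>R (Es (int N) * eb N (int N - 1))"
    by (simp add: u(5) e_def algebra_simps)
  ultimately show ?thesis by simp
qed

text \<open>Gaussian elimination. Without its corner the matrix is the product of the transvections
  1 - \<alpha> E e_k, k < N - 1. Dividing it out leaves 1 - W, where W lives in the last column and
  is a finite geometric series in \<alpha> E. The diagonal entry \<alpha>^N lambda^N of that column
  is treated by \<open>cunit_diagonal\<close>, and the rest of the column gives a
  transvection.\<close>

lemma cunit_Fb: "cunit (Fb \<alpha>)"
proof -
  have N0: "N > 0" using N by simp
  define e where "e = eb N (int N - 1)"
  define g where "g K = 1 - \<alpha> *\<^sub>R (\<Sum>k<K. Es 1 * eb N (int k))" for K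
  have EE: "(Es 1 * eb N j) * (Es 1 * eb N k) = 0" if "\<not> int N dvd j - 1 - k" for j k
  proof -
    have "(Es 1 * eb N j) * (Es 1 * eb N k) = Es 1 * (eb N j * Es 1) * eb N k" by (simp only: mult.assoc)
    also have "\<dots> = Es 1 * (Es 1 * (eb N (j - 1) * eb N k))" unfolding eb_shift by (simp only: mult.assoc)
    finally show ?thesis using that by (simp add: eb_mult)
  qed
  have "cunit (g K)" if "K \<le> N - 1" for K
    using that
  proof (induction K)
    case 0
    then show ?case using cunit_square_zero[of 0] by (simp add: g_def)
  next
    case (Suc K)
    let ?n = "\<alpha> *\<^sub>R (Es 1 * eb N (int K))"
    have "\<not> int N dvd int K - 1 - int K" using N by (subst dvd_small) auto
    from EE[OF this] have "cunit (1 - ?n)"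
      by (intro cunit_square_zero') simp_all
    moreover have "(\<Sum>k<K. Es 1 * eb N (int k)) * (Es 1 * eb N (int K)) = 0"
      unfolding sum_distrib_right
    proof (rule sum.neutral, rule ballI, rule EE)
      fix k assume "k \<in> {..<K}"
      then show "\<not> int N dvd int k - 1 - int K" using Suc.prems by (subst dvd_small) auto
    qed
    then have "g K * (1 - ?n) = g (Suc K)"
      by (simp add: g_def algebra_simps)
    ultimately show ?case using cunit_mult[OF Suc.IH] Suc.prems by force
  qed
  then have cg: "cunit (g (N - 1))" by simp
  have S: "(\<Sum>k<N - 1. eb N (int k)) = 1 - e"
    using sum_eb_pred[OF N0] by (simp add: e_def)
  have gN: "g (N - 1) = 1 - \<alpha> *\<^sub>R (Es 1 * (1 - e))"
    unfolding g_def S[symmetric] sum_distrib_left ..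
  define W where "W = (\<Sum>i<N. \<alpha> ^ Suc i *\<^sub>R (Es (int (Suc i)) * e))"
  have pW: "per N W" by (simp add: W_def e_def)
  have ee: "e * e = e" by (simp add: e_def eb_mult)
  have We: "W * e = W" unfolding W_def sum_distrib_right by (simp add: mult.assoc ee)
  have eE: "e * (Es (int (Suc i)) * e) = (if i = N - 1 then Es (int N) * e else 0)" if "i < N" for i
  proof -
    have "e * (Es (int (Suc i)) * e) = (e * Es (int (Suc i))) * e" by (simp only: mult.assoc)
    also have "\<dots> = Es (int (Suc i)) * (eb N (int N - 1 - int (Suc i)) * e)"
      unfolding e_def eb_shift by (simp only: mult.assoc)
    also have "eb N (int N - 1 - int (Suc i)) * e = (if int N dvd - int (Suc i) then e else 0)"
    proof -
      have "eb N (int N - 1 - int (Suc i)) = e" if "int N dvd - int (Suc i)"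
        unfolding e_def by (rule eb_cong) (use that in \<open>simp del: of_nat_Suc\<close>)
      moreover have "int N - 1 - int (Suc i) - (int N - 1) = - int (Suc i)" by simp
      ultimately show ?thesis unfolding e_def eb_mult by presburger
    qed
    also have "int N dvd - int (Suc i) \<longleftrightarrow> i = N - 1"
      using that dvd_imp_le[of N "Suc i"] by (auto simp del: of_nat_Suc)
    finally show ?thesis using N by auto
  qed
  have eW: "e * W = \<alpha> ^ N *\<^sub>R (Es (int N) * e)"
  proof -
    have "e * W = (\<Sum>i<N. \<alpha> ^ Suc i *\<^sub>R (e * (Es (int (Suc i)) * e)))"
      by (simp add: W_def sum_distrib_left)
    also have "\<dots> = (\<Sum>i<N. if i = N - 1 then \<alpha> ^ N *\<^sub>R (Es (int N) * e) else 0)"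
      by (rule sum.cong[OF refl]) (use N in \<open>auto simp: eE simp del: of_nat_Suc power_Suc\<close>)
    finally show ?thesis using N by simp
  qed
  \<comment> \<open>Telescoping: \<alpha> E moves each term of W to the next, and the overflow is
    \<alpha> E e W because e W is the last term.\<close>
  have EW: "\<alpha> *\<^sub>R (Es 1 * W) = W - \<alpha> *\<^sub>R (Es 1 * e) + \<alpha> *\<^sub>R (Es 1 * (e * W))"
  proof -
    define a where "a i = \<alpha> ^ Suc i *\<^sub>R (Es (int (Suc i)) * e)" for i
    have step: "\<alpha> *\<^sub>R (Es 1 * a i) = a (Suc i)" for i
      by (simp add: a_def Es_mult flip: mult.assoc)
    have "\<alpha> *\<^sub>R (Es 1 * W) = (\<Sum>i<N. \<alpha> *\<^sub>R (Es 1 * a i))"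
      by (simp add: W_def a_def sum_distrib_left scaleR_sum_right)
    also have "\<dots> = (\<Sum>i<N. a (Suc i))" by (simp only: step)
    also have "\<dots> = W + a N - a 0"
      using sum_lessThan_telescope[of a N] by (simp add: W_def a_def sum_subtractf algebra_simps)
    also have "a N = \<alpha> *\<^sub>R (Es 1 * (e * W))"
      unfolding eW by (simp add: a_def Es_mult add.commute flip: mult.assoc)
    finally show ?thesis by (simp add: a_def algebra_simps)
  qed
  have "g (N - 1) * (1 - W) = Fb \<alpha>"
  proof -
    have "g (N - 1) * W = W - \<alpha> *\<^sub>R (Es 1 * W) + \<alpha> *\<^sub>R (Es 1 * (e * W))"
      unfolding gN by (simp add: algebra_simps)
    also have "\<dots> = \<alpha> *\<^sub>R (Es 1 * e)" by (simp add: EW)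
    finally have gW: "g (N - 1) * W = \<alpha> *\<^sub>R (Es 1 * e)" .
    show ?thesis
      unfolding right_diff_distrib gW unfolding gN by (simp add: Fb_def Eb_eq_Es algebra_simps)
  qed
  moreover have "(1 - e * W) * (1 - (W - e * W)) = 1 - W"
  proof -
    have "W * (e * M) = W * M" for M using We by (simp flip: mult.assoc)
    then show ?thesis by (simp add: algebra_simps)
  qed
  moreover have "cunit (1 - (W - e * W))"
  proof (rule cunit_square_zero')
    have "W * (e * M) = W * M" for M using We by (simp flip: mult.assoc)
    then show "(W - e * W) * (W - e * W) = 0" by (simp add: algebra_simps)
  qed (simp add: pW e_def)
  moreover have "cunit (1 - e * W)"
    unfolding eW using cunit_diagonal[of "\<alpha> ^ N"] by (simp add: e_def)
  ultimately show ?thesis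
    using cunit_mult[OF cg cunit_mult] by metis
qed

text \<open>Conjugation maps lines to lines, so invariance can be differentiated along them;
  nondegeneracy of the trace form then identifies the gradient.\<close>

lemma gradient_conjugate:
  assumes "cinv a b" and L: "per N L"
  shows "g (b * L * a) = b * g L * a"
proof -
  have ab: "per N a" "per N b" "a * b = 1" "b * a = 1" and inv: "\<And>L. per N L \<Longrightarrow> \<Phi> (a * L * b) = \<Phi> L"
    using assms(1) by (auto simp: cinv_def)
  have inv': "\<Phi> (b * M * a) = \<Phi> M" if "per N M" for M
  proof -
    have "a * (b * M * a) * b = (a * b) * M * (a * b)" by (simp only: mult.assoc)
    then show ?thesis using inv[of "b * M * a"] that ab by simp
  qed
  show ?thesis
  proof (rule tr_nondegenerate[of N])
    fix M assume M: "per N M"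
    let ?M = "a * M * b"
    have e: "b * (L + \<epsilon> *\<^sub>R ?M) * a = b * L * a + \<epsilon> *\<^sub>R M" for \<epsilon>
    proof -
      have "b * ?M * a = (b * a) * M * (b * a)" by (simp only: mult.assoc)
      then show ?thesis using ab by (simp add: algebra_simps)
    qed
    have "\<Phi> (b * L * a + \<epsilon> *\<^sub>R M) = \<Phi> (L + \<epsilon> *\<^sub>R ?M)" for \<epsilon>
      using inv'[of "L + \<epsilon> *\<^sub>R ?M"] ab L M by (simp add: e)
    then have "((\<lambda>\<epsilon>. \<Phi> (b * L * a + \<epsilon> *\<^sub>R M)) has_real_derivative tr N (g L * ?M)) (at 0)"
      using gradient[OF L, of ?M] ab M by simp
    then have "tr N (g (b * L * a) * M) = tr N (g L * ?M)"
      using gradient[of "b * L * a" M] ab L M by (intro DERIV_unique) simp_all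
    also have "\<dots> = tr N (b * g L * a * M)"
      using tr_commute[of N "g L * a * M" b] ab per_g[OF L] M by (simp add: mult.assoc)
    finally show "tr N (g (b * L * a) * M) = tr N (b * g L * a * M)" .
  qed (use N ab L per_g in auto)
qed

end

section \<open>The flows\<close>

lemma constant_diagonal_commute:
  assumes "diagonal d" "\<And>j. ent d j j = ent d (j - 1) (j - 1)"
  shows "d * A = A * d"
proof -
  have "ent d j j = ent d 0 0" for j
  proof (induction j rule: int_induct[of _ 0])
    case (step1 i)
    then show ?case using assms(2)[of "i + 1"] by simp
  next
    case (step2 i)
    then show ?case using assms(2)[of i] by simp
  qed simp
  then have "d = ent d 0 0 *\<^sub>R 1"
    using assms(1) by (intro band_eqI) (auto simp: ent_simps diagonal_def)
  then show ?thesis by (metis mult.left_neutral mult.right_neutral mult_scaleR_left mult_scaleR_right)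
qed

text \<open>F raises grades by at most one, so of the strictly negative part only grade -1 can spill
  over, and it reaches the diagonal at most.\<close>

lemma neg_mult_Fb:
  "neg (Fb \<alpha> * w) = Fb \<alpha> * neg w - zer (Fb \<alpha> * neg w)" "zer (Fb \<alpha> * w) = zer w + zer (Fb \<alpha> * neg w)"
  "neg (w * Fb \<alpha>) = neg w * Fb \<alpha> - zer (neg w * Fb \<alpha>)" "zer (w * Fb \<alpha>) = zer w + zer (neg w * Fb \<alpha>)"
  by (rule band_eqI, auto simp: Fb_def algebra_simps ent_simps restr.rep_eq ent_Eb_mult)+

text \<open>In the second form of the field, the spill-over terms of \<open>neg_mult_Fb\<close>
  cancel against the diagonal parts, and the same diagonal matrix \<kappa> remains on both sides.
  Its consecutive entries agree by \<open>Wb_shift\<close>; so it is scalar and commutes with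
  T.\<close>

lemma hvf_factorized:
  assumes N: "N \<ge> 2" and per: "per N T" "per N Y" "per N w"
    and u: "T * Y = Fb \<alpha> * w" and v: "Y * T = w * Fb \<alpha>"
  shows "hvf N T Y = T * neg w * Fb \<alpha> - Fb \<alpha> * neg w * T"
proof -
  define \<kappa> where "\<kappa> = kdiag N (w * Fb \<alpha>) (Fb \<alpha> * w) - zer w"
  have "\<kappa> * T = T * \<kappa>"
  proof (rule constant_diagonal_commute)
    show "diagonal \<kappa>" by (simp add: \<kappa>_def)
    fix j
    define D where "D = w * Fb \<alpha> - Fb \<alpha> * w"
    have "per N D" "tr N D = 0"
      using per tr_commute[of N w "Fb \<alpha>"] by (simp_all add: D_def)
    from Wb_shift[OF N this, of j]
    show "ent \<kappa> j j = ent \<kappa> (j - 1) (j - 1)"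
      unfolding \<kappa>_def kdiag_def D_def[symmetric] unfolding D_def
      by (simp add: ent_simps restr.rep_eq Fb_def ent_Eb_mult algebra_simps) (simp add: field_simps)
  qed
  moreover have "hvf N T Y = (\<kappa> - Fb \<alpha> * neg w) * T - T * (\<kappa> - neg w * Fb \<alpha>)"
    unfolding hvf_alt(2) u v neg_mult_Fb[where \<alpha> = \<alpha> and w = w] \<kappa>_def by simp
  ultimately show ?thesis
    by (simp add: left_diff_distrib right_diff_distrib mult.assoc)
qed


section \<open>The flow in coordinates on the submanifold\<close>

lemma lFinv_emb:
  assumes N: "N > 0" and h: "per N h" "Fb \<alpha> * h = 1" "h * Fb \<alpha> = 1"
  shows "lFinv N \<alpha> = emb N h"
  unfolding lFinv_def
proof (rule the_equality)
  show "ser N (emb N h) \<and> lmul N (lF N \<alpha>) (emb N h) = lI N \<and> lmul N (emb N h) (lF N \<alpha>) = lI N"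
    using N h by (simp add: ser_emb lF_emb lI_emb emb_lmul)
  fix Y assume Y: "ser N Y \<and> lmul N (lF N \<alpha>) Y = lI N \<and> lmul N Y (lF N \<alpha>) = lI N"
  then obtain B where B: "per N B" "Y = emb N B" using ser_imp_emb[OF N] by metis
  have "emb N (Fb \<alpha> * B) = emb N 1"
    using Y N B by (simp add: lF_emb lI_emb emb_lmul)
  then have "Fb \<alpha> * B = 1" using emb_inject[OF N, of "Fb \<alpha> * B" 1] B by simp
  then have "h * (Fb \<alpha> * B) = h" by simp
  then have "B = h" using h by (simp flip: mult.assoc)
  then show "Y = emb N h" using B by simp
qed

lemma tangentT_emb:
  assumes "N > 0" "per N V" "grade_le 0 V" "grade_ge (- int m) V"
  shows "tangentT N m (emb N V)"
proof -
  have "emb N V = (\<lambda>p r s. \<Sum>c\<in>coords N m. cf c V * emb N (bc N c) p r s)"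
    unfolding emb_combination using tangent_decomposition[OF assms] by simp
  also have "\<dots> = (\<lambda>p r s. \<Sum>c\<in>coords N m. coord N c (emb N V) * cbasis N c p r s)"
    using assms by (simp add: coord_emb cbasis_emb)
  finally show ?thesis by (simp add: tangentT_def)
qed

lemma hvf_TT:
  assumes N: "N \<ge> 2" and X: "per N X"
  shows "grade_le 0 (hvf N (TT N m x) X)" "grade_ge (- int m) (hvf N (TT N m x) X)"
    "c \<in> coords N m \<Longrightarrow> cf c (hvf N (TT N m x) X) = - qb N (TT N m x) (TT N m x) X (bd N c)"
proof -
  show "grade_le 0 (hvf N (TT N m x) X)"
  proof (rule grade_le_hvf[OF N per_TT X])
    show "TT N m x = 1 *\<^sub>R Eb + (\<Sum>c\<in>coords N m. x c *\<^sub>R bc N c)" by (simp add: TT_def)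
  qed (intro grade_le_sum grade_le_simps grade_bc)
  show "grade_ge (- int m) (hvf N (TT N m x) X)"
    by (rule grade_ge_hvf[OF grade_TT(1)])
  show "cf c (hvf N (TT N m x) X) = - qb N (TT N m x) (TT N m x) X (bd N c)" if c: "c \<in> coords N m"
    using tr_bd[OF c, of "hvf N (TT N m x) X"] tr_commute[of N "hvf N (TT N m x) X" "bd N c"]
      qb_hvf[OF per_TT X, of "bd N c"] X by simp
qed

text \<open>The gradient Y and the one assembled from its coordinate derivatives differ by an
  element annihilating the tangent space; as Hamiltonian fields are tangent, the bracket does not
  see the difference.\<close>

lemma qb_TT_gradient:
  assumes N: "N \<ge> 2" and Y: "per N Y" and X: "per N X"
    and y: "\<And>c. c \<in> coords N m \<Longrightarrow> y c = tr N (Y * bc N c)"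
  shows "qb N (TT N m x) (TT N m x) (\<Sum>c\<in>coords N m. y c *\<^sub>R bd N c) X = qb N (TT N m x) (TT N m x) Y X"
proof -
  let ?T = "TT N m x" and ?C = "coords N m"
  define V where "V = hvf N ?T X"
  have pV: "per N V" using X by (simp add: V_def)
  have V: "V = (\<Sum>c\<in>?C. cf c V *\<^sub>R bc N c)"
    unfolding V_def by (rule tangent_decomposition) (use hvf_TT[OF N X] N X in auto)
  have trV: "qb N ?T ?T Z X = tr N (Z * V)" if "per N Z" for Z
    using qb_skew[of N ?T ?T Z X] qb_hvf[of N ?T X Z] that X by (simp add: V_def)
  have "tr N (Y * V) = (\<Sum>c\<in>?C. cf c V * y c)"
    by (subst V) (simp add: sum_distrib_left tr_sum y)
  moreover have "tr N ((\<Sum>c\<in>?C. y c *\<^sub>R bd N c) * V) = (\<Sum>c\<in>?C. cf c V * y c)"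
  proof -
    have "tr N (bd N c * V) = cf c V" if "c \<in> ?C" for c
      using tr_bd[OF that, of V] tr_commute[of N V "bd N c"] pV by simp
    then show ?thesis by (simp add: sum_distrib_right tr_sum mult.commute)
  qed
  ultimately show ?thesis using trV[OF Y] trV[of "\<Sum>c\<in>?C. y c *\<^sub>R bd N c"] by simp
qed

context ad_invariant
begin

lemma gradient_pullback:
  assumes h: "per N h" and c: "c \<in> coords N m"
  shows "pd (\<lambda>y. \<Phi> (TT N m y * h)) c x = tr N (h * g (TT N m x * h) * bc N c)"
proof -
  let ?A = "TT N m x * h" and ?M = "bc N c * h"
  have "TT N m (x(c := t)) * h = ?A - x c *\<^sub>R ?M + t *\<^sub>R ?M" for t
    unfolding TT_update[OF c] by (simp add: algebra_simps)
  then have "((\<lambda>t. \<Phi> (TT N m (x(c := t)) * h)) has_real_derivative tr N (g ?A * ?M)) (at (x c))"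
    using gradient_at[of "?A - x c *\<^sub>R ?M" ?M "x c"] h by simp
  then have "pd (\<lambda>y. \<Phi> (TT N m y * h)) c x = tr N (g ?A * ?M)"
    unfolding pd_def by (rule DERIV_imp_deriv)
  also have "\<dots> = tr N (h * g ?A * bc N c)"
    using tr_commute[of N "g ?A * bc N c" h] per_g[of ?A] h by (simp add: mult.assoc)
  finally show ?thesis .
qed

text \<open>By covariance of the gradient under conjugation a single matrix w governs both sides: C1
  and C2, here without their factor 1/2, are F R(w) and R(w) F with R(w) = w - 2 neg w. Since T w F
  = F w T, the terms in w cancel and neg w survives, as in \<open>hvf_factorized\<close>.\<close>

lemma flow_hamiltonian:
  fixes \<alpha> x m
  assumes "cinv (Fb \<alpha>) h"
  defines "T \<equiv> TT N m x"
  defines "C1 \<equiv> Fb \<alpha> * (h * (T * h * g (T * h)) - 2 *\<^sub>R neg (h * (T * h * g (T * h))))"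
    and "C2 \<equiv> (h * T * g (h * T) * h - 2 *\<^sub>R neg (h * T * g (h * T) * h)) * Fb \<alpha>"
  shows "(1/2) *\<^sub>R (T * C2) - (1/2) *\<^sub>R (C1 * T) = - hvf N T (h * g (T * h))"
proof -
  let ?F = "Fb \<alpha>" and ?g = "g (T * h)"
  have h: "per N h" "?F * h = 1" "h * ?F = 1" using assms(1) by (simp_all add: cinv_def)
  have hF: "h * (?F * M) = M" "?F * (h * M) = M" for M using h by (simp_all flip: mult.assoc)
  have pT: "per N T" by (simp add: T_def)
  have pg: "per N ?g" using per_g h pT by simp
  define w where "w = h * (T * h * ?g)"
  have pw: "per N w" using h pT pg by (simp add: w_def)
  have comm: "?g * (T * h) = T * h * ?g" using g_commute[of "T * h"] h pT by simp
  have "g (h * T) = h * ?g * ?F"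
    using gradient_conjugate[OF assms(1), of "T * h"] h pT by (simp add: mult.assoc)
  then have w2: "h * T * g (h * T) * h = w"
    using h by (simp add: w_def mult.assoc hF)
  have u: "T * (h * ?g) = ?F * w" by (simp add: w_def mult.assoc hF)
  have v: "h * ?g * T = w * ?F"
  proof -
    have "h * ?g * T = h * (?g * (T * h)) * ?F" using h by (simp add: mult.assoc)
    then show ?thesis unfolding comm by (simp add: w_def)
  qed
  have "T * (w * ?F) = T * (h * ?g) * T" by (simp only: v[symmetric] mult.assoc)
  then have eq: "T * (w * ?F) = ?F * w * T" by (simp only: u)
  have "hvf N T (h * ?g) = T * neg w * ?F - ?F * neg w * T"
    by (rule hvf_factorized[OF N pT _ pw u v]) (simp add: h pg)
  moreover have "T * C2 - C1 * T = 2 *\<^sub>R (?F * neg w * T - T * neg w * ?F)"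
    unfolding C1_def C2_def w2 unfolding w_def[symmetric] using eq by (simp add: algebra_simps)
  then have "(1/2) *\<^sub>R (T * C2) - (1/2) *\<^sub>R (C1 * T) = ?F * neg w * T - T * neg w * ?F"
    by (simp flip: scaleR_right_diff_distrib)
  ultimately show ?thesis by simp
qed

end

lemma invariant_flow:
  fixes N m :: nat and \<alpha> :: real and x and \<phi> :: "lser \<Rightarrow> real" and G :: "lser \<Rightarrow> lser"
  assumes N: "N \<ge> 2"
    and gradient: "\<And>L M. ser N L \<Longrightarrow> ser N M \<Longrightarrow>
      ((\<lambda>\<epsilon>. \<phi> (ladd L (lscale \<epsilon> M))) has_real_derivative lpair N (G L) M) (at 0)"
    and ser_G: "\<And>L. ser N L \<Longrightarrow> ser N (G L)"
    and commute: "\<And>L. ser N L \<Longrightarrow> lbr N (G L) L = lzero"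
  defines "T \<equiv> Tpt N m x" and "Fi \<equiv> lFinv N \<alpha>" and "F \<equiv> lF N \<alpha>"
  defines "L1 \<equiv> lmul N T Fi" and "L2 \<equiv> lmul N Fi T"
  defines "C1 \<equiv> lscale (1/2) (lmul N F (Rop (lmul N Fi (lmul N L1 (G L1)))))"
    and "C2 \<equiv> lscale (1/2) (lmul N (Rop (lmul N (lmul N L2 (G L2)) Fi)) F)"
  defines "V \<equiv> lsub (lmul N T C2) (lmul N C1 T)"
    and "\<psi> \<equiv> \<lambda>y. \<phi> (lmul N (Tpt N m y) Fi)"
  shows "tangentT N m V \<and> (\<Sum>c\<in>coords N m. pd f c x * coord N c V) = ib2 N m \<psi> f x"
proof -
  have N0: "N > 0" using N by simp
  define \<Phi> where "\<Phi> A = \<phi> (emb N A)" for A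
  \<comment> \<open>The preimage of the gradient under \<open>emb\<close>; it exists by
    \<open>ser_imp_emb\<close>, and the commutation with A is carried back by injectivity.\<close>
  define g where "g A = (SOME B. per N B \<and> emb N B = G (emb N A))" for A
  have g: "per N (g A) \<and> emb N (g A) = G (emb N A)" if "per N A" for A
  proof -
    obtain B where "per N B" "G (emb N A) = emb N B" using ser_imp_emb[OF N0 ser_G[OF ser_emb]] by metis
    then show ?thesis unfolding g_def by (intro someI_ex[of "\<lambda>B. per N B \<and> emb N B = G (emb N A)"]) auto
  qed
  interpret ad_invariant N \<Phi> g
  proof
    fix A M assume A: "per N A" and M: "per N M"
    show "((\<lambda>\<epsilon>. \<Phi> (A + \<epsilon> *\<^sub>R M)) has_real_derivative tr N (g A * M)) (at 0)"
      using gradient[OF ser_emb ser_emb, of A M] g[OF A] A M N0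
      by (simp add: \<Phi>_def emb_linear flip: lpair_emb)
  next
    fix A assume A: "per N A"
    then show "per N (g A)" using g by simp
    have "G (emb N A) = emb N (g A)" using g[OF A] by simp
    then have "lbr N (G (emb N A)) (emb N A) = emb N (g A * A - A * g A)"
      using g[OF A, THEN conjunct1] A N0 by (simp only: lbr_def emb_lmul emb_linear(2) per_mult)
    then have "emb N (g A * A - A * g A) = emb N 0"
      using commute[OF ser_emb, of A] by (simp only: emb_linear(4))
    then have "g A * A - A * g A = 0"
      using emb_inject[OF N0, of "g A * A - A * g A" 0] g A by simp
    then show "g A * A = A * g A" by simp
  qed (rule N)
  obtain h where ci: "cinv (Fb \<alpha>) h" using cunit_Fb by (auto simp: cunit_def)
  then have h: "per N h" "Fb \<alpha> * h = 1" "h * Fb \<alpha> = 1" by (simp_all add: cinv_def)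
  have Fi: "Fi = emb N h" unfolding Fi_def by (rule lFinv_emb[OF N0 h])
  let ?T = "TT N m x" and ?C = "coords N m"
  have T: "T = emb N ?T" unfolding T_def by (rule Tpt_emb[OF N0])
  have F: "F = emb N (Fb \<alpha>)" unfolding F_def by (rule lF_emb[OF N0])
  have pg: "per N (g A)" if "per N A" for A using g[OF that] by simp
  have Gemb: "G (emb N A) = emb N (g A)" if "per N A" for A using g[OF that] by simp
  define Y where "Y = h * g (?T * h)"
  have pY: "per N Y" using h pg by (simp add: Y_def)
  have C1: "C1 = emb N ((1/2) *\<^sub>R (Fb \<alpha> * (h * (?T * h * g (?T * h)) - 2 *\<^sub>R neg (h * (?T * h * g (?T * h))))))"
    unfolding C1_def L1_def T F Fi using h pg N0
    by (simp add: emb_lmul Gemb projections_emb emb_linear)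
  have C2: "C2 = emb N ((1/2) *\<^sub>R ((h * ?T * g (h * ?T) * h - 2 *\<^sub>R neg (h * ?T * g (h * ?T) * h)) * Fb \<alpha>))"
    unfolding C2_def L2_def T F Fi using h pg N0
    by (simp add: emb_lmul Gemb projections_emb emb_linear)
  have "V = emb N (?T * ((1/2) *\<^sub>R ((h * ?T * g (h * ?T) * h - 2 *\<^sub>R neg (h * ?T * g (h * ?T) * h)) * Fb \<alpha>))
      - ((1/2) *\<^sub>R (Fb \<alpha> * (h * (?T * h * g (?T * h)) - 2 *\<^sub>R neg (h * (?T * h * g (?T * h)))))) * ?T)"
    unfolding V_def T C1 C2 using h pg N0 by (simp only: emb_lmul per_simps per_mult per_TT per_Fb per_restr emb_linear(2))
  also have "\<dots> = emb N (- hvf N ?T Y)"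
    using flow_hamiltonian[OF ci, of m x] by (simp add: Y_def)
  finally have V: "V = emb N (- hvf N ?T Y)" .
  have tangent: "tangentT N m V"
    unfolding V using hvf_TT(1,2)[OF N pY] pY N0 by (intro tangentT_emb) simp_all
  have coordV: "coord N c V = qb N ?T ?T Y (bd N c)" if "c \<in> ?C" for c
    unfolding V using coord_emb[OF that, of "- hvf N ?T Y"] hvf_TT(3)[OF N pY that, of x] pY
    by (simp add: cf_def ent_simps)
  have \<psi>: "\<psi> = (\<lambda>y. \<Phi> (TT N m y * h))"
    unfolding \<psi>_def \<Phi>_def Fi using h N0 by (simp add: Tpt_emb emb_lmul)
  have pd\<psi>: "pd \<psi> c x = tr N (Y * bc N c)" if "c \<in> ?C" for c
    unfolding \<psi> Y_def by (rule gradient_pullback[OF h(1) that])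
  let ?X = "\<lambda>f. \<Sum>c\<in>?C. pd f c x *\<^sub>R bd N c"
  \<comment> \<open>The minus sign in V matches the one in \<open>qb_hvf\<close>, so the derivative
    of f along V is the bracket with \<psi> in the first slot.\<close>
  have "(\<Sum>c\<in>?C. pd f c x * coord N c V) = qb N ?T ?T Y (?X f)"
    unfolding qb_sum qb_linear by (rule sum.cong[OF refl]) (simp add: coordV)
  also have "\<dots> = qb N ?T ?T (?X \<psi>) (?X f)"
    by (rule qb_TT_gradient[symmetric, OF N pY _ pd\<psi>]) simp_all
  also have "\<dots> = ib2 N m \<psi> f x"
    unfolding ib2_def Tpt_emb[OF N0] gradT_emb by (rule pb2_emb[OF N0, symmetric]) simp_all
  finally show ?thesis using tangent by simp
qed

theorem mainTheorem10:
  fixes N m :: nat and \<alpha> :: real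
  assumes "N \<ge> 2" and "m \<ge> 1"
  shows "(\<forall>c1 c2 :: real. poissonT N m (\<lambda>f g y. c1 * ib1 N m \<alpha> f g y + c2 * ib2 N m f g y))
    \<and> (\<forall>(\<phi> :: lser \<Rightarrow> real) (G :: lser \<Rightarrow> lser).
         (\<forall>L M. ser N L \<and> ser N M \<longrightarrow>
              ((\<lambda>\<epsilon>. \<phi> (ladd L (lscale \<epsilon> M))) has_real_derivative lpair N (G L) M) (at 0)) \<and>
         (\<forall>L. ser N L \<longrightarrow> ser N (G L)) \<and>
         (\<forall>L. ser N L \<longrightarrow> lbr N (G L) L = lzero)
       \<longrightarrow>
       (\<forall>x. let T = Tpt N m x; Fi = lFinv N \<alpha>; F = lF N \<alpha>;
               L1 = lmul N T Fi; L2 = lmul N Fi T;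
               C1 = lscale (1/2) (lmul N F (Rop (lmul N Fi (lmul N L1 (G L1)))));
               C2 = lscale (1/2) (lmul N (Rop (lmul N (lmul N L2 (G L2)) Fi)) F);
               V = lsub (lmul N T C2) (lmul N C1 T);
               \<psi> = (\<lambda>y. \<phi> (lmul N (Tpt N m y) Fi))
           in tangentT N m V \<and>
              (\<forall>f. smoothT N m f \<longrightarrow>
                 (\<Sum>c\<in>coords N m. pd f c x * coord N c V) = ib2 N m \<psi> f x)))"
  using brackets_compatible[OF assms(1)] invariant_flow[OF assms(1)] unfolding Let_def by blast

end
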